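(* Let $N\ge1$, $K\ge 0$, $\varphi\in L^1_K$, and let $f\in C(\mathbf{R}^N\times(0,\infty)\times\mathbf{R}\times\mathbf{R}^N)$ satisfy, for some constants $C>0$ and $A>1$, $$|f(x,t,p,q)|\le C(1+t)^{-A}\big(|p|+(1+t)^{1/2}|q|\big)\quad\text{for all }(x,t,p,q)\in\mathbf{R}^N\times(0,\infty)\times\mathbf{R}\times\mathbf{R}^N .$$ Then there exists a solution $u$ of the Cauchy problem $\partial_t u=\Delta u+f(x,t,u,\nabla u)$ in $\mathbf{R}^N\times(0,\infty)$, $u(x,0)=\varphi(x)$, with the following properties: (i) $u,\nabla u\in C(\mathbf{R}^N\times(0,\infty))$; (ii) for every $q\in[1,\infty]$ and $l\in[0,K]$, $$\sup_{0<t<\infty}t^{\frac N2(1-\frac1q)}\Big[\|u(t)\|_q+t^{1/2}\|\nabla_x u(t)\|_q\Big]<\infty,\qquad \sup_{0<t<\infty}(1+t)^{-\frac l2}\Big[|||u(t)|||_l+t^{1/2}|||\nabla_x u(t)|||_l\Big]<\infty;$$ (iii) the limit $$M:=\lim_{t\to\infty}\int_{\mathbf{R}^N}u(x,t)\,dx=\int_{\mathbf{R}^N}\varphi\,dx+\int_0^\infty\!\!\int_{\mathbf{R}^N}f(x,t,u(x,t),\nabla u(x,t))\,dx\,dt$$ exists and, for every $q\in[1,\infty]$ and $j=0,1$, $$\lim_{t\to\infty}t^{\frac N2(1-\frac1q)+\frac j2}\big\|\nabla^j[u(t)-Mg(t)]\big\|_q=0.$$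
   Context: Notation: $G(x,t)=(4\pi t)^{-N/2}\exp(-|x|^2/(4t))$; $g(x,t)=G(x,1+t)$. $\|\cdot\|_q$ is the norm of $L^q(\mathbf{R}^N)$; for $m\ge0$, $|||f|||_m=\int_{\mathbf{R}^N}(1+|x|)^m|f(x)|\,dx$; $L^1_K=\{\phi\in L^1(\mathbf{R}^N):|||\phi|||_K<\infty\}$. A solution of the Cauchy problem $\partial_tu=\Delta u+f(x,t,u,\nabla u)$, $u(\cdot,0)=\varphi$ (with $\varphi\in L^1(\mathbf{R}^N)$) is a function $u\in L^\infty_{loc}(0,\infty:W^{1,1}(\mathbf{R}^N))$ such that $u(x,t)=\int G(x-\xi,t)\varphi(\xi)d\xi+\int_0^t\int G(x-\xi,t-s)f(\xi,s,u(\xi,s),\nabla u(\xi,s))\,d\xi\,ds$ for almost all $(x,t)\in\mathbf{R}^N\times(0,\infty)$. *)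

theory Defs
  imports "HOL-Analysis.Analysis" "HOL-Probability.Probability"
begin

definition heat_kernel :: "'a::euclidean_space \<Rightarrow> real \<Rightarrow> real" where
  "heat_kernel x t = (4 * pi * t) powr (- real DIM('a) / 2) * exp (- (norm x)\<^sup>2 / (4 * t))"

definition gauss :: "'a::euclidean_space \<Rightarrow> real \<Rightarrow> real" where
  "gauss x t = heat_kernel x (1 + t)"

definition grad :: "('a::euclidean_space \<Rightarrow> real) \<Rightarrow> 'a \<Rightarrow> 'a" where
  "grad h x = (THE D. (h has_derivative (\<lambda>v. D \<bullet> v)) (at x))"

definition Lp_norm :: "ereal \<Rightarrow> ('a::euclidean_space \<Rightarrow> 'b::real_normed_vector) \<Rightarrow> ereal" where
  "Lp_norm q h =
     (if q = \<infinity> then esssup lborel (\<lambda>x. ereal (norm (h x)))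
      else (let I = (\<integral>\<^sup>+ x. ennreal (norm (h x) powr real_of_ereal q) \<partial>lborel)
            in if I = \<infinity> then \<infinity> else ereal (enn2real I powr (1 / real_of_ereal q))))"

definition inv_exp :: "ereal \<Rightarrow> real" where
  "inv_exp q = (if q = \<infinity> then 0 else 1 / real_of_ereal q)"

definition wnorm :: "real \<Rightarrow> ('a::euclidean_space \<Rightarrow> 'b::real_normed_vector) \<Rightarrow> ennreal" where
  "wnorm m h = (\<integral>\<^sup>+ x. ennreal ((1 + norm x) powr m * norm (h x)) \<partial>lborel)"

definition L1_K :: "real \<Rightarrow> ('a::euclidean_space \<Rightarrow> real) set" where
  "L1_K K = {\<phi>. integrable lborel \<phi> \<and> wnorm K \<phi> < \<infinity>}"

text \<open>Mild solution of u_t = Delta u + f(x,t,u,grad u), u(0) = phi.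
  Du x t is the spatial gradient of u(.,t) at x; u lies in L^infty_loc((0,infty); W^{1,1}).\<close>
definition is_solution ::
  "('a::euclidean_space \<Rightarrow> real \<Rightarrow> real \<Rightarrow> 'a \<Rightarrow> real) \<Rightarrow> ('a \<Rightarrow> real)
    \<Rightarrow> ('a \<Rightarrow> real \<Rightarrow> real) \<Rightarrow> ('a \<Rightarrow> real \<Rightarrow> 'a) \<Rightarrow> bool" where
  "is_solution f \<phi> u Du \<longleftrightarrow>
     (\<lambda>(x, t). u x t) \<in> borel_measurable (lborel \<Otimes>\<^sub>M lborel) \<and>
     (\<lambda>(x, t). Du x t) \<in> borel_measurable (lborel \<Otimes>\<^sub>M lborel) \<and>
     (\<forall>t>0. integrable lborel (\<lambda>x. u x t) \<and> integrable lborel (\<lambda>x. Du x t) \<and>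
            (\<forall>x. ((\<lambda>y. u y t) has_derivative (\<lambda>v. Du x t \<bullet> v)) (at x))) \<and>
     (\<forall>a b. 0 < a \<longrightarrow> a \<le> b \<longrightarrow>
        (\<exists>B. \<forall>t\<in>{a..b}. (\<integral>x. \<bar>u x t\<bar> \<partial>lborel) + (\<integral>x. norm (Du x t) \<partial>lborel) \<le> B)) \<and>
     (AE z in lborel \<Otimes>\<^sub>M lborel. 0 < snd z \<longrightarrow>
        (let x = fst z; t = snd z;
             F = (\<lambda>(\<xi>, s). heat_kernel (x - \<xi>) (t - s) * f \<xi> s (u \<xi> s) (Du \<xi> s))
         in set_integrable (lborel \<Otimes>\<^sub>M lborel) (UNIV \<times> {0<..<t}) F \<and>
            u x t = (\<integral>\<xi>. heat_kernel (x - \<xi>) t * \<phi> \<xi> \<partial>lborel)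
                    + (LINT w:UNIV \<times> {0<..<t}|lborel \<Otimes>\<^sub>M lborel. F w)))"

end

theory Submission
  imports Defs "HOL-Complex_Analysis.Great_Picard" "HOL-Real_Asymp.Real_Asymp"
begin

text \<open>Everything is dominated pointwise by \<open>H(x,t) = \<integral> G(x - \<xi>, 2t) \<bar>\<phi>(\<xi>)\<bar> d\<xi>\<close>. Since \<open>G(\<cdot>,t)\<close> and
  \<open>t\<^sup>1\<^sup>/\<^sup>2 \<bar>\<nabla>G(\<cdot>,t)\<bar>\<close> are at most a constant times \<open>G(\<cdot>,2t)\<close>, and the semigroup propagates \<open>H\<close>, the Duhamel
  operator preserves the bounds \<open>\<bar>u\<bar> \<le> \<beta>(t) H\<close>, \<open>t\<^sup>1\<^sup>/\<^sup>2 \<bar>\<nabla>u\<bar> \<le> \<beta>(t) H\<close> as soon as \<open>\<beta>\<close> is a supersolution of a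
  scalar integral inequality of Abel type; \<open>A > 1\<close> makes a bounded \<open>\<beta>\<close> exist. As \<open>f\<close> is merely continuous,
  a solution is obtained as a limit of solutions of equations with a delayed nonlinearity, which are
  equicontinuous because \<open>\<integral> \<bar>(G,\<nabla>G)(z - \<zeta>) - (G,\<nabla>G)(z' - \<zeta>)\<bar> \<rho>(\<zeta>) d\<zeta> \<rightarrow> 0\<close> as \<open>z' \<rightarrow> z\<close>. The bounds on
  \<open>H\<close> give (ii). For (iii), \<open>u - M g\<close> is a superposition of differences of heat kernels over sources \<open>(\<xi>,s)\<close>: those
  with \<open>\<bar>\<xi>\<bar> < \<delta> t\<^sup>1\<^sup>/\<^sup>2\<close>, \<open>s < \<delta> t\<close> contribute little by scaling and uniform continuity, the others with
  \<open>s \<le> t/2\<close> carry little mass, and those with \<open>s > t/2\<close> are controlled by the decay of the nonlinearity.\<close>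

subsection \<open>The heat kernel and its spatial gradient\<close>

text \<open>Doubling the time buys room: half of a Gaussian exponent absorbs the factor |x| / sqrt t
  of the gradient, and the other half is again a heat kernel. The loss is 2^(N/2) once per integral,
  and the semigroup law for doubled times returns exactly \<open>H\<close>, so that only scalar time
  integrals remain. The gradient bound puts s^(-1/2) into the nonlinearity and the gradient of the
  kernel adds (t - s)^(-1/2); this Abel kernel has a finite integral that does not depend on t.

  The delay \<delta> makes the approximate equations explicit in time. The delayed source is cut off
  to s > 2 \<delta>, which keeps s - \<delta> above s / 2 and all bounds independent of \<delta>.

  The majorants of the kernels blow up at the evaluation point and move with it, so near a point
  they have no common integrable bound; only their integrals are known to be continuous. Continuity
  of the potentials therefore rests on Pratt's form of dominated convergence. Value and gradient
  travel together as one pair-valued kernel, since f sees both.\<close>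

lemma powr_minus_half: "x powr (- (1/2)) = 1 / sqrt x" if "0 < x" for x :: real
  using that by (simp add: powr_minus powr_half_sqrt inverse_eq_divide)

lemma heat_kernel_nonneg: "0 \<le> heat_kernel x t"
  by (simp add: heat_kernel_def)

lemma borel_measurable_heat_kernel[measurable (raw)]:
  fixes f :: "'b \<Rightarrow> 'a::euclidean_space"
  assumes [measurable]: "f \<in> borel_measurable M" "g \<in> borel_measurable M"
  shows "(\<lambda>x. heat_kernel (f x) (g x)) \<in> borel_measurable M"
  unfolding heat_kernel_def by measurable

lemma continuous_heat_kernel:
  "continuous (at z) (\<lambda>z. heat_kernel (fst z) (snd z))" if "snd z > 0"
  for z :: "'a::euclidean_space \<times> real"
  unfolding heat_kernel_def using that by (auto intro!: continuous_intros)

lemma heat_kernel_le: "heat_kernel x t \<le> (4 * pi * t) powr (- real DIM('a) / 2)" if "t > 0"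
  for x :: "'a::euclidean_space"
proof -
  have "exp (- (norm x)\<^sup>2 / (4 * t)) \<le> exp 0"
    using that by (subst exp_le_cancel_iff) simp
  then show ?thesis
    unfolding heat_kernel_def by (intro mult_right_le_one_le) auto
qed

text \<open>The factors are centred normal densities of variance 2t, so unit mass reduces by Fubini
  to dimension one.\<close>

lemma heat_kernel_eq_prod:
  fixes x :: "'a::euclidean_space"
  assumes "t > 0"
  shows "heat_kernel x t = (\<Prod>b\<in>Basis. normal_density 0 (sqrt (2 * t)) (x \<bullet> b))"
proof -
  have "(\<Prod>b\<in>Basis. normal_density 0 (sqrt (2 * t)) (x \<bullet> b))
      = (\<Prod>b\<in>(Basis::'a set). 1 / sqrt (4 * pi * t)) * (\<Prod>b\<in>Basis. exp (- (x \<bullet> b)\<^sup>2 / (4 * t)))"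
    unfolding prod.distrib[symmetric] using assms
    by (intro prod.cong) (auto simp: normal_density_def mult_ac)
  also have "(\<Prod>b\<in>(Basis::'a set). 1 / sqrt (4 * pi * t)) = (4 * pi * t) powr (- real DIM('a) / 2)"
  proof -
    define y where "y = 4 * pi * t"
    have y: "0 < y" using assms by (simp add: y_def)
    have "(1 / sqrt y) ^ DIM('a) = (y powr (- (1/2))) powr real DIM('a)"
      using y by (simp add: powr_minus_half powr_realpow)
    also have "\<dots> = y powr (- real DIM('a) / 2)"
      by (simp add: powr_powr)
    finally show ?thesis by (simp add: y_def)
  qed
  also have "(\<Prod>b\<in>Basis. exp (- (x \<bullet> b)\<^sup>2 / (4 * t))) = exp (- (norm x)\<^sup>2 / (4 * t))"
    unfolding exp_sum[OF finite_Basis, symmetric] sum_divide_distrib[symmetric] sum_negf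
    by (subst power2_norm_eq_inner, subst euclidean_inner) (simp add: power2_eq_square)
  finally show ?thesis by (simp add: heat_kernel_def)
qed

section \<open>Unit mass and the semigroup law\<close>

lemma nn_integral_translate:
  fixes f :: "'a::euclidean_space \<Rightarrow> ennreal"
  assumes [measurable]: "f \<in> borel_measurable borel"
  shows "(\<integral>\<^sup>+y. f (y - m) \<partial>lborel) = (\<integral>\<^sup>+y. f y \<partial>lborel)"
proof -
  have "(\<integral>\<^sup>+y. f y \<partial>lborel) = (\<integral>\<^sup>+y. f y \<partial>distr lborel borel ((+) (- m)))"
    by (simp add: lborel_distr_plus)
  also have "\<dots> = (\<integral>\<^sup>+y. f (y - m) \<partial>lborel)"
    by (subst nn_integral_distr) auto
  finally show ?thesis ..
qed

lemma nn_integral_heat_kernel: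
  "(\<integral>\<^sup>+x. ennreal (heat_kernel (x - m) t) \<partial>lborel) = 1" if "t > 0" for m :: "'a::euclidean_space"
proof -
  have "(\<integral>\<^sup>+x. ennreal (heat_kernel (x::'a) t) \<partial>lborel)
     = (\<integral>\<^sup>+x. (\<Prod>b\<in>Basis. ennreal (normal_density 0 (sqrt (2 * t)) (x \<bullet> b))) \<partial>(lborel::'a measure))"
    by (simp add: heat_kernel_eq_prod[OF that] prod_ennreal)
  also have "\<dots> = (\<Prod>b\<in>(Basis::'a set). \<integral>\<^sup>+x. ennreal (normal_density 0 (sqrt (2 * t)) x) \<partial>lborel)"
    by (rule nn_integral_lborel_prod) auto
  also have "\<dots> = 1"
    using that by (subst nn_integral_eq_integral) auto
  finally show ?thesis
    by (subst nn_integral_translate) auto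
qed

text \<open>Completing the square in y: a Gaussian in y centred at a weighted mean of x and z, times
  a factor free of y. Once the Gaussian is integrated out by its unit mass, the semigroup law is
  immediate.\<close>

lemma heat_kernel_mult:
  fixes x y z :: "'a::euclidean_space"
  assumes "a > 0" "b > 0"
  shows "heat_kernel (x - y) a * heat_kernel (y - z) b
    = heat_kernel (x - z) (a + b)
      * heat_kernel (y - ((b / (a + b)) *\<^sub>R x + (a / (a + b)) *\<^sub>R z)) (a * b / (a + b))"
proof -
  define m where "m = (b / (a + b)) *\<^sub>R x + (a / (a + b)) *\<^sub>R z"
  define d where "d = x - z"
  define w where "w = y - m"
  have ab: "a + b \<noteq> 0" using assms by simp
  have xm: "x - m = (a / (a + b)) *\<^sub>R d"
  proof -
    have "x = (a / (a + b) + b / (a + b)) *\<^sub>R x"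
      using ab by (simp add: add_divide_distrib[symmetric])
    then show ?thesis unfolding m_def d_def by (simp add: algebra_simps)
  qed
  have zm: "m - z = (b / (a + b)) *\<^sub>R d"
  proof -
    have "z = (a / (a + b) + b / (a + b)) *\<^sub>R z"
      using ab by (simp add: add_divide_distrib[symmetric])
    then show ?thesis unfolding m_def d_def by (simp add: algebra_simps)
  qed
  have xy: "x - y = (a / (a + b)) *\<^sub>R d - w" and yz: "y - z = w + (b / (a + b)) *\<^sub>R d"
    using xm zm by (simp_all add: w_def algebra_simps)
  \<comment> \<open>The offsets of x and z from the centre \<open>m\<close> are in the proportion a
    : b, so the cross terms of \<open>d\<close> and \<open>w\<close> cancel after division by a and
    b.\<close>
  have "(norm (x - y))\<^sup>2 / a + (norm (y - z))\<^sup>2 / b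
      = (norm d)\<^sup>2 / (a + b) + (norm w)\<^sup>2 * (1 / a + 1 / b)"
  proof -
    define D W I where "D = (norm d)\<^sup>2" and "W = (norm w)\<^sup>2" and "I = d \<bullet> w"
    have 1: "(norm (x - y))\<^sup>2 = (a / (a + b))\<^sup>2 * D - 2 * (a / (a + b)) * I + W"
      unfolding xy D_def W_def I_def power2_norm_eq_inner
      by (simp only: inner_diff_left inner_diff_right inner_scaleR_left inner_scaleR_right
          inner_commute[of w d]) (simp add: power2_eq_square algebra_simps)
    have 2: "(norm (y - z))\<^sup>2 = W + 2 * (b / (a + b)) * I + (b / (a + b))\<^sup>2 * D"
      unfolding yz D_def W_def I_def power2_norm_eq_inner
      by (simp only: inner_add_left inner_add_right inner_scaleR_left inner_scaleR_right
          inner_commute[of w d]) (simp add: power2_eq_square algebra_simps)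
    have "((a / c)\<^sup>2 * D - 2 * (a / c) * I + W) / a + (W + 2 * (b / c) * I + (b / c)\<^sup>2 * D) / b
       = (a + b) / c\<^sup>2 * D + W * (1 / a + 1 / b)" if "c > 0" for c
      using assms that by (simp add: field_simps power2_eq_square)
    from this[of "a + b"] show ?thesis
      unfolding 1 2 D_def[symmetric] W_def[symmetric] using assms by (simp add: power2_eq_square)
  qed
  then have n: "(norm (x - y))\<^sup>2 / a + (norm (y - z))\<^sup>2 / b
      = (norm d)\<^sup>2 / (a + b) + (norm w)\<^sup>2 / (a * b / (a + b))"
    using assms by (simp add: add_divide_distrib[symmetric] divide_simps)
  have q: "- X / (4 * c) = (- 1 / 4) * (X / c)" for X c :: real
    by simp
  have e: "- (norm (x - y))\<^sup>2 / (4 * a) + - (norm (y - z))\<^sup>2 / (4 * b)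
      = - (norm d)\<^sup>2 / (4 * (a + b)) + - (norm w)\<^sup>2 / (4 * (a * b / (a + b)))"
    unfolding q distrib_left[symmetric] n ..
  have p: "(4 * pi * a) powr r * (4 * pi * b) powr r
      = (4 * pi * (a + b)) powr r * (4 * pi * (a * b / (a + b))) powr r" for r
  proof -
    have "(4 * pi * a) * (4 * pi * b) = (4 * pi * (a + b)) * (4 * pi * (a * b / (a + b)))"
      using assms by (simp add: field_simps)
    then show ?thesis
      using assms by (metis powr_mult)
  qed
  have mult4: "(k * l) * (m * n) = (k * m) * (l * n)" for k l m n :: real
    by (simp add: mult_ac)
  show ?thesis
    unfolding m_def[symmetric] w_def[symmetric] d_def[symmetric] heat_kernel_def
    unfolding mult4[of _ "exp _"] p exp_add[symmetric] e ..
qed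

lemma heat_kernel_convolution:
  fixes x z :: "'a::euclidean_space"
  assumes "a > 0" "b > 0"
  shows "(\<integral>\<^sup>+y. ennreal (heat_kernel (x - y) a * heat_kernel (y - z) b) \<partial>lborel)
    = ennreal (heat_kernel (x - z) (a + b))"
  using assms
  by (simp add: heat_kernel_mult ennreal_mult heat_kernel_nonneg nn_integral_cmult
      nn_integral_heat_kernel)

text \<open>The kernel together with its spatial gradient, extended by zero to nonpositive times; this
  encodes the causality restriction \<open>s < t\<close> of the Duhamel integral.\<close>

definition heat_jet :: "'a::euclidean_space \<times> real \<Rightarrow> real \<times> 'a" where
  "heat_jet z = (if snd z > 0 then
     (heat_kernel (fst z) (snd z), - (heat_kernel (fst z) (snd z) / (2 * snd z)) *\<^sub>R fst z) else 0)"

text \<open>The factor t^(-1/2) is the cost of the gradient. On bounded times it also majorises the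
  kernel itself up to a constant, so one scalar function dominates the whole jet.\<close>

definition heat_dom :: "'a::euclidean_space \<times> real \<Rightarrow> real" where
  "heat_dom z = (if snd z > 0 then snd z powr (- (1/2)) * heat_kernel (fst z) (2 * snd z) else 0)"

lemma borel_measurable_fst_borel[measurable]:
  "fst \<in> borel_measurable (borel :: ('b::topological_space \<times> 'c::topological_space) measure)"
  by (intro borel_measurable_continuous_onI continuous_on_fst continuous_on_id)

lemma borel_measurable_snd_borel[measurable]:
  "snd \<in> borel_measurable (borel :: ('b::topological_space \<times> 'c::topological_space) measure)"
  by (intro borel_measurable_continuous_onI continuous_on_snd continuous_on_id)

lemma borel_measurable_heat_jet[measurable]:
  "heat_jet \<in> borel_measurable (borel :: ('a::euclidean_space \<times> real) measure)"
  unfolding heat_jet_def by measurable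

lemma borel_measurable_heat_dom[measurable]:
  "heat_dom \<in> borel_measurable (borel :: ('a::euclidean_space \<times> real) measure)"
  unfolding heat_dom_def by measurable

lemma heat_dom_nonneg: "0 \<le> heat_dom z"
  by (simp add: heat_dom_def heat_kernel_nonneg)

text \<open>Extension by zero endangers continuity only at time 0, where the kernel concentrates. In
  the potentials this corresponds to sources at exactly the evaluation time, which form a null
  set.\<close>

lemma isCont_switch_time:
  fixes f :: "'a::euclidean_space \<times> real \<Rightarrow> 'b::real_normed_vector"
  assumes "snd z \<noteq> 0" "snd z > 0 \<Longrightarrow> isCont f z"
  shows "isCont (\<lambda>z. if snd z > 0 then f z else 0) z"
proof (cases "snd z > 0")
  case True
  have "eventually (\<lambda>z. snd z > (0::real)) (nhds z)"
    using True by (intro eventually_nhds_in_open[of "{z. 0 < snd z}", simplified]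
        open_Collect_less continuous_intros)
  then have "eventually (\<lambda>z. (if snd z > 0 then f z else 0) = f z) (nhds z)"
    by (rule eventually_mono) auto
  then show ?thesis using assms(2)[OF True] by (subst isCont_cong)
next
  case False
  then have "snd z < 0" using assms by simp
  then have "eventually (\<lambda>z. snd z < (0::real)) (nhds z)"
    by (intro eventually_nhds_in_open[of "{z. 0 > snd z}", simplified]
        open_Collect_less continuous_intros)
  then have "eventually (\<lambda>z. (if snd z > 0 then f z else 0) = 0) (nhds z)"
    by (rule eventually_mono) auto
  then show ?thesis by (subst isCont_cong) auto
qed

lemma isCont_heat_jet: "isCont heat_jet z" if "snd z \<noteq> 0"
  unfolding heat_jet_def[abs_def]
  by (rule isCont_switch_time[OF that])
    (auto intro!: continuous_intros continuous_heat_kernel)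

lemma isCont_heat_dom: "isCont heat_dom z" if "snd z \<noteq> 0"
  unfolding heat_dom_def[abs_def] heat_kernel_def
  by (rule isCont_switch_time[OF that]) (auto intro!: continuous_intros)

text \<open>Half of the exponent |x|^2 / (4t) belongs to the kernel of time 2t; the other half is
  kept as a factor that can absorb powers of |x|.\<close>

lemma heat_kernel_double:
  fixes x :: "'a::euclidean_space"
  assumes "t > 0"
  shows "heat_kernel x t = 2 powr (real DIM('a) / 2) * exp (- (norm x)\<^sup>2 / (8 * t)) * heat_kernel x (2 * t)"
proof -
  have "(4 * pi * t) powr (- real DIM('a) / 2)
      = 2 powr (real DIM('a) / 2) * (2 * (4 * pi * t)) powr (- real DIM('a) / 2)"
    using assms by (subst powr_mult) (auto simp: powr_minus)
  then have "(4 * pi * t) powr (- real DIM('a) / 2)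
      = 2 powr (real DIM('a) / 2) * (4 * pi * (2 * t)) powr (- real DIM('a) / 2)"
    by (simp add: mult_ac)
  moreover have "exp (- (norm x)\<^sup>2 / (4 * t)) = exp (- (norm x)\<^sup>2 / (8 * t)) * exp (- (norm x)\<^sup>2 / (4 * (2 * t)))"
    by (simp add: exp_add[symmetric] field_simps)
  ultimately show ?thesis unfolding heat_kernel_def by simp
qed

lemma exp_minus_le_inverse: "exp (- x) \<le> 1 / (1 + x)" if "x \<ge> 0" for x :: real
  using exp_ge_add_one_self[of x] that by (simp add: exp_minus field_simps)

lemma heat_kernel_le_double:
  fixes x :: "'a::euclidean_space"
  assumes "t > 0"
  shows "heat_kernel x t \<le> 2 powr (real DIM('a) / 2) * heat_kernel x (2 * t)"
proof -
  have "exp (- (norm x)\<^sup>2 / (8 * t)) \<le> exp 0"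
    using assms by (subst exp_le_cancel_iff) simp
  then have "2 powr (real DIM('a) / 2) * exp (- (norm x)\<^sup>2 / (8 * t)) \<le> 2 powr (real DIM('a) / 2)"
    by (intro mult_right_le_one_le) auto
  then show ?thesis
    unfolding heat_kernel_double[OF assms, of x] by (rule mult_right_mono[OF _ heat_kernel_nonneg])
qed

text \<open>In the variable y = |x| / sqrt t this says that the spare factor exp (- y^2 / 8) beats y
  / 2, which follows from exp (- r) \<le> 1 / (1 + r) and a square.\<close>

lemma norm_grad_heat_kernel_le:
  fixes x :: "'a::euclidean_space"
  assumes t: "t > 0"
  shows "norm x / (2 * t) * heat_kernel x t
    \<le> 2 powr (real DIM('a) / 2) * (t powr (- (1/2)) * heat_kernel x (2 * t))"
proof -
  define y where "y = norm x / sqrt t"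
  have y: "y \<ge> 0" "norm x = y * sqrt t" "(norm x)\<^sup>2 = y\<^sup>2 * t"
    using t by (auto simp: y_def power_divide)
  have "y / 2 * exp (- (norm x)\<^sup>2 / (8 * t)) \<le> y / 2 * (1 / (1 + y\<^sup>2 / 8))"
    using exp_minus_le_inverse[of "y\<^sup>2/8"] t y by (intro mult_left_mono) auto
  also have "\<dots> \<le> 1"
  proof -
    have "0 \<le> (y - 2)\<^sup>2" by simp
    then have "y / 2 \<le> 1 + y\<^sup>2 / 8" by (simp add: power2_eq_square algebra_simps)
    then show ?thesis by (simp add: field_simps add_pos_nonneg)
  qed
  finally have "y / 2 * exp (- (norm x)\<^sup>2 / (8 * t)) \<le> 1" .
  moreover have "norm x / (2 * t) = t powr (- (1/2)) * (y / 2)"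
    using t y by (simp add: powr_minus_half field_simps)
  ultimately have *: "norm x / (2 * t) * exp (- (norm x)\<^sup>2 / (8 * t)) \<le> t powr (- (1/2))"
    by (metis (no_types, opaque_lifting) mult.assoc mult_left_le powr_ge_zero)
  have "norm x / (2 * t) * heat_kernel x t
      = (norm x / (2 * t) * exp (- (norm x)\<^sup>2 / (8 * t))) * (2 powr (real DIM('a) / 2) * heat_kernel x (2 * t))"
    unfolding heat_kernel_double[OF t, of x] by simp
  also have "\<dots> \<le> t powr (- (1/2)) * (2 powr (real DIM('a) / 2) * heat_kernel x (2 * t))"
    by (intro mult_right_mono *) (auto simp: heat_kernel_nonneg)
  finally show ?thesis by (simp add: mult_ac)
qed

lemma norm_fst_heat_jet_le:
  fixes z :: "'a::euclidean_space \<times> real"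
  assumes "snd z > 0"
  shows "\<bar>fst (heat_jet z)\<bar> \<le> 2 powr (real DIM('a) / 2) * heat_kernel (fst z) (2 * snd z)"
  using heat_kernel_le_double[OF assms, of "fst z"] assms
  by (simp add: heat_jet_def heat_kernel_nonneg)

lemma norm_snd_heat_jet_le:
  fixes z :: "'a::euclidean_space \<times> real"
  shows "norm (snd (heat_jet z)) \<le> 2 powr (real DIM('a) / 2) * heat_dom z"
  using norm_grad_heat_kernel_le[of "snd z" "fst z"]
  by (auto simp: heat_jet_def heat_dom_def heat_kernel_nonneg abs_mult mult_ac)

lemma norm_pair_le: "norm p \<le> norm (fst p) + norm (snd p)"
  by (metis norm_Pair_le prod.collapse)

lemma norm_fst_heat_jet_le':
  fixes z :: "'a::euclidean_space \<times> real"
  assumes "snd z \<le> T"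
  shows "\<bar>fst (heat_jet z)\<bar> \<le> 2 powr (real DIM('a) / 2) * (sqrt T * heat_dom z)"
proof (cases "snd z > 0")
  case True
  have "1 \<le> sqrt T * (snd z powr (- (1/2)))"
    using True assms by (simp add: powr_minus_half field_simps)
  then have "heat_kernel (fst z) (2 * snd z) \<le> sqrt T * heat_dom z"
    using True mult_right_mono[of 1 "sqrt T * (snd z powr (- (1/2)))" "heat_kernel (fst z) (2 * snd z)"]
    by (simp add: heat_dom_def heat_kernel_nonneg mult_ac)
  then have "2 powr (real DIM('a) / 2) * heat_kernel (fst z) (2 * snd z)
     \<le> 2 powr (real DIM('a) / 2) * (sqrt T * heat_dom z)" by simp
  then show ?thesis using norm_fst_heat_jet_le[OF True] by linarith
qed (auto simp: heat_jet_def heat_dom_def)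

lemma norm_heat_jet_le:
  fixes z :: "'a::euclidean_space \<times> real"
  assumes "snd z \<le> T"
  shows "norm (heat_jet z) \<le> 2 powr (real DIM('a) / 2) * ((1 + sqrt T) * heat_dom z)"
  using norm_fst_heat_jet_le'[OF assms] norm_snd_heat_jet_le[of z] norm_pair_le[of "heat_jet z"]
  by (simp add: algebra_simps)

lemma has_derivative_heat_jet:
  fixes x :: "'a::euclidean_space"
  shows "((\<lambda>x. fst (heat_jet (x, t))) has_derivative (\<lambda>v. snd (heat_jet (x, t)) \<bullet> v)) (at x)"
proof (cases "t > 0")
  case True
  have "((\<lambda>x::'a. (norm x)\<^sup>2) has_derivative (\<lambda>v. 2 * (x \<bullet> v))) (at x)"
    unfolding power2_norm_eq_inner
    by (auto intro!: derivative_eq_intros simp: inner_commute)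
  then have "((\<lambda>x. heat_kernel x t) has_derivative
      (\<lambda>v. (4 * pi * t) powr (- real DIM('a) / 2) * (exp (- (norm x)\<^sup>2 / (4 * t)) * (- (2 * (x \<bullet> v)) / (4 * t)))))
      (at x)"
    unfolding heat_kernel_def using True by (auto intro!: derivative_eq_intros)
  also have "(\<lambda>v. (4 * pi * t) powr (- real DIM('a) / 2) * (exp (- (norm x)\<^sup>2 / (4 * t)) * (- (2 * (x \<bullet> v)) / (4 * t))))
     = (\<lambda>v. snd (heat_jet (x, t)) \<bullet> v)"
    using True by (auto simp: heat_jet_def heat_kernel_def field_simps)
  finally show ?thesis using True by (simp add: heat_jet_def)
qed (simp add: heat_jet_def)

text \<open>A larger time improves the exponential, and the prefactor falls by at most 2^(N/2) as
  long as the time at most doubles. This compares a delayed time with the current one.\<close>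

lemma heat_kernel_time_mono:
  fixes x :: "'a::euclidean_space"
  assumes "0 < a" "a \<le> b" "b \<le> 2 * a"
  shows "heat_kernel x a \<le> 2 powr (real DIM('a) / 2) * heat_kernel x b"
proof -
  have "(4 * pi * a) powr (- real DIM('a) / 2) \<le> (4 * pi * (b / 2)) powr (- real DIM('a) / 2)"
    using assms by (intro powr_mono2') auto
  also have "\<dots> = 2 powr (real DIM('a) / 2) * (4 * pi * b) powr (- real DIM('a) / 2)"
  proof -
    have "(4 * pi * (b / 2)) powr r = ((1 / 2) * (4 * pi * b)) powr r" for r
      by (simp add: mult_ac)
    then show ?thesis
      by (simp only: powr_mult powr_divide) (simp add: powr_minus field_simps)
  qed
  finally have 1: "(4 * pi * a) powr (- real DIM('a) / 2)
     \<le> 2 powr (real DIM('a) / 2) * (4 * pi * b) powr (- real DIM('a) / 2)" .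
  have "(norm x)\<^sup>2 / (4 * b) \<le> (norm x)\<^sup>2 / (4 * a)"
    using assms by (intro divide_left_mono) auto
  then have 2: "exp (- (norm x)\<^sup>2 / (4 * a)) \<le> exp (- (norm x)\<^sup>2 / (4 * b))"
    by simp
  have "heat_kernel x a \<le> (2 powr (real DIM('a) / 2) * (4 * pi * b) powr (- real DIM('a) / 2)) * exp (- (norm x)\<^sup>2 / (4 * b))"
    unfolding heat_kernel_def by (rule mult_mono[OF 1 2]) auto
  then show ?thesis
    by (simp add: heat_kernel_def mult.assoc)
qed

subsection \<open>Heat potentials of weighted sources\<close>

text \<open>Pratt's lemma for limit zero: the majorants may move with n as long as their integrals
  converge to the integral of their limit. The part of \<open>f n\<close> below \<open>h\<close> is
  treated by dominated convergence; the excess is at most \<open>g n\<close> minus its truncation at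
  \<open>h\<close>, and the integral of that difference tends to zero.\<close>

lemma integral_tendsto_zero_Pratt:
  fixes f g :: "nat \<Rightarrow> 'b \<Rightarrow> real"
  assumes f[measurable]: "\<And>n. f n \<in> borel_measurable M"
    and g: "\<And>n. integrable M (g n)" and h: "integrable M h"
    and bd: "\<And>n x. 0 \<le> f n x" "\<And>n x. f n x \<le> g n x" "\<And>x. 0 \<le> h x"
    and f0: "AE x in M. (\<lambda>n. f n x) \<longlonglongrightarrow> 0" and gh: "AE x in M. (\<lambda>n. g n x) \<longlonglongrightarrow> h x"
    and lim: "(\<lambda>n. \<integral>x. g n x \<partial>M) \<longlonglongrightarrow> (\<integral>x. h x \<partial>M)"
  shows "(\<lambda>n. \<integral>x. f n x \<partial>M) \<longlonglongrightarrow> 0"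
proof -
  have g_nn: "0 \<le> g n x" for n x using bd(1,2) order_trans by blast
  have [measurable]: "g n \<in> borel_measurable M" "h \<in> borel_measurable M" for n
    using g h by auto
  have fi: "integrable M (f n)" for n
    by (rule Bochner_Integration.integrable_bound[OF g[of n]]) (use bd g_nn in auto)
  have mi: "integrable M (\<lambda>x. min (f n x) (h x))" for n
    by (rule Bochner_Integration.integrable_bound[OF h]) (use bd in auto)
  have mj: "integrable M (\<lambda>x. min (g n x) (h x))" for n
    by (rule Bochner_Integration.integrable_bound[OF h]) (use bd g_nn in auto)
  have "(\<lambda>n. \<integral>x. min (f n x) (h x) \<partial>M) \<longlonglongrightarrow> (\<integral>x. 0 \<partial>M)"
  proof (rule integral_dominated_convergence[OF _ _ h])
    show "AE x in M. (\<lambda>n. min (f n x) (h x)) \<longlonglongrightarrow> 0"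
      using f0
    proof eventually_elim
      case (elim x)
      have "(\<lambda>n. min (f n x) (h x)) \<longlonglongrightarrow> min 0 (h x)"
        by (intro tendsto_intros elim)
      then show ?case using bd(3)[of x] by simp
    qed
  qed (use bd in \<open>auto intro!: AE_I2\<close>)
  then have l1: "(\<lambda>n. \<integral>x. min (f n x) (h x) \<partial>M) \<longlonglongrightarrow> 0" by simp
  have l2: "(\<lambda>n. \<integral>x. min (g n x) (h x) \<partial>M) \<longlonglongrightarrow> (\<integral>x. h x \<partial>M)"
  proof (rule integral_dominated_convergence[OF _ _ h])
    show "AE x in M. (\<lambda>n. min (g n x) (h x)) \<longlonglongrightarrow> h x"
      using gh
    proof eventually_elim
      case (elim x)
      have "(\<lambda>n. min (g n x) (h x)) \<longlonglongrightarrow> min (h x) (h x)"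
        by (intro tendsto_intros elim)
      then show ?case by simp
    qed
  qed (use bd g_nn in \<open>auto intro!: AE_I2\<close>)
  have le: "(\<integral>x. f n x \<partial>M) \<le> (\<integral>x. min (f n x) (h x) \<partial>M) + ((\<integral>x. g n x \<partial>M) - (\<integral>x. min (g n x) (h x) \<partial>M))" for n
  proof -
    have "(\<integral>x. f n x \<partial>M) \<le> (\<integral>x. min (f n x) (h x) + (g n x - min (g n x) (h x)) \<partial>M)"
    proof (rule integral_mono[OF fi])
      show "f n x \<le> min (f n x) (h x) + (g n x - min (g n x) (h x))" for x
        using bd(2)[of n x] by (auto simp: min_def)
    qed (use mi mj g in auto)
    also have "\<dots> = (\<integral>x. min (f n x) (h x) \<partial>M) + ((\<integral>x. g n x \<partial>M) - (\<integral>x. min (g n x) (h x) \<partial>M))"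
      using mi mj g by simp
    finally show ?thesis .
  qed
  have "(\<lambda>n. (\<integral>x. min (f n x) (h x) \<partial>M) + ((\<integral>x. g n x \<partial>M) - (\<integral>x. min (g n x) (h x) \<partial>M))) \<longlonglongrightarrow>
    0 + ((\<integral>x. h x \<partial>M) - (\<integral>x. h x \<partial>M))"
    by (intro tendsto_intros l1 l2 lim)
  then have sm: "(\<lambda>n. (\<integral>x. min (f n x) (h x) \<partial>M) + ((\<integral>x. g n x \<partial>M) - (\<integral>x. min (g n x) (h x) \<partial>M))) \<longlonglongrightarrow> 0"
    by simp
  show ?thesis
    by (rule tendsto_sandwich[OF _ _ tendsto_const sm]) (use le bd in \<open>auto intro!: always_eventually\<close>)
qed

lemma norm_integral_le:
  fixes f :: "'b \<Rightarrow> 'c::{banach,second_countable_topology}"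
  assumes "integrable M f" "integrable M g" "\<And>x. x \<in> space M \<Longrightarrow> norm (f x) \<le> g x"
  shows "norm (\<integral>x. f x \<partial>M) \<le> (\<integral>x. g x \<partial>M)"
  using assms by (intro order_trans[OF integral_norm_bound integral_mono]) auto

text \<open>The remainder is written as an average over the segment instead of a value at an
  intermediate point, so that it can be exchanged with the integral over the sources. Nonpositive
  elapsed times are included because the jet vanishes there.\<close>

lemma heat_kernel_taylor:
  fixes x v \<xi> :: "'a::euclidean_space"
  shows "ennreal \<bar>fst (heat_jet (x + v, t)) - fst (heat_jet (x, t)) - snd (heat_jet (x, t)) \<bullet> v\<bar>
    \<le> ennreal (norm v) * (\<integral>\<^sup>+\<theta>\<in>{0..1}. ennreal (norm (heat_jet (x + \<theta> *\<^sub>R v, t) - heat_jet (x, t))) \<partial>lborel)"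
proof (cases "t > 0")
  case True
  define \<psi> where "\<psi> \<theta> = fst (heat_jet (x + \<theta> *\<^sub>R v, t)) - \<theta> * (snd (heat_jet (x, t)) \<bullet> v)" for \<theta> :: real
  define \<psi>' where "\<psi>' \<theta> = (snd (heat_jet (x + \<theta> *\<^sub>R v, t)) - snd (heat_jet (x, t))) \<bullet> v" for \<theta> :: real
  have d: "(\<psi> has_vector_derivative \<psi>' \<theta>) (at \<theta> within S)" for \<theta> S
  proof -
    have "((\<lambda>\<theta>. x + \<theta> *\<^sub>R v) has_derivative (\<lambda>h. h *\<^sub>R v)) (at \<theta>)"
      by (auto intro!: derivative_eq_intros)
    from has_derivative_compose[OF this has_derivative_heat_jet[of "t"]]
    have "((\<lambda>\<theta>. fst (heat_jet (x + \<theta> *\<^sub>R v, t))) has_derivative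
       (\<lambda>h. snd (heat_jet (x + \<theta> *\<^sub>R v, t)) \<bullet> (h *\<^sub>R v))) (at \<theta>)" by simp
    moreover have "((\<lambda>\<theta>. \<theta> * (snd (heat_jet (x, t)) \<bullet> v)) has_derivative
       (\<lambda>h. h * (snd (heat_jet (x, t)) \<bullet> v))) (at \<theta>)"
      by (auto intro!: derivative_eq_intros)
    ultimately have "(\<psi> has_derivative (\<lambda>h. h *\<^sub>R \<psi>' \<theta>)) (at \<theta>)"
      unfolding \<psi>_def \<psi>'_def
      by (rule has_derivative_eq_rhs[OF has_derivative_diff])
        (simp add: fun_eq_iff algebra_simps inner_diff_left)
    then show ?thesis
      by (auto simp: has_vector_derivative_def intro: has_derivative_at_withinI)
  qed
  have jc: "continuous_on S (\<lambda>\<theta>. heat_jet (x + \<theta> *\<^sub>R v, t))" for S :: "real set"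
  proof (rule continuous_at_imp_continuous_on, safe)
    fix \<theta> :: real
    have "isCont (\<lambda>\<theta>. (x + \<theta> *\<^sub>R v, t)) \<theta>" by (intro continuous_intros)
    then show "isCont (\<lambda>\<theta>. heat_jet (x + \<theta> *\<^sub>R v, t)) \<theta>"
      by (rule isCont_o2[OF _ isCont_heat_jet]) (use True in auto)
  qed
  then have c: "continuous_on {0..1} \<psi>'"
    unfolding \<psi>'_def by (intro continuous_intros)
  have "has_bochner_integral lborel (\<lambda>\<theta>. indicator {0..1} \<theta> *\<^sub>R \<psi>' \<theta>) (\<psi> 1 - \<psi> 0)"
    by (rule has_bochner_integral_FTC_Icc[OF _ d c]) auto
  then have i: "integrable lborel (\<lambda>\<theta>. indicator {0..1} \<theta> *\<^sub>R \<psi>' \<theta>)"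
    and e: "(\<integral>\<theta>. indicator {0..1} \<theta> *\<^sub>R \<psi>' \<theta> \<partial>lborel) = \<psi> 1 - \<psi> 0"
    by (auto simp: has_bochner_integral_iff)
  have "ennreal \<bar>fst (heat_jet (x + v, t)) - fst (heat_jet (x, t)) - snd (heat_jet (x, t)) \<bullet> v\<bar>
      = ennreal (norm (\<psi> 1 - \<psi> 0))"
    by (simp add: \<psi>_def)
  also have "\<dots> \<le> (\<integral>\<^sup>+\<theta>. ennreal (norm (indicator {0..1} \<theta> *\<^sub>R \<psi>' \<theta>)) \<partial>lborel)"
    unfolding e[symmetric] by (rule integral_norm_bound_ennreal[OF i])
  also have "\<dots> \<le> (\<integral>\<^sup>+\<theta>. ennreal (norm v) * (ennreal (norm (heat_jet (x + \<theta> *\<^sub>R v, t) - heat_jet (x, t))) * indicator {0..1} \<theta>) \<partial>lborel)"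
  proof (rule nn_integral_mono)
    fix \<theta> :: real
    have "\<bar>\<psi>' \<theta>\<bar> \<le> norm (snd (heat_jet (x + \<theta> *\<^sub>R v, t)) - snd (heat_jet (x, t))) * norm v"
      unfolding \<psi>'_def by (rule Cauchy_Schwarz_ineq2)
    also have "\<dots> \<le> norm (heat_jet (x + \<theta> *\<^sub>R v, t) - heat_jet (x, t)) * norm v"
      unfolding snd_diff[symmetric] by (intro mult_right_mono norm_ge_zero) (metis norm_snd_le prod.collapse)
    finally have "\<bar>\<psi>' \<theta>\<bar> \<le> norm v * norm (heat_jet (x + \<theta> *\<^sub>R v, t) - heat_jet (x, t))"
      by (simp add: mult.commute)
    then have "ennreal \<bar>\<psi>' \<theta>\<bar> \<le> ennreal (norm v) * ennreal (norm (heat_jet (x + \<theta> *\<^sub>R v, t) - heat_jet (x, t)))"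
      by (subst ennreal_mult[symmetric]) (auto intro: ennreal_leI)
    then show "ennreal (norm (indicator {0..1} \<theta> *\<^sub>R \<psi>' \<theta>))
      \<le> ennreal (norm v) * (ennreal (norm (heat_jet (x + \<theta> *\<^sub>R v, t) - heat_jet (x, t))) * indicator {0..1} \<theta>)"
      by (cases "\<theta> \<in> {0..1}") auto
  qed
  also have "\<dots> = ennreal (norm v) * (\<integral>\<^sup>+\<theta>\<in>{0..1}. ennreal (norm (heat_jet (x + \<theta> *\<^sub>R v, t) - heat_jet (x, t))) \<partial>lborel)"
    by (rule nn_integral_cmult) measurable
  finally show ?thesis .
qed (simp add: heat_jet_def)

text \<open>The initial datum (sources at the points \<open>(\<xi>, 0)\<close>) and the Duhamel term (sources spread over
  space-time) are both instances of the following setting.\<close>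

locale heat_source = sigma_finite_measure M
  for M :: "'b measure" +
  fixes pos :: "'b \<Rightarrow> 'a::euclidean_space \<times> real" and \<rho> :: "'b \<Rightarrow> real" and V :: "'a \<times> real \<Rightarrow> real"
  assumes pos_measurable[measurable]: "pos \<in> borel_measurable M"
    and \<rho>_measurable[measurable]: "\<rho> \<in> borel_measurable M"
    and \<rho>_nonneg: "0 \<le> \<rho> b"
    and time_nonneg: "\<rho> b \<noteq> 0 \<Longrightarrow> 0 \<le> snd (pos b)"
    and time_neq: "t > 0 \<Longrightarrow> AE b in M. snd (pos b) \<noteq> t"
    and dom: "snd z > 0 \<Longrightarrow> has_bochner_integral M (\<lambda>b. heat_dom (z - pos b) * \<rho> b) (V z)"
    and V_cont: "continuous_on {z. snd z > 0} V"
begin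

text \<open>The mean oscillation of the jet between two evaluation points, weighted by \<rho>. It is
  the single quantity behind continuity, equicontinuity and differentiability of the
  potentials.\<close>

definition modulus :: "'a \<times> real \<Rightarrow> 'a \<times> real \<Rightarrow> real" where
  "modulus z z' = (\<integral>b. norm (heat_jet (z - pos b) - heat_jet (z' - pos b)) * \<rho> b \<partial>M)"

definition potential :: "('b \<Rightarrow> real) \<Rightarrow> 'a \<times> real \<Rightarrow> real \<times> 'a" where
  "potential F z = (\<integral>b. F b *\<^sub>R heat_jet (z - pos b) \<partial>M)"

lemma jet_bound:
  assumes "snd z \<le> T"
  shows "norm (heat_jet (z - pos b)) * \<rho> b \<le> 2 powr (real DIM('a) / 2) * (1 + sqrt T) * (heat_dom (z - pos b) * \<rho> b)"
proof (cases "\<rho> b = 0")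
  case False
  \<comment> \<open>Source times are nonnegative wherever \<rho> is nonzero, so the elapsed time
    never exceeds the evaluation time.\<close>
  then have "snd (z - pos b) \<le> T" using time_nonneg[of b] assms by simp
  from mult_right_mono[OF norm_heat_jet_le[OF this] \<rho>_nonneg[of b]] show ?thesis
    by (simp add: mult_ac)
qed simp

lemma jet_integrable:
  assumes z: "snd z > 0" and [measurable]: "F \<in> borel_measurable M" and F: "\<And>b. \<bar>F b\<bar> \<le> L * \<rho> b"
  shows "integrable M (\<lambda>b. F b *\<^sub>R heat_jet (z - pos b))"
proof (rule Bochner_Integration.integrable_bound)
  let ?c = "2 powr (real DIM('a) / 2) * (1 + sqrt (snd z))"
  show "integrable M (\<lambda>b. \<bar>L\<bar> * (?c * (heat_dom (z - pos b) * \<rho> b)))"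
    using dom[OF z] by (auto simp: has_bochner_integral_iff)
  show "AE b in M. norm (F b *\<^sub>R heat_jet (z - pos b)) \<le> norm (\<bar>L\<bar> * (?c * (heat_dom (z - pos b) * \<rho> b)))"
  proof (rule AE_I2)
    fix b
    have "norm (F b *\<^sub>R heat_jet (z - pos b)) \<le> (\<bar>L\<bar> * \<rho> b) * norm (heat_jet (z - pos b))"
      using F[of b] mult_right_mono[OF abs_ge_self[of L] \<rho>_nonneg[of b]]
      by (auto intro!: mult_right_mono)
    also have "\<dots> \<le> \<bar>L\<bar> * (?c * (heat_dom (z - pos b) * \<rho> b))"
      using mult_left_mono[OF jet_bound[of z "snd z" b], of "\<bar>L\<bar>"] by (simp add: mult_ac)
    finally show "norm (F b *\<^sub>R heat_jet (z - pos b)) \<le> norm (\<bar>L\<bar> * (?c * (heat_dom (z - pos b) * \<rho> b)))"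
      by simp
  qed
qed measurable

lemma modulus_integrable:
  assumes "snd z > 0" "snd z' > 0"
  shows "integrable M (\<lambda>b. norm (heat_jet (z - pos b) - heat_jet (z' - pos b)) * \<rho> b)"
proof -
  have "integrable M (\<lambda>b. \<rho> b *\<^sub>R heat_jet (z - pos b))" "integrable M (\<lambda>b. \<rho> b *\<^sub>R heat_jet (z' - pos b))"
    using assms \<rho>_nonneg by (auto intro!: jet_integrable[where L = 1])
  from integrable_norm[OF Bochner_Integration.integrable_diff[OF this]] show ?thesis
    unfolding scaleR_diff_right[symmetric] using \<rho>_nonneg by (simp add: mult.commute)
qed

text \<open>The jets converge for every source whose time differs from that of \<open>z0\<close>,
  and the majorants built from \<open>heat_dom\<close> have integrals given by the continuous
  function V. These are the hypotheses of Pratt's lemma.\<close>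

lemma modulus_tendsto_zero:
  assumes z0: "snd z0 > 0"
  shows "((\<lambda>z. modulus z z0) \<longlongrightarrow> 0) (at z0)"
  unfolding tendsto_at_iff_sequentially
proof (intro allI impI)
  fix X assume X: "X \<longlonglongrightarrow> z0"
  have s: "(\<lambda>n. snd (X n)) \<longlonglongrightarrow> snd z0" using X by (rule tendsto_snd)
  from order_tendstoD(1)[OF s z0] order_tendstoD(2)[OF s, of "2 * snd z0"] z0
  have "eventually (\<lambda>n. 0 < snd (X n) \<and> snd (X n) < 2 * snd z0) sequentially"
    by (simp add: eventually_conj)
  then obtain n0 where n0: "\<And>n. n \<ge> n0 \<Longrightarrow> 0 < snd (X n) \<and> snd (X n) < 2 * snd z0"
    by (auto simp: eventually_sequentially)
  \<comment> \<open>Dropping finitely many terms keeps all times positive and below twice the limit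
    time, which makes the constant in \<open>jet_bound\<close> uniform in n.\<close>
  define Y where "Y n = X (n + n0)" for n
  have Y: "Y \<longlonglongrightarrow> z0" unfolding Y_def using X by (rule LIMSEQ_ignore_initial_segment)
  have Y0: "0 < snd (Y n)" "snd (Y n) \<le> 2 * snd z0" for n
    using n0[of "n + n0"] by (auto simp: Y_def)
  let ?c = "2 powr (real DIM('a) / 2) * (1 + sqrt (2 * snd z0))"
  have "(\<lambda>n. \<integral>b. norm (heat_jet (Y n - pos b) - heat_jet (z0 - pos b)) * \<rho> b \<partial>M) \<longlonglongrightarrow> 0"
  proof (rule integral_tendsto_zero_Pratt[where
        g = "\<lambda>n b. ?c * (heat_dom (Y n - pos b) * \<rho> b) + ?c * (heat_dom (z0 - pos b) * \<rho> b)"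
        and h = "\<lambda>b. ?c * (heat_dom (z0 - pos b) * \<rho> b) + ?c * (heat_dom (z0 - pos b) * \<rho> b)"])
    show "integrable M (\<lambda>b. ?c * (heat_dom (Y n - pos b) * \<rho> b) + ?c * (heat_dom (z0 - pos b) * \<rho> b))" for n
      using dom[OF Y0(1)[of n]] dom[OF z0]
      by (intro Bochner_Integration.integrable_add integrable_mult_right) (auto simp: has_bochner_integral_iff)
    show "integrable M (\<lambda>b. ?c * (heat_dom (z0 - pos b) * \<rho> b) + ?c * (heat_dom (z0 - pos b) * \<rho> b))"
      using dom[OF z0]
      by (intro Bochner_Integration.integrable_add integrable_mult_right) (auto simp: has_bochner_integral_iff)
    show "norm (heat_jet (Y n - pos b) - heat_jet (z0 - pos b)) * \<rho> b
      \<le> ?c * (heat_dom (Y n - pos b) * \<rho> b) + ?c * (heat_dom (z0 - pos b) * \<rho> b)" for n b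
    proof -
      have "norm (heat_jet (Y n - pos b) - heat_jet (z0 - pos b)) * \<rho> b
          \<le> (norm (heat_jet (Y n - pos b)) + norm (heat_jet (z0 - pos b))) * \<rho> b"
        by (intro mult_right_mono norm_triangle_ineq4 \<rho>_nonneg)
      also have "\<dots> = norm (heat_jet (Y n - pos b)) * \<rho> b + norm (heat_jet (z0 - pos b)) * \<rho> b"
        by (simp add: algebra_simps)
      also have "\<dots> \<le> ?c * (heat_dom (Y n - pos b) * \<rho> b) + ?c * (heat_dom (z0 - pos b) * \<rho> b)"
        using Y0[of n] z0 by (intro add_mono jet_bound) auto
      finally show ?thesis .
    qed
    have lim: "(\<lambda>n. heat_jet (Y n - pos b)) \<longlonglongrightarrow> heat_jet (z0 - pos b)"
      "(\<lambda>n. heat_dom (Y n - pos b)) \<longlonglongrightarrow> heat_dom (z0 - pos b)" if "snd (pos b) \<noteq> snd z0" for b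
      using that by (auto intro!: isCont_tendsto_compose[OF isCont_heat_jet]
          isCont_tendsto_compose[OF isCont_heat_dom] tendsto_intros Y)
    show "AE b in M. (\<lambda>n. norm (heat_jet (Y n - pos b) - heat_jet (z0 - pos b)) * \<rho> b) \<longlonglongrightarrow> 0"
      using time_neq[OF z0]
    proof eventually_elim
      case (elim b)
      have "(\<lambda>n. norm (heat_jet (Y n - pos b) - heat_jet (z0 - pos b)) * \<rho> b)
        \<longlonglongrightarrow> norm (heat_jet (z0 - pos b) - heat_jet (z0 - pos b)) * \<rho> b"
        by (intro tendsto_intros lim elim)
      then show ?case by simp
    qed
    show "AE b in M. (\<lambda>n. ?c * (heat_dom (Y n - pos b) * \<rho> b) + ?c * (heat_dom (z0 - pos b) * \<rho> b)) \<longlonglongrightarrow>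
      ?c * (heat_dom (z0 - pos b) * \<rho> b) + ?c * (heat_dom (z0 - pos b) * \<rho> b)"
      using time_neq[OF z0] by eventually_elim (intro tendsto_intros lim)
    have "(\<lambda>n. V (Y n)) \<longlonglongrightarrow> V z0"
      by (rule continuous_on_tendsto_compose[OF V_cont Y]) (use Y0 z0 in auto)
    then have "(\<lambda>n. ?c * V (Y n) + ?c * V z0) \<longlonglongrightarrow> ?c * V z0 + ?c * V z0"
      by (intro tendsto_intros)
    moreover have eq: "(\<integral>b. ?c * (heat_dom (z - pos b) * \<rho> b) + ?c * (heat_dom (z0 - pos b) * \<rho> b) \<partial>M) = ?c * V z + ?c * V z0"
      if "snd z > 0" for z
      using dom[OF that] dom[OF z0]
      by (subst Bochner_Integration.integral_add) (auto simp: has_bochner_integral_iff simp del: mult_eq_0_iff)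
    ultimately show "(\<lambda>n. \<integral>b. ?c * (heat_dom (Y n - pos b) * \<rho> b) + ?c * (heat_dom (z0 - pos b) * \<rho> b) \<partial>M) \<longlonglongrightarrow>
      (\<integral>b. ?c * (heat_dom (z0 - pos b) * \<rho> b) + ?c * (heat_dom (z0 - pos b) * \<rho> b) \<partial>M)"
      unfolding eq[OF Y0(1)] eq[OF z0] by simp
  qed (use z0 in \<open>auto intro!: add_nonneg_nonneg mult_nonneg_nonneg heat_dom_nonneg \<rho>_nonneg\<close>)
  then have "(\<lambda>n. modulus (X (n + n0)) z0) \<longlonglongrightarrow> 0"
    by (simp add: modulus_def Y_def)
  then show "((\<lambda>z. modulus z z0) \<circ> X) \<longlonglongrightarrow> 0"
    unfolding o_def by (rule LIMSEQ_offset)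
qed

lemma modulus_small:
  assumes "snd z0 > 0" "e > 0"
  obtains d where "d > 0" "\<And>z. dist z z0 < d \<Longrightarrow> snd z > 0" "\<And>z. dist z z0 < d \<Longrightarrow> modulus z z0 < e"
proof -
  obtain d where d: "d > 0" "\<And>z. z \<noteq> z0 \<Longrightarrow> dist z z0 < d \<Longrightarrow> modulus z z0 < e"
  proof -
    have nn: "0 \<le> modulus z z0" for z
      unfolding modulus_def by (intro integral_nonneg_AE AE_I2 mult_nonneg_nonneg \<rho>_nonneg) auto
    show ?thesis
      using modulus_tendsto_zero[OF assms(1)] assms(2) that nn unfolding tendsto_iff eventually_at
      by fastforce
  qed
  show ?thesis
  proof (rule that[of "min d (snd z0)"])
    show "min d (snd z0) > 0" using d assms by simp
    fix z assume z: "dist z z0 < min d (snd z0)"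
    have "\<bar>snd z - snd z0\<bar> \<le> dist z z0"
      using dist_snd_le[of z z0] by (simp add: dist_real_def)
    then show "snd z > 0" using z by linarith
    show "modulus z z0 < e"
      by (cases "z = z0") (use d z assms in \<open>auto simp: modulus_def\<close>)
  qed
qed

text \<open>F enters the bound only through L, so all potentials with sources below L \<rho> share
  one modulus of continuity.\<close>

lemma potential_diff_le:
  assumes z: "snd z > 0" "snd z' > 0" and F: "F \<in> borel_measurable M" "\<And>b. \<bar>F b\<bar> \<le> L * \<rho> b"
  shows "norm (potential F z - potential F z') \<le> L * modulus z z'"
proof -
  have "potential F z - potential F z' = (\<integral>b. F b *\<^sub>R (heat_jet (z - pos b) - heat_jet (z' - pos b)) \<partial>M)"
    unfolding potential_def scaleR_diff_right
    by (rule Bochner_Integration.integral_diff[symmetric]) (intro jet_integrable[OF _ F] z)+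
  also have "norm \<dots> \<le> (\<integral>b. L * (norm (heat_jet (z - pos b) - heat_jet (z' - pos b)) * \<rho> b) \<partial>M)"
  proof (rule norm_integral_le)
    show "integrable M (\<lambda>b. F b *\<^sub>R (heat_jet (z - pos b) - heat_jet (z' - pos b)))"
      unfolding scaleR_diff_right
      by (intro Bochner_Integration.integrable_diff jet_integrable[OF _ F] z)
    show "norm (F b *\<^sub>R (heat_jet (z - pos b) - heat_jet (z' - pos b)))
      \<le> L * (norm (heat_jet (z - pos b) - heat_jet (z' - pos b)) * \<rho> b)" for b
      using mult_right_mono[OF F(2)[of b], of "norm (heat_jet (z - pos b) - heat_jet (z' - pos b))"]
      by (simp add: mult_ac)
  qed (use modulus_integrable[OF z] in auto)
  also have "\<dots> = L * modulus z z'" by (simp add: modulus_def)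
  finally show ?thesis .
qed

lemma continuous_on_potential:
  assumes F: "F \<in> borel_measurable M" "\<And>b. \<bar>F b\<bar> \<le> L * \<rho> b"
  shows "continuous_on {z. snd z > 0} (potential F)"
proof (rule continuous_at_imp_continuous_on, safe)
  fix x :: 'a and t :: real assume "0 < snd (x, t)"
  show "isCont (potential F) (x, t)"
    unfolding continuous_at_eps_delta
  proof (intro allI impI)
    fix e :: real assume "e > 0"
    obtain d where d: "d > 0" "\<And>z. dist z (x, t) < d \<Longrightarrow> snd z > 0"
      "\<And>z. dist z (x, t) < d \<Longrightarrow> modulus z (x, t) < e / (\<bar>L\<bar> + 1)"
      using modulus_small[OF \<open>0 < snd (x, t)\<close>, of "e / (\<bar>L\<bar> + 1)"] \<open>e > 0\<close> by auto
    show "\<exists>d>0. \<forall>z. dist z (x, t) < d \<longrightarrow> dist (potential F z) (potential F (x, t)) < e"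
    proof (intro exI[of _ d] conjI allI impI d(1))
      fix z assume z: "dist z (x, t) < d"
      have m0: "0 \<le> modulus z (x, t)"
        unfolding modulus_def by (intro integral_nonneg_AE AE_I2 mult_nonneg_nonneg \<rho>_nonneg) auto
      have "dist (potential F z) (potential F (x, t)) \<le> L * modulus z (x, t)"
        unfolding dist_norm by (rule potential_diff_le[OF d(2)[OF z] \<open>0 < snd (x, t)\<close> F])
      also have "\<dots> \<le> (\<bar>L\<bar> + 1) * modulus z (x, t)"
        using m0 by (intro mult_right_mono) auto
      also have "\<dots> < (\<bar>L\<bar> + 1) * (e / (\<bar>L\<bar> + 1))"
        by (intro mult_strict_left_mono d(3) z) auto
      finally show "dist (potential F z) (potential F (x, t)) < e" by simp
    qed
  qed
qed

text \<open>The kernel gradients have no locally uniform integrable bound, so differentiation under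
  the integral is not done by domination. The Taylor remainder is instead bounded by the average of
  \<open>modulus\<close> along the segment from x to y, which is small as soon as the segment is
  short.\<close>

lemma has_derivative_potential:
  assumes t: "t > 0" and F: "F \<in> borel_measurable M" "\<And>b. \<bar>F b\<bar> \<le> L * \<rho> b"
  shows "((\<lambda>x. fst (potential F (x, t))) has_derivative (\<lambda>v. snd (potential F (x, t)) \<bullet> v)) (at x)"
  unfolding has_derivative_at_alt
proof (intro conjI allI impI)
  note [measurable] = F(1)
  show "bounded_linear ((\<bullet>) (snd (potential F (x, t))))" by (rule bounded_linear_inner_right)
  fix e :: real assume e: "e > 0"
  define z0 where "z0 = (x, t)"
  have z0: "snd z0 > 0" using t by (simp add: z0_def)
  have ep: "e / (\<bar>L\<bar> + 1) > 0" using e by simp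
  obtain d where d: "d > 0" "\<And>z. dist z z0 < d \<Longrightarrow> snd z > 0"
    "\<And>z. dist z z0 < d \<Longrightarrow> modulus z z0 < e / (\<bar>L\<bar> + 1)"
    using modulus_small[OF z0 ep] by blast
  show "\<exists>d>0. \<forall>y. norm (y - x) < d \<longrightarrow>
      norm (fst (potential F (y, t)) - fst (potential F (x, t)) - snd (potential F (x, t)) \<bullet> (y - x)) \<le> e * norm (y - x)"
  proof (intro exI[of _ d] conjI allI impI d(1))
    fix y assume y: "norm (y - x) < d"
    define v where "v = y - x"
    let ?z = "\<lambda>\<theta>. (x + \<theta> *\<^sub>R v, t)"
    let ?r = "\<lambda>b. fst (heat_jet (?z 1 - pos b)) - fst (heat_jet (z0 - pos b)) - snd (heat_jet (z0 - pos b)) \<bullet> v"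
    let ?q = "\<lambda>\<theta> b. norm (heat_jet (?z \<theta> - pos b) - heat_jet (z0 - pos b))"
    have i: "integrable M (\<lambda>b. F b *\<^sub>R heat_jet (z - pos b))" if "snd z > 0" for z
      by (rule jet_integrable[OF that F])
    have f: "fst (potential F z) = (\<integral>b. F b * fst (heat_jet (z - pos b)) \<partial>M)"
      "integrable M (\<lambda>b. F b * fst (heat_jet (z - pos b)))" if "snd z > 0" for z
      using integral_bounded_linear[OF bounded_linear_fst i[OF that]]
        integrable_bounded_linear[OF bounded_linear_fst i[OF that]]
      by (simp_all add: potential_def)
    have s: "snd (potential F z0) \<bullet> v = (\<integral>b. F b * (snd (heat_jet (z0 - pos b)) \<bullet> v) \<partial>M)"
      "integrable M (\<lambda>b. F b * (snd (heat_jet (z0 - pos b)) \<bullet> v))"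
      using integral_bounded_linear[OF bounded_linear_compose[OF bounded_linear_inner_left[of v] bounded_linear_snd] i[OF z0]]
        integrable_bounded_linear[OF bounded_linear_compose[OF bounded_linear_inner_left[of v] bounded_linear_snd] i[OF z0]]
      by (simp_all add: potential_def)
    have t1: "snd (?z 1) > 0" using t by simp
    have ii: "integrable M (\<lambda>b. F b * ?r b)"
      unfolding right_diff_distrib
      by (intro Bochner_Integration.integrable_diff f(2)[OF t1] f(2)[OF z0] s(2))
    have "fst (potential F (?z 1)) - fst (potential F z0) - snd (potential F z0) \<bullet> v = (\<integral>b. F b * ?r b \<partial>M)"
      unfolding f(1)[OF z0] s(1) f(1)[OF t1] right_diff_distrib
        Bochner_Integration.integral_diff[OF Bochner_Integration.integrable_diff[OF f(2)[OF t1] f(2)[OF z0]] s(2)]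
        Bochner_Integration.integral_diff[OF f(2)[OF t1] f(2)[OF z0]] ..
    then have "ennreal (norm (fst (potential F (?z 1)) - fst (potential F z0) - snd (potential F z0) \<bullet> v))
        \<le> (\<integral>\<^sup>+b. ennreal (norm (F b * ?r b)) \<partial>M)"
      using integral_norm_bound_ennreal[OF ii] by simp
    also have "\<dots> \<le> (\<integral>\<^sup>+b. (\<integral>\<^sup>+\<theta>. ennreal (\<bar>L\<bar> * norm v) * (ennreal (?q \<theta> b * \<rho> b) * indicator {0..1} \<theta>) \<partial>lborel) \<partial>M)"
    proof (rule nn_integral_mono)
      fix b
      have "ennreal (norm (F b * ?r b)) = ennreal \<bar>F b\<bar> * ennreal \<bar>?r b\<bar>"
        by (simp add: abs_mult ennreal_mult)
      also have "\<dots> \<le> ennreal (\<bar>L\<bar> * \<rho> b) * ennreal \<bar>?r b\<bar>"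
        using F(2)[of b] mult_right_mono[OF abs_ge_self[of L] \<rho>_nonneg[of b]]
        by (intro mult_right_mono ennreal_leI) auto
      also have "ennreal \<bar>?r b\<bar> \<le> ennreal (norm v) * (\<integral>\<^sup>+\<theta>\<in>{0..1}. ennreal (?q \<theta> b) \<partial>lborel)"
        using heat_kernel_taylor[of "x - fst (pos b)" v "t - snd (pos b)"]
        by (simp add: z0_def minus_prod_def algebra_simps)
      also have "ennreal (\<bar>L\<bar> * \<rho> b) * (ennreal (norm v) * (\<integral>\<^sup>+\<theta>\<in>{0..1}. ennreal (?q \<theta> b) \<partial>lborel))
         = (\<integral>\<^sup>+\<theta>. ennreal (\<bar>L\<bar> * \<rho> b) * (ennreal (norm v) * (ennreal (?q \<theta> b) * indicator {0..1} \<theta>)) \<partial>lborel)"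
        by (simp add: nn_integral_cmult)
      also have "\<dots> = (\<integral>\<^sup>+\<theta>. ennreal (\<bar>L\<bar> * norm v) * (ennreal (?q \<theta> b * \<rho> b) * indicator {0..1} \<theta>) \<partial>lborel)"
        using \<rho>_nonneg[of b] by (intro nn_integral_cong) (auto simp: indicator_def ennreal_mult[symmetric] mult_ac)
      finally show "ennreal (norm (F b * ?r b)) \<le> (\<integral>\<^sup>+\<theta>. ennreal (\<bar>L\<bar> * norm v) * (ennreal (?q \<theta> b * \<rho> b) * indicator {0..1} \<theta>) \<partial>lborel)"
        by (simp add: mult_left_mono)
    qed
    \<comment> \<open>After Tonelli the inner integral is \<open>modulus\<close> at the point of
      parameter \<theta>.\<close>
    also have "\<dots> = (\<integral>\<^sup>+\<theta>. (\<integral>\<^sup>+b. ennreal (\<bar>L\<bar> * norm v) * (ennreal (?q \<theta> b * \<rho> b) * indicator {0..1} \<theta>) \<partial>M) \<partial>lborel)"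
    proof -
      interpret pair_sigma_finite M "lborel :: real measure" ..
      show ?thesis by (rule Fubini'[symmetric]) measurable
    qed
    also have "\<dots> \<le> (\<integral>\<^sup>+(\<theta>::real). ennreal (\<bar>L\<bar> * norm v * (e / (\<bar>L\<bar> + 1))) * indicator {0..1} \<theta> \<partial>lborel)"
    proof (rule nn_integral_mono)
      fix \<theta> :: real
      have I: "(\<integral>\<^sup>+b. ennreal (?q \<theta> b * \<rho> b) \<partial>M) \<le> ennreal (e / (\<bar>L\<bar> + 1))" if \<theta>: "\<theta> \<in> {0..1}"
      proof -
        \<comment> \<open>Every point of the segment lies as close to \<open>z0\<close> as its
          endpoint, so one radius serves all \<theta>.\<close>
        have "dist (?z \<theta>) z0 \<le> norm v"
          using \<theta> by (auto simp: z0_def dist_Pair_Pair dist_norm mult_left_le_one_le)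
        then have "dist (?z \<theta>) z0 < d" using y by (simp add: v_def)
        then have "modulus (?z \<theta>) z0 < e / (\<bar>L\<bar> + 1)" by (rule d(3))
        moreover have "(\<integral>\<^sup>+b. ennreal (?q \<theta> b * \<rho> b) \<partial>M) = ennreal (modulus (?z \<theta>) z0)"
          unfolding modulus_def using modulus_integrable[of "?z \<theta>" z0] t z0 \<rho>_nonneg
          by (intro nn_integral_eq_integral) auto
        ultimately show ?thesis by (auto intro: ennreal_leI)
      qed
      then show "(\<integral>\<^sup>+b. ennreal (\<bar>L\<bar> * norm v) * (ennreal (?q \<theta> b * \<rho> b) * indicator {0..1} \<theta>) \<partial>M)
        \<le> ennreal (\<bar>L\<bar> * norm v * (e / (\<bar>L\<bar> + 1))) * indicator {0..1} \<theta>"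
      proof (cases "\<theta> \<in> {0..1}")
        case True
        have "(\<integral>\<^sup>+b. ennreal (\<bar>L\<bar> * norm v) * ennreal (?q \<theta> b * \<rho> b) \<partial>M)
          = ennreal (\<bar>L\<bar> * norm v) * (\<integral>\<^sup>+b. ennreal (?q \<theta> b * \<rho> b) \<partial>M)"
          by (rule nn_integral_cmult) measurable
        also have "\<dots> \<le> ennreal (\<bar>L\<bar> * norm v) * ennreal (e / (\<bar>L\<bar> + 1))"
          by (intro mult_left_mono I True) auto
        also have "\<dots> = ennreal (\<bar>L\<bar> * norm v * (e / (\<bar>L\<bar> + 1)))"
          by (rule ennreal_mult[symmetric]) (use e in auto)
        finally show ?thesis using True by simp
      qed simp
    qed
    also have "\<dots> = ennreal (\<bar>L\<bar> * norm v * (e / (\<bar>L\<bar> + 1)))"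
      by (simp add: nn_integral_cmult)
    finally have "norm (fst (potential F (?z 1)) - fst (potential F z0) - snd (potential F z0) \<bullet> v)
       \<le> \<bar>L\<bar> * norm v * (e / (\<bar>L\<bar> + 1))"
      using e by (subst (asm) ennreal_le_iff) auto
    also have "\<dots> \<le> e * norm v"
      using e by (simp add: field_simps mult_left_mono)
    finally show "norm (fst (potential F (y, t)) - fst (potential F (x, t)) - snd (potential F (x, t)) \<bullet> (y - x)) \<le> e * norm (y - x)"
      by (simp add: v_def z0_def)
  qed
qed

end

subsection \<open>The dominating solution\<close>

lemma nn_integral_lborel_prod_snd:
  fixes f :: "'a::euclidean_space \<times> 'b::euclidean_space \<Rightarrow> ennreal"
  assumes "f \<in> borel_measurable borel"
  shows "(\<integral>\<^sup>+z. f z \<partial>lborel) = (\<integral>\<^sup>+y. (\<integral>\<^sup>+x. f (x, y) \<partial>lborel) \<partial>lborel)"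
proof -
  have "f \<in> borel_measurable (lborel \<Otimes>\<^sub>M lborel)"
    using assms by (simp add: lborel_prod)
  from lborel_pair.nn_integral_snd[OF this] show ?thesis
    by (simp add: lborel_prod)
qed

text \<open>Integrability is not assumed: otherwise the Bochner integral is 0 by convention, and T 0
  = 0.\<close>

lemma norm_bounded_linear_integral_le:
  fixes f :: "'b \<Rightarrow> 'c::{banach,second_countable_topology}"
    and T :: "'c \<Rightarrow> 'd::{banach,second_countable_topology}"
  assumes T: "bounded_linear T"
  shows "ennreal (norm (T (\<integral>x. f x \<partial>M))) \<le> (\<integral>\<^sup>+x. ennreal (norm (T (f x))) \<partial>M)"
proof (cases "integrable M f")
  case True
  then show ?thesis
    unfolding integral_bounded_linear[OF T True, symmetric]
    by (intro integral_norm_bound_ennreal integrable_bounded_linear[OF T])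
next
  case False
  then show ?thesis
    by (simp add: not_integrable_integral_eq linear_0[OF bounded_linear.linear[OF T]])
qed

text \<open>The number pi, as the value of the Abel kernel integral.\<close>

definition beta_half :: real where "beta_half = Beta (1/2) (1/2)"

lemma beta_half_nonneg: "0 \<le> beta_half"
  unfolding beta_half_def Beta_def by (intro divide_nonneg_nonneg mult_nonneg_nonneg) auto

text \<open>The two singular factors together scale like 1 / t, which cancels the Jacobian of s = t
  r; hence the value does not depend on t and is the Beta integral over the unit interval.\<close>

lemma nn_integral_abel_kernel:
  assumes t: "t > (0::real)"
  shows "(\<integral>\<^sup>+s\<in>{0<..<t}. ennreal ((t - s) powr (- (1/2)) * s powr (- (1/2))) \<partial>lborel) = ennreal beta_half"
proof -
  have "((\<lambda>s. s powr (- (1/2)) * (1 - s) powr (- (1/2))) has_integral beta_half) {0..1::real}"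
    using has_integral_Beta_real[of "1/2" "1/2"] by (simp add: beta_half_def)
  then have "((\<lambda>s. s powr (- (1/2)) * (1 - s) powr (- (1/2))) has_integral beta_half) {0<..<1::real}"
    by (simp add: has_integral_Icc_iff_Ioo)
  from nn_integral_has_integral_lebesgue'[OF _ this]
  have b: "(\<integral>\<^sup>+s. ennreal (s powr (- (1/2)) * (1 - s) powr (- (1/2))) * indicator {0<..<1} s \<partial>lborel) = ennreal beta_half"
    by simp
  have "(\<integral>\<^sup>+s\<in>{0<..<t}. ennreal ((t - s) powr (- (1/2)) * s powr (- (1/2))) \<partial>lborel)
      = ennreal \<bar>t\<bar> * (\<integral>\<^sup>+s. ennreal ((t - (0 + t * s)) powr (- (1/2)) * (0 + t * s) powr (- (1/2))) * indicator {0<..<t} (0 + t * s) \<partial>lborel)"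
    by (rule nn_integral_real_affine) (use t in auto)
  also have "\<dots> = (\<integral>\<^sup>+s. ennreal \<bar>t\<bar> * (ennreal ((t - (0 + t * s)) powr (- (1/2)) * (0 + t * s) powr (- (1/2))) * indicator {0<..<t} (0 + t * s)) \<partial>lborel)"
    by (rule nn_integral_cmult[symmetric]) measurable
  also have "\<dots> = (\<integral>\<^sup>+s. ennreal (s powr (- (1/2)) * (1 - s) powr (- (1/2))) * indicator {0<..<1} s \<partial>lborel)"
  proof (rule nn_integral_cong)
    fix s :: real
    show "ennreal \<bar>t\<bar> * (ennreal ((t - (0 + t * s)) powr (- (1/2)) * (0 + t * s) powr (- (1/2))) * indicator {0<..<t} (0 + t * s))
       = ennreal (s powr (- (1/2)) * (1 - s) powr (- (1/2))) * indicator {0<..<1} s"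
    proof (cases "s \<in> {0<..<1}")
      case True
      have 1: "t - (0 + t * s) = t * (1 - s)" by (simp add: algebra_simps)
      have 2: "t powr (- (1/2)) * t powr (- (1/2)) * t = 1"
        using t by (simp add: powr_minus_half)
      have "\<bar>t\<bar> * ((t - (0 + t * s)) powr (- (1/2)) * (0 + t * s) powr (- (1/2)))
          = (t powr (- (1/2)) * t powr (- (1/2)) * t) * (s powr (- (1/2)) * (1 - s) powr (- (1/2)))"
        unfolding 1 using t True by (simp add: powr_mult mult_ac)
      also note 2
      finally have "\<bar>t\<bar> * ((t - (0 + t * s)) powr (- (1/2)) * (0 + t * s) powr (- (1/2)))
          = s powr (- (1/2)) * (1 - s) powr (- (1/2))" by simp
      then have "ennreal \<bar>t\<bar> * ennreal ((t - (0 + t * s)) powr (- (1/2)) * (0 + t * s) powr (- (1/2)))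
          = ennreal (s powr (- (1/2)) * (1 - s) powr (- (1/2)))"
        by (subst ennreal_mult[symmetric]) auto
      moreover have "0 + t * s \<in> {0<..<t}" using True t by auto
      ultimately show ?thesis using True by simp
    next
      case False
      then have "0 + t * s \<notin> {0<..<t}" using t by (auto simp: zero_less_mult_iff)
      then show ?thesis using False by simp
    qed
  qed
  also note b
  finally show ?thesis .
qed

locale initial_datum =
  fixes \<phi> :: "'a::euclidean_space \<Rightarrow> real"
  assumes phi_integrable: "integrable lborel \<phi>"
begin

lemma phi_measurable[measurable]: "\<phi> \<in> borel_measurable borel"
  using phi_integrable by simp

definition mass :: real where "mass = (\<integral>\<xi>. \<bar>\<phi> \<xi>\<bar> \<partial>lborel)"

definition H :: "'a \<times> real \<Rightarrow> real" where
  "H z = (\<integral>\<xi>. heat_kernel (fst z - \<xi>) (2 * snd z) * \<bar>\<phi> \<xi>\<bar> \<partial>lborel)"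

lemma mass_nonneg: "0 \<le> mass"
  by (simp add: mass_def)

lemma nn_integral_abs_phi: "(\<integral>\<^sup>+\<xi>. ennreal \<bar>\<phi> \<xi>\<bar> \<partial>lborel) = ennreal mass"
  unfolding mass_def using phi_integrable by (intro nn_integral_eq_integral) auto

lemma H_nonneg: "0 \<le> H z"
  unfolding H_def by (intro integral_nonneg_AE AE_I2 mult_nonneg_nonneg heat_kernel_nonneg) auto

lemma H_measurable[measurable]: "H \<in> borel_measurable borel"
  unfolding H_def by measurable

lemma integrable_heat_kernel_phi:
  assumes "t > 0"
  shows "integrable lborel (\<lambda>\<xi>. heat_kernel (x - \<xi>) t * \<bar>\<phi> \<xi>\<bar>)"
proof (rule Bochner_Integration.integrable_bound)
  show "integrable lborel (\<lambda>\<xi>. (4 * pi * t) powr (- real DIM('a) / 2) * \<bar>\<phi> \<xi>\<bar>)"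
    using phi_integrable by auto
  show "AE \<xi> in lborel. norm (heat_kernel (x - \<xi>) t * \<bar>\<phi> \<xi>\<bar>)
      \<le> norm ((4 * pi * t) powr (- real DIM('a) / 2) * \<bar>\<phi> \<xi>\<bar>)"
  proof (rule AE_I2)
    fix \<xi>
    show "norm (heat_kernel (x - \<xi>) t * \<bar>\<phi> \<xi>\<bar>) \<le> norm ((4 * pi * t) powr (- real DIM('a) / 2) * \<bar>\<phi> \<xi>\<bar>)"
      using mult_right_mono[OF heat_kernel_le[OF assms, of "x - \<xi>"], of "\<bar>\<phi> \<xi>\<bar>"]
      by (simp add: abs_mult heat_kernel_nonneg)
  qed
qed measurable

lemma nn_integral_H:
  "t > 0 \<Longrightarrow> (\<integral>\<^sup>+\<xi>. ennreal (heat_kernel (x - \<xi>) (2 * t) * \<bar>\<phi> \<xi>\<bar>) \<partial>lborel) = ennreal (H (x, t))"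
  unfolding H_def using integrable_heat_kernel_phi[of "2 * t" x]
  by (subst nn_integral_eq_integral) (auto simp: heat_kernel_nonneg)

lemma H_le: "t > 0 \<Longrightarrow> H (x, t) \<le> (8 * pi * t) powr (- real DIM('a) / 2) * mass"
proof -
  assume t: "t > 0"
  have "H (x, t) \<le> (\<integral>\<xi>. (8 * pi * t) powr (- real DIM('a) / 2) * \<bar>\<phi> \<xi>\<bar> \<partial>lborel)"
    unfolding H_def fst_conv snd_conv
  proof (rule integral_mono)
    show "heat_kernel (x - \<xi>) (2 * t) * \<bar>\<phi> \<xi>\<bar> \<le> (8 * pi * t) powr (- real DIM('a) / 2) * \<bar>\<phi> \<xi>\<bar>" for \<xi>
      using t heat_kernel_le[of "2 * t" "x - \<xi>"] by (intro mult_right_mono) (auto simp: mult_ac)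
  qed (use t phi_integrable integrable_heat_kernel_phi in auto)
  then show ?thesis by (simp add: mass_def)
qed

lemma H_continuous: "continuous_on {z. snd z > 0} H"
  unfolding continuous_on_sequentially
proof safe
  fix X and x :: 'a and t :: real
  assume X: "\<forall>n. X n \<in> {z. snd z > 0}" and t: "0 < snd (x, t)" and lim: "X \<longlonglongrightarrow> (x, t)"
  have s: "(\<lambda>n. snd (X n)) \<longlonglongrightarrow> t" using tendsto_snd[OF lim] by simp
  from order_tendstoD(1)[OF s, of "t / 2"] t
  have ev: "eventually (\<lambda>n. t / 2 < snd (X n)) sequentially" by simp
  then obtain n0 where n0: "\<And>n. n \<ge> n0 \<Longrightarrow> t / 2 < snd (X n)"
    by (auto simp: eventually_sequentially)
  have "(\<lambda>n. H (X (n + n0))) \<longlonglongrightarrow> H (x, t)"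
    unfolding H_def
  \<comment> \<open>All kernel times along the tail of the sequence are at least t, so the kernels
    are bounded by the maximum of the kernel of time t.\<close>
  proof (rule integral_dominated_convergence[where w = "\<lambda>\<xi>. (4 * pi * t) powr (- real DIM('a) / 2) * \<bar>\<phi> \<xi>\<bar>"])
    show "integrable lborel (\<lambda>\<xi>. (4 * pi * t) powr (- real DIM('a) / 2) * \<bar>\<phi> \<xi>\<bar>)"
      using phi_integrable by auto
    have "(\<lambda>n. (fst (X (n + n0)) - \<xi>, 2 * snd (X (n + n0)))) \<longlonglongrightarrow> (x - \<xi>, 2 * t)" for \<xi>
      using LIMSEQ_ignore_initial_segment[OF lim, of n0]
      by (intro tendsto_intros) (auto dest: tendsto_fst tendsto_snd)
    from isCont_tendsto_compose[OF continuous_heat_kernel this]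
    show "AE \<xi> in lborel. (\<lambda>n. heat_kernel (fst (X (n + n0)) - \<xi>) (2 * snd (X (n + n0))) * \<bar>\<phi> \<xi>\<bar>)
       \<longlonglongrightarrow> heat_kernel (fst (x, t) - \<xi>) (2 * snd (x, t)) * \<bar>\<phi> \<xi>\<bar>"
      using t by (auto intro!: AE_I2 tendsto_intros)
    show "AE \<xi> in lborel. norm (heat_kernel (fst (X (n + n0)) - \<xi>) (2 * snd (X (n + n0))) * \<bar>\<phi> \<xi>\<bar>)
       \<le> (4 * pi * t) powr (- real DIM('a) / 2) * \<bar>\<phi> \<xi>\<bar>" for n
    proof (rule AE_I2)
      fix \<xi>
      have t2: "t \<le> 2 * snd (X (n + n0))" using n0[of "n + n0"] by simp
      then have "heat_kernel (fst (X (n + n0)) - \<xi>) (2 * snd (X (n + n0)))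
         \<le> (4 * pi * (2 * snd (X (n + n0)))) powr (- real DIM('a) / 2)"
        using t by (intro heat_kernel_le) auto
      also have "\<dots> \<le> (4 * pi * t) powr (- real DIM('a) / 2)"
        using t2 t by (intro powr_mono2') auto
      finally show "norm (heat_kernel (fst (X (n + n0)) - \<xi>) (2 * snd (X (n + n0))) * \<bar>\<phi> \<xi>\<bar>)
         \<le> (4 * pi * t) powr (- real DIM('a) / 2) * \<bar>\<phi> \<xi>\<bar>"
        by (auto simp: abs_mult heat_kernel_nonneg intro!: mult_right_mono)
    qed
  qed auto
  then show "(H \<circ> X) \<longlonglongrightarrow> H (x, t)"
    unfolding o_def by (rule LIMSEQ_offset)
qed

lemma nn_integral_H_total:
  assumes t: "t > 0"
  shows "(\<integral>\<^sup>+x. ennreal (H (x, t)) \<partial>lborel) = ennreal mass"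
proof -
  have "(\<integral>\<^sup>+x. ennreal (H (x, t)) \<partial>lborel)
      = (\<integral>\<^sup>+x. (\<integral>\<^sup>+\<xi>. ennreal (heat_kernel (x - \<xi>) (2 * t) * \<bar>\<phi> \<xi>\<bar>) \<partial>lborel) \<partial>lborel)"
    using t by (simp add: nn_integral_H)
  also have "\<dots> = (\<integral>\<^sup>+\<xi>. (\<integral>\<^sup>+x. ennreal (heat_kernel (x - \<xi>) (2 * t) * \<bar>\<phi> \<xi>\<bar>) \<partial>lborel) \<partial>lborel)"
    by (rule lborel_pair.Fubini') measurable
  also have "\<dots> = (\<integral>\<^sup>+\<xi>. ennreal \<bar>\<phi> \<xi>\<bar> \<partial>lborel)"
    using t by (simp add: ennreal_mult heat_kernel_nonneg nn_integral_multc nn_integral_heat_kernel)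
  also have "\<dots> = ennreal mass" by (rule nn_integral_abs_phi)
  finally show ?thesis .
qed

text \<open>Both kernels carry doubled times, so the semigroup law reproduces \<open>H\<close>
  exactly, without a constant. This is why \<open>H\<close> can dominate a Duhamel integral of
  itself.\<close>

lemma H_semigroup:
  assumes "a > 0" "b > 0"
  shows "(\<integral>\<^sup>+y. ennreal (heat_kernel (x - y) (2 * a) * H (y, b)) \<partial>lborel) = ennreal (H (x, a + b))"
proof -
  have "(\<integral>\<^sup>+y. ennreal (heat_kernel (x - y) (2 * a) * H (y, b)) \<partial>lborel)
    = (\<integral>\<^sup>+y. (\<integral>\<^sup>+\<xi>. ennreal (heat_kernel (x - y) (2 * a) * heat_kernel (y - \<xi>) (2 * b)) * ennreal \<bar>\<phi> \<xi>\<bar> \<partial>lborel) \<partial>lborel)"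
  proof (rule nn_integral_cong)
    fix y
    have "ennreal (heat_kernel (x - y) (2 * a) * H (y, b)) = ennreal (heat_kernel (x - y) (2 * a)) * ennreal (H (y, b))"
      by (simp add: ennreal_mult heat_kernel_nonneg H_nonneg)
    also have "\<dots> = (\<integral>\<^sup>+\<xi>. ennreal (heat_kernel (x - y) (2 * a)) * ennreal (heat_kernel (y - \<xi>) (2 * b) * \<bar>\<phi> \<xi>\<bar>) \<partial>lborel)"
      unfolding nn_integral_H[OF assms(2), symmetric] by (rule nn_integral_cmult[symmetric]) measurable
    finally show "ennreal (heat_kernel (x - y) (2 * a) * H (y, b))
       = (\<integral>\<^sup>+\<xi>. ennreal (heat_kernel (x - y) (2 * a) * heat_kernel (y - \<xi>) (2 * b)) * ennreal \<bar>\<phi> \<xi>\<bar> \<partial>lborel)"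
      by (simp add: ennreal_mult heat_kernel_nonneg mult_ac)
  qed
  also have "\<dots> = (\<integral>\<^sup>+\<xi>. (\<integral>\<^sup>+y. ennreal (heat_kernel (x - y) (2 * a) * heat_kernel (y - \<xi>) (2 * b)) * ennreal \<bar>\<phi> \<xi>\<bar> \<partial>lborel) \<partial>lborel)"
    by (rule lborel_pair.Fubini') measurable
  also have "\<dots> = (\<integral>\<^sup>+\<xi>. ennreal (heat_kernel (x - \<xi>) (2 * (a + b)) * \<bar>\<phi> \<xi>\<bar>) \<partial>lborel)"
  proof (rule nn_integral_cong)
    fix \<xi>
    have "(\<integral>\<^sup>+y. ennreal (heat_kernel (x - y) (2 * a) * heat_kernel (y - \<xi>) (2 * b)) * ennreal \<bar>\<phi> \<xi>\<bar> \<partial>lborel)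
      = (\<integral>\<^sup>+y. ennreal (heat_kernel (x - y) (2 * a) * heat_kernel (y - \<xi>) (2 * b)) \<partial>lborel) * ennreal \<bar>\<phi> \<xi>\<bar>"
      by (rule nn_integral_multc) measurable
    also have "(\<integral>\<^sup>+y. ennreal (heat_kernel (x - y) (2 * a) * heat_kernel (y - \<xi>) (2 * b)) \<partial>lborel)
      = ennreal (heat_kernel (x - \<xi>) (2 * (a + b)))"
      unfolding distrib_left using assms by (intro heat_kernel_convolution) auto
    finally show "(\<integral>\<^sup>+y. ennreal (heat_kernel (x - y) (2 * a) * heat_kernel (y - \<xi>) (2 * b)) * ennreal \<bar>\<phi> \<xi>\<bar> \<partial>lborel)
      = ennreal (heat_kernel (x - \<xi>) (2 * (a + b)) * \<bar>\<phi> \<xi>\<bar>)"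
      by (simp add: ennreal_mult heat_kernel_nonneg)
  qed
  also have "\<dots> = ennreal (H (x, a + b))"
    using assms by (intro nn_integral_H) simp
  finally show ?thesis .
qed

text \<open>At each source time s the spatial integral equals \<open>H\<close> (x, t) whatever s is.
  The space-time integral therefore factors, and every estimate of Duhamel terms becomes a scalar
  integral over time.\<close>

lemma nn_integral_duhamel:
  assumes [measurable]: "a \<in> borel_measurable borel" and a: "\<And>s. 0 \<le> a s" and S[measurable]: "S \<in> sets borel" "S \<subseteq> {0<..<t}"
  shows "(\<integral>\<^sup>+b. ennreal (a (snd b) * (heat_kernel (x - fst b) (2 * (t - snd b)) * H b)) * indicator S (snd b) \<partial>lborel)
    = ennreal (H (x, t)) * (\<integral>\<^sup>+s\<in>S. ennreal (a s) \<partial>lborel)"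
proof -
  have "(\<integral>\<^sup>+b. ennreal (a (snd b) * (heat_kernel (x - fst b) (2 * (t - snd b)) * H b)) * indicator S (snd b) \<partial>lborel)
    = (\<integral>\<^sup>+s. (\<integral>\<^sup>+y. ennreal (a s * (heat_kernel (x - y) (2 * (t - s)) * H (y, s))) * indicator S s \<partial>lborel) \<partial>lborel)"
    by (subst nn_integral_lborel_prod_snd) auto
  also have "\<dots> = (\<integral>\<^sup>+s. ennreal (H (x, t)) * (ennreal (a s) * indicator S s) \<partial>lborel)"
  proof (rule nn_integral_cong)
    fix s
    show "(\<integral>\<^sup>+y. ennreal (a s * (heat_kernel (x - y) (2 * (t - s)) * H (y, s))) * indicator S s \<partial>lborel)
      = ennreal (H (x, t)) * (ennreal (a s) * indicator S s)"
    proof (cases "s \<in> S")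
      case True
      then have s: "0 < t - s" "0 < s" using S by auto
      have "(\<integral>\<^sup>+y. ennreal (a s * (heat_kernel (x - y) (2 * (t - s)) * H (y, s))) \<partial>lborel)
         = (\<integral>\<^sup>+y. ennreal (a s) * ennreal (heat_kernel (x - y) (2 * (t - s)) * H (y, s)) \<partial>lborel)"
        by (intro nn_integral_cong ennreal_mult a mult_nonneg_nonneg heat_kernel_nonneg H_nonneg)
      also have "\<dots> = ennreal (a s) * ennreal (H (x, t - s + s))"
        unfolding H_semigroup[OF s, symmetric] by (rule nn_integral_cmult) measurable
      finally show ?thesis using True by (simp add: mult.commute)
    qed simp
  qed
  also have "\<dots> = ennreal (H (x, t)) * (\<integral>\<^sup>+s\<in>S. ennreal (a s) \<partial>lborel)"
    by (rule nn_integral_cmult) measurable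
  finally show ?thesis .
qed

text \<open>All sources sit at time 0, so the elapsed time is t and the singular factor of
  \<open>heat_dom\<close> comes out of the integral.\<close>

sublocale init: heat_source lborel "\<lambda>\<xi>. (\<xi>, 0)" "\<lambda>\<xi>. \<bar>\<phi> \<xi>\<bar>" "\<lambda>z. snd z powr (- (1/2)) * H z"
proof
  fix z :: "'a \<times> real" assume z: "snd z > 0"
  have "has_bochner_integral lborel (\<lambda>\<xi>. heat_kernel (fst z - \<xi>) (2 * snd z) * \<bar>\<phi> \<xi>\<bar>) (H z)"
    using integrable_heat_kernel_phi[of "2 * snd z" "fst z"] z
    by (simp add: has_bochner_integral_iff H_def)
  then have "has_bochner_integral lborel (\<lambda>\<xi>. snd z powr (- (1/2)) * (heat_kernel (fst z - \<xi>) (2 * snd z) * \<bar>\<phi> \<xi>\<bar>)) (snd z powr (- (1/2)) * H z)"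
    by (intro has_bochner_integral_mult_right)
  then show "has_bochner_integral lborel (\<lambda>\<xi>. heat_dom (z - (\<xi>, 0)) * \<bar>\<phi> \<xi>\<bar>) (snd z powr (- (1/2)) * H z)"
    using z by (simp add: heat_dom_def mult.assoc)
next
  show "continuous_on {z::'a \<times> real. 0 < snd z} (\<lambda>z. snd z powr (- (1/2)) * H z)"
    by (intro continuous_intros H_continuous) auto
qed auto

text \<open>The size that the nonlinearity may have, up to a constant, when u and its gradient are
  dominated by \<open>H\<close>: the factor s^(-1/2) stems from the gradient.\<close>

definition \<rho> :: "'a \<times> real \<Rightarrow> real" where
  "\<rho> b = (if snd b > 0 then snd b powr (- (1/2)) * H b else 0)"

lemma \<rho>_meas[measurable]: "\<rho> \<in> borel_measurable borel"
  unfolding \<rho>_def by measurable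

lemma \<rho>_ge_0: "0 \<le> \<rho> b"
  by (simp add: \<rho>_def H_nonneg)

lemma AE_lborel_snd_neq: "AE b in (lborel :: ('a \<times> real) measure). snd b \<noteq> t"
proof -
  have "AE b in (lborel \<Otimes>\<^sub>M lborel :: ('a \<times> real) measure). snd b \<noteq> t"
  proof (rule lborel_pair.AE_pair_measure)
    show "{b \<in> space (lborel \<Otimes>\<^sub>M lborel :: ('a \<times> real) measure). snd b \<noteq> t} \<in> sets (lborel \<Otimes>\<^sub>M lborel)"
      by measurable
    show "AE x in (lborel :: 'a measure). AE y in lborel. snd (x, y) \<noteq> t"
      using AE_lborel_singleton[of t] by simp
  qed
  then show ?thesis unfolding lborel_prod .
qed

text \<open>The factor s^(-1/2) of \<rho> meets the factor (t - s)^(-1/2) of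
  \<open>heat_dom\<close>; the time integral is the Abel integral, and the space integral gives
  \<open>H\<close>.\<close>

sublocale duh: heat_source "lborel :: ('a \<times> real) measure" "\<lambda>b. b" \<rho> "\<lambda>z. beta_half * H z"
proof
  show "(\<lambda>b. b) \<in> borel_measurable (lborel :: ('a \<times> real) measure)" by simp
  show "\<rho> \<in> borel_measurable (lborel :: ('a \<times> real) measure)" by simp
  show "0 \<le> \<rho> b" for b by (rule \<rho>_ge_0)
  show "\<rho> b \<noteq> 0 \<Longrightarrow> 0 \<le> snd b" for b by (auto simp: \<rho>_def split: if_splits)
  show "AE b in (lborel :: ('a \<times> real) measure). snd b \<noteq> t" for t by (rule AE_lborel_snd_neq)
  show "continuous_on {z. 0 < snd z} (\<lambda>z. beta_half * H z)"
    by (intro continuous_intros H_continuous)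
  fix z :: "'a \<times> real" assume z: "0 < snd z"
  obtain x t where xt: "z = (x, t)" "t > 0" using z by (cases z) auto
  have "(\<integral>\<^sup>+b. ennreal (heat_dom (z - b) * \<rho> b) \<partial>lborel)
     = (\<integral>\<^sup>+b. ennreal (((t - snd b) powr (- (1/2)) * snd b powr (- (1/2)))
         * (heat_kernel (x - fst b) (2 * (t - snd b)) * H b)) * indicator {0<..<t} (snd b) \<partial>lborel)"
    by (intro nn_integral_cong) (auto simp: heat_dom_def \<rho>_def xt indicator_def mult_ac)
  also have "\<dots> = ennreal (H (x, t)) * ennreal beta_half"
    unfolding nn_integral_abel_kernel[OF xt(2), symmetric]
    by (rule nn_integral_duhamel) auto
  also have "\<dots> = ennreal (beta_half * H z)"
    by (simp add: xt ennreal_mult beta_half_nonneg H_nonneg mult.commute)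
  finally show "has_bochner_integral lborel (\<lambda>b. heat_dom (z - b) * \<rho> b) (beta_half * H z)"
    by (intro has_bochner_integral_nn_integral AE_I2 mult_nonneg_nonneg heat_dom_nonneg \<rho>_ge_0
        beta_half_nonneg H_nonneg) auto
qed

lemma init_potential_bound:
  assumes t: "t > 0"
  shows "\<bar>fst (init.potential \<phi> (x, t))\<bar> \<le> 2 powr (real DIM('a) / 2) * H (x, t)"
    and "norm (snd (init.potential \<phi> (x, t))) \<le> 2 powr (real DIM('a) / 2) * (t powr (- (1/2)) * H (x, t))"
proof -
  have "ennreal (norm (fst (init.potential \<phi> (x, t)))) \<le> (\<integral>\<^sup>+\<xi>. ennreal (2 powr (real DIM('a) / 2)) * ennreal (heat_kernel (x - \<xi>) (2 * t) * \<bar>\<phi> \<xi>\<bar>) \<partial>lborel)"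
    unfolding init.potential_def
  proof (rule order_trans[OF norm_bounded_linear_integral_le[OF bounded_linear_fst] nn_integral_mono])
    fix \<xi>
    have "norm (fst (\<phi> \<xi> *\<^sub>R heat_jet ((x, t) - (\<xi>, 0)))) \<le> 2 powr (real DIM('a) / 2) * (heat_kernel (x - \<xi>) (2 * t) * \<bar>\<phi> \<xi>\<bar>)"
      using mult_right_mono[OF norm_fst_heat_jet_le[of "(x - \<xi>, t)"] abs_ge_zero[of "\<phi> \<xi>"]] t
      by (simp add: abs_mult mult_ac)
    then show "ennreal (norm (fst (\<phi> \<xi> *\<^sub>R heat_jet ((x, t) - (\<xi>, 0))))) \<le> ennreal (2 powr (real DIM('a) / 2)) * ennreal (heat_kernel (x - \<xi>) (2 * t) * \<bar>\<phi> \<xi>\<bar>)"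
      by (subst ennreal_mult[symmetric]) (auto simp: heat_kernel_nonneg intro: ennreal_leI)
  qed
  also have "\<dots> = ennreal (2 powr (real DIM('a) / 2)) * ennreal (H (x, t))"
    unfolding nn_integral_H[OF t, symmetric] by (rule nn_integral_cmult) measurable
  also have "\<dots> = ennreal (2 powr (real DIM('a) / 2) * H (x, t))"
    by (subst ennreal_mult[symmetric]) (auto simp: H_nonneg mult_ac)
  finally show "\<bar>fst (init.potential \<phi> (x, t))\<bar> \<le> 2 powr (real DIM('a) / 2) * H (x, t)"
    by (subst (asm) ennreal_le_iff) (auto simp: H_nonneg)
  have "ennreal (norm (snd (init.potential \<phi> (x, t)))) \<le> (\<integral>\<^sup>+\<xi>. ennreal (2 powr (real DIM('a) / 2) * t powr (- (1/2))) * ennreal (heat_kernel (x - \<xi>) (2 * t) * \<bar>\<phi> \<xi>\<bar>) \<partial>lborel)"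
    unfolding init.potential_def
  proof (rule order_trans[OF norm_bounded_linear_integral_le[OF bounded_linear_snd] nn_integral_mono])
    fix \<xi>
    have "norm (snd (\<phi> \<xi> *\<^sub>R heat_jet ((x, t) - (\<xi>, 0)))) \<le> (2 powr (real DIM('a) / 2) * t powr (- (1/2))) * (heat_kernel (x - \<xi>) (2 * t) * \<bar>\<phi> \<xi>\<bar>)"
      using mult_right_mono[OF norm_snd_heat_jet_le[of "(x - \<xi>, t)"] abs_ge_zero[of "\<phi> \<xi>"]] t
      by (simp add: abs_mult mult_ac heat_dom_def)
    then show "ennreal (norm (snd (\<phi> \<xi> *\<^sub>R heat_jet ((x, t) - (\<xi>, 0))))) \<le> ennreal (2 powr (real DIM('a) / 2) * t powr (- (1/2))) * ennreal (heat_kernel (x - \<xi>) (2 * t) * \<bar>\<phi> \<xi>\<bar>)"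
      by (subst ennreal_mult[symmetric]) (auto simp: heat_kernel_nonneg intro: ennreal_leI)
  qed
  also have "\<dots> = ennreal (2 powr (real DIM('a) / 2) * t powr (- (1/2))) * ennreal (H (x, t))"
    unfolding nn_integral_H[OF t, symmetric] by (rule nn_integral_cmult) measurable
  also have "\<dots> = ennreal (2 powr (real DIM('a) / 2) * (t powr (- (1/2)) * H (x, t)))"
    by (subst ennreal_mult[symmetric]) (auto simp: H_nonneg mult_ac)
  finally show "norm (snd (init.potential \<phi> (x, t))) \<le> 2 powr (real DIM('a) / 2) * (t powr (- (1/2)) * H (x, t))"
    by (subst (asm) ennreal_le_iff) (auto simp: H_nonneg)
qed

text \<open>The set S selects source times: all of them for existence, the second half of (0, t) for
  the asymptotics.\<close>

lemma duhamel_bound: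
  assumes [measurable]: "a \<in> borel_measurable borel" and a: "\<And>s. 0 \<le> a s"
    and S[measurable]: "S \<in> sets borel"
    and F: "\<And>y s. s > 0 \<Longrightarrow> \<bar>F (y, s)\<bar> \<le> a s * indicator S s * H (y, s)" and F0: "\<And>y s. s \<le> 0 \<Longrightarrow> F (y, s) = 0"
  shows "ennreal \<bar>fst (duh.potential F (x, t))\<bar> \<le> ennreal (2 powr (real DIM('a) / 2) * H (x, t)) * (\<integral>\<^sup>+s\<in>{0<..<t} \<inter> S. ennreal (a s) \<partial>lborel)"
    and "ennreal (norm (snd (duh.potential F (x, t)))) \<le> ennreal (2 powr (real DIM('a) / 2) * H (x, t)) * (\<integral>\<^sup>+s\<in>{0<..<t} \<inter> S. ennreal ((t - s) powr (- (1/2)) * a s) \<partial>lborel)"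
proof -
  have "ennreal (norm (fst (duh.potential F (x, t)))) \<le> (\<integral>\<^sup>+b. ennreal (2 powr (real DIM('a) / 2)) * (ennreal (a (snd b) * (heat_kernel (x - fst b) (2 * (t - snd b)) * H b)) * indicator ({0<..<t} \<inter> S) (snd b)) \<partial>lborel)"
    unfolding duh.potential_def
  proof (rule order_trans[OF norm_bounded_linear_integral_le[OF bounded_linear_fst] nn_integral_mono])
    fix b :: "'a \<times> real"
    obtain y s where b: "b = (y, s)" by (cases b)
    show "ennreal (norm (fst (F b *\<^sub>R heat_jet ((x, t) - b)))) \<le> ennreal (2 powr (real DIM('a) / 2)) * (ennreal (a (snd b) * (heat_kernel (x - fst b) (2 * (t - snd b)) * H b)) * indicator ({0<..<t} \<inter> S) (snd b))"
    proof (cases "0 < s \<and> s < t")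
      case True
      have "norm (fst (F b *\<^sub>R heat_jet ((x, t) - b))) \<le> (a s * indicator S s * H (y, s)) * (2 powr (real DIM('a) / 2) * heat_kernel (x - y) (2 * (t - s)))"
        using mult_mono[OF F[of s y] norm_fst_heat_jet_le[of "(x - y, t - s)"]] True a[of s] H_nonneg
        by (auto simp: b abs_mult indicator_def)
      then show ?thesis
        using True by (cases "s \<in> S")
         (auto simp: b ennreal_mult[symmetric] a H_nonneg heat_kernel_nonneg mult_ac intro!: ennreal_leI)
    next
      case False
      then show ?thesis using F0[of s y] by (auto simp: b heat_jet_def)
    qed
  qed
  also have "\<dots> = ennreal (2 powr (real DIM('a) / 2)) * (ennreal (H (x, t)) * (\<integral>\<^sup>+s\<in>{0<..<t} \<inter> S. ennreal (a s) \<partial>lborel))"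
    by (subst nn_integral_cmult, measurable, subst nn_integral_duhamel) (auto simp: a)
  finally show "ennreal \<bar>fst (duh.potential F (x, t))\<bar> \<le> ennreal (2 powr (real DIM('a) / 2) * H (x, t)) * (\<integral>\<^sup>+s\<in>{0<..<t} \<inter> S. ennreal (a s) \<partial>lborel)"
    by (simp add: ennreal_mult H_nonneg mult.assoc)
  have "ennreal (norm (snd (duh.potential F (x, t)))) \<le> (\<integral>\<^sup>+b. ennreal (2 powr (real DIM('a) / 2)) * (ennreal (((t - snd b) powr (- (1/2)) * a (snd b)) * (heat_kernel (x - fst b) (2 * (t - snd b)) * H b)) * indicator ({0<..<t} \<inter> S) (snd b)) \<partial>lborel)"
    unfolding duh.potential_def
  proof (rule order_trans[OF norm_bounded_linear_integral_le[OF bounded_linear_snd] nn_integral_mono])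
    fix b :: "'a \<times> real"
    obtain y s where b: "b = (y, s)" by (cases b)
    show "ennreal (norm (snd (F b *\<^sub>R heat_jet ((x, t) - b)))) \<le> ennreal (2 powr (real DIM('a) / 2)) * (ennreal (((t - snd b) powr (- (1/2)) * a (snd b)) * (heat_kernel (x - fst b) (2 * (t - snd b)) * H b)) * indicator ({0<..<t} \<inter> S) (snd b))"
    proof (cases "0 < s \<and> s < t")
      case True
      have "norm (snd (F b *\<^sub>R heat_jet ((x, t) - b))) = \<bar>F (y, s)\<bar> * norm (snd (heat_jet (x - y, t - s)))"
        by (simp add: b)
      also have "\<dots> \<le> (a s * indicator S s * H (y, s)) * (2 powr (real DIM('a) / 2) * ((t - s) powr (- (1/2)) * heat_kernel (x - y) (2 * (t - s))))"
        using F[of s y] norm_snd_heat_jet_le[of "(x - y, t - s)"] True a[of s] H_nonneg[of "(y, s)"]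
        by (intro mult_mono) (auto simp: heat_dom_def)
      finally have "norm (snd (F b *\<^sub>R heat_jet ((x, t) - b))) \<le> (a s * indicator S s * H (y, s)) * (2 powr (real DIM('a) / 2) * ((t - s) powr (- (1/2)) * heat_kernel (x - y) (2 * (t - s))))" .
      then show ?thesis
        using True F[of s y] by (cases "s \<in> S")
         (auto simp: b ennreal_mult[symmetric] a H_nonneg heat_kernel_nonneg mult_ac intro!: ennreal_leI)
    next
      case False
      then show ?thesis using F0[of s y] by (auto simp: b heat_jet_def)
    qed
  qed
  also have "\<dots> = ennreal (2 powr (real DIM('a) / 2)) * (ennreal (H (x, t)) * (\<integral>\<^sup>+s\<in>{0<..<t} \<inter> S. ennreal ((t - s) powr (- (1/2)) * a s) \<partial>lborel))"
    by (subst nn_integral_cmult, measurable, subst nn_integral_duhamel) (auto simp: a)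
  finally show "ennreal (norm (snd (duh.potential F (x, t)))) \<le> ennreal (2 powr (real DIM('a) / 2) * H (x, t)) * (\<integral>\<^sup>+s\<in>{0<..<t} \<inter> S. ennreal ((t - s) powr (- (1/2)) * a s) \<partial>lborel)"
    by (simp add: ennreal_mult H_nonneg mult.assoc)
qed

text \<open>Bounding the singular integral of the gradient part is enough for both components,
  because 1 \<le> sqrt t (t - s)^(-1/2) for 0 < s < t.\<close>

lemma duhamel_jet_bound:
  assumes [measurable]: "a \<in> borel_measurable borel" and a: "\<And>s. 0 \<le> a s"
    and S[measurable]: "S \<in> sets borel"
    and F: "\<And>y s. s > 0 \<Longrightarrow> \<bar>F (y, s)\<bar> \<le> a s * indicator S s * H (y, s)" and F0: "\<And>y s. s \<le> 0 \<Longrightarrow> F (y, s) = 0"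
    and t: "0 < t" and P: "0 \<le> P"
    and tail: "(\<integral>\<^sup>+s\<in>{0<..<t} \<inter> S. ennreal ((t - s) powr (- (1/2)) * a s) \<partial>lborel) \<le> ennreal P"
  shows "\<bar>fst (duh.potential F (x, t))\<bar> \<le> 2 powr (real DIM('a) / 2) * H (x, t) * (sqrt t * P)"
    and "norm (snd (duh.potential F (x, t))) \<le> 2 powr (real DIM('a) / 2) * H (x, t) * P"
proof -
  let ?h = "2 powr (real DIM('a) / 2) * H (x, t)" and ?S = "{0<..<t} \<inter> S"
  have h0: "0 \<le> ?h" by (simp add: H_nonneg)
  have "ennreal (norm (snd (duh.potential F (x, t)))) \<le> ennreal ?h * ennreal P"
    by (rule order_trans[OF duhamel_bound(2)[OF assms(1) a S F F0] mult_left_mono[OF tail]]) auto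
  then show "norm (snd (duh.potential F (x, t))) \<le> ?h * P"
    unfolding ennreal_mult[OF h0 P, symmetric] using h0 P by (subst (asm) ennreal_le_iff) auto
  have "(\<integral>\<^sup>+s\<in>?S. ennreal (a s) \<partial>lborel)
     \<le> (\<integral>\<^sup>+s. ennreal (sqrt t) * (ennreal ((t - s) powr (- (1/2)) * a s) * indicator ?S s) \<partial>lborel)"
  proof (rule nn_integral_mono)
    fix s
    have "a s \<le> sqrt t * ((t - s) powr (- (1/2)) * a s)" if "0 < s" "s < t"
    proof -
      have "1 \<le> sqrt t * (t - s) powr (- (1/2))"
        using that by (simp add: powr_minus_half field_simps)
      from mult_right_mono[OF this a[of s]] show ?thesis by (simp add: mult_ac)
    qed
    then show "ennreal (a s) * indicator ?S s \<le> ennreal (sqrt t) * (ennreal ((t - s) powr (- (1/2)) * a s) * indicator ?S s)"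
      using t a by (auto simp: indicator_def ennreal_mult[symmetric] intro!: ennreal_leI)
  qed
  also have "\<dots> = ennreal (sqrt t) * (\<integral>\<^sup>+s\<in>?S. ennreal ((t - s) powr (- (1/2)) * a s) \<partial>lborel)"
    by (rule nn_integral_cmult) measurable
  also have "\<dots> \<le> ennreal (sqrt t) * ennreal P" by (intro mult_left_mono tail) auto
  also have "\<dots> = ennreal (sqrt t * P)" using P t by (simp add: ennreal_mult)
  finally have tail': "(\<integral>\<^sup>+s\<in>?S. ennreal (a s) \<partial>lborel) \<le> ennreal (sqrt t * P)" .
  have tP: "0 \<le> sqrt t * P" using t P by simp
  have "ennreal \<bar>fst (duh.potential F (x, t))\<bar> \<le> ennreal ?h * ennreal (sqrt t * P)"
    by (rule order_trans[OF duhamel_bound(1)[OF assms(1) a S F F0] mult_left_mono[OF tail']]) auto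
  then show "\<bar>fst (duh.potential F (x, t))\<bar> \<le> ?h * (sqrt t * P)"
    unfolding ennreal_mult[OF h0 tP, symmetric] using h0 tP by (subst (asm) ennreal_le_iff) auto
qed

end

subsection \<open>The time weight and a supersolution of the comparison inequality\<close>

text \<open>The derivative is asked for only in the open interval, because the integrands in
  question are singular at an endpoint: \<open>kw\<close> at 0, the Abel factor at t.\<close>

lemma nn_integral_FTC_interior:
  fixes f F :: "real \<Rightarrow> real"
  assumes "a \<le> b" "continuous_on {a..b} F" "\<And>x. a < x \<Longrightarrow> x < b \<Longrightarrow> (F has_real_derivative f x) (at x)"
    and "\<And>x. a \<le> x \<Longrightarrow> x \<le> b \<Longrightarrow> 0 \<le> f x"
  shows "(\<integral>\<^sup>+x\<in>{a..b}. ennreal (f x) \<partial>lborel) = ennreal (F b - F a)"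
proof -
  have "(f has_integral F b - F a) {a..b}"
    using assms(3)
    by (intro fundamental_theorem_of_calculus_interior assms(1,2))
      (auto simp: has_real_derivative_iff_has_vector_derivative[symmetric])
  then show ?thesis
    using assms(4) by (intro nn_integral_has_integral_lebesgue') auto
qed

text \<open>Up to constants \<open>kw A\<close> is the weight \<open>(1 + s) powr (- A) * (1 + (1 + s) powr (1/2) * s powr (- (1/2)))\<close>
  produced by the growth condition on the nonlinearity, in a form that has an explicit bounded primitive.\<close>

definition kw :: "real \<Rightarrow> real \<Rightarrow> real" where
  "kw A s = s powr (- (1/2)) * (1 + sqrt s) powr (1 - 2 * A)"

text \<open>Obtained by substituting r = 1 + sqrt s, which turns the weight into 2 r^(1 - 2A) dr;
  normalised to vanish at 0.\<close>

definition kw_primitive :: "real \<Rightarrow> real \<Rightarrow> real" where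
  "kw_primitive A s = (1 - (1 + sqrt s) powr (2 - 2 * A)) / (A - 1)"

lemma kw_nonneg: "0 \<le> kw A s"
  by (simp add: kw_def)

lemma kw_measurable[measurable]: "kw A \<in> borel_measurable borel"
  unfolding kw_def by measurable

lemma powr_nonpos_le_one: "1 \<le> x \<Longrightarrow> a \<le> 0 \<Longrightarrow> x powr a \<le> 1" for x a :: real
  using powr_mono[of a 0 x] by simp

lemma kw_le: "A > 1 \<Longrightarrow> s > 0 \<Longrightarrow> kw A s \<le> s powr (- (1/2))"
  unfolding kw_def by (intro mult_right_le_one_le) (auto intro!: powr_nonpos_le_one)

lemma kw_antimono:
  assumes "A > 1" "0 < r" "r \<le> s"
  shows "kw A s \<le> kw A r"
  unfolding kw_def using assms by (intro mult_mono powr_mono2') (auto simp: add_pos_nonneg)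

text \<open>The right-hand side is at most 1, which serves the supersolution, and tends to 0 for
  large s, which later makes the contribution of late sources vanish.\<close>

lemma mult_kw_le: "A > 1 \<Longrightarrow> s > 0 \<Longrightarrow> s * kw A s \<le> (1 + sqrt s) powr (2 - 2 * A)"
proof -
  assume "A > 1" "s > 0"
  have "s * kw A s = sqrt s * (1 + sqrt s) powr (1 - 2 * A)"
    using \<open>s > 0\<close> by (simp add: kw_def powr_minus_half field_simps)
  also have "\<dots> \<le> (1 + sqrt s) powr 1 * (1 + sqrt s) powr (1 - 2 * A)"
    using \<open>s > 0\<close> by (intro mult_right_mono) auto
  also have "\<dots> = (1 + sqrt s) powr (2 - 2 * A)"
    unfolding powr_add[symmetric] by simp
  finally show ?thesis .
qed

lemma kw_primitive_deriv:
  assumes "A > 1" "s > 0"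
  shows "(kw_primitive A has_real_derivative kw A s) (at s)"
proof -
  have d: "((\<lambda>s. 1 + sqrt s) has_real_derivative inverse (sqrt s) / 2) (at s)"
    using assms by (auto intro!: derivative_eq_intros)
  have s0: "1 + sqrt s > 0" using assms by (simp add: add_pos_nonneg)
  have "((\<lambda>s. (1 + sqrt s) powr (2 - 2 * A)) has_real_derivative
      (2 - 2 * A) * (1 + sqrt s) powr (2 - 2 * A - 1) * (inverse (sqrt s) / 2)) (at s)"
    by (rule DERIV_chain2[OF has_real_derivative_powr[OF s0] d])
  from DERIV_cdivide[OF DERIV_diff[OF DERIV_const[of 1] this], of "A - 1"]
  have "((\<lambda>s. (1 - (1 + sqrt s) powr (2 - 2 * A)) / (A - 1)) has_real_derivative
      - ((2 - 2 * A) * (1 + sqrt s) powr (2 - 2 * A - 1) * (inverse (sqrt s) / 2)) / (A - 1)) (at s)"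
    by simp
  moreover have "- ((2 - 2 * A) * (1 + sqrt s) powr (2 - 2 * A - 1) * (inverse (sqrt s) / 2)) / (A - 1) = kw A s"
  proof -
    have e: "2 - 2 * A - 1 = 1 - 2 * A" by simp
    have q: "- ((2 - 2 * A) * P * (i / 2)) / (A - 1) = i * P" for P i
      using assms by (simp add: field_simps)
    show ?thesis
      unfolding e kw_def q using assms by (simp add: powr_minus_half inverse_eq_divide)
  qed
  ultimately show ?thesis
    unfolding kw_primitive_def[abs_def] by simp
qed

lemma kw_primitive_cont: "A > 1 \<Longrightarrow> continuous_on {0..t} (kw_primitive A)"
  unfolding kw_primitive_def[abs_def]
  by (intro continuous_intros ballI) (simp_all add: add_nonneg_eq_0_iff)

lemma kw_primitive_bounds:
  assumes "A > 1" "s \<ge> 0"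
  shows "0 \<le> kw_primitive A s" "kw_primitive A s \<le> 1 / (A - 1)"
proof -
  have "(1 + sqrt s) powr (2 - 2 * A) \<le> 1"
    using assms by (intro powr_nonpos_le_one) auto
  then show "0 \<le> kw_primitive A s" using assms by (simp add: kw_primitive_def)
  show "kw_primitive A s \<le> 1 / (A - 1)"
    using assms by (simp add: kw_primitive_def divide_right_mono)
qed

lemma kw_primitive_mono:
  assumes "A > 1" "0 \<le> r" "r \<le> s"
  shows "kw_primitive A r \<le> kw_primitive A s"
proof -
  have "(1 + sqrt s) powr (2 - 2 * A) \<le> (1 + sqrt r) powr (2 - 2 * A)"
    using assms by (intro powr_mono2') (auto simp: add_pos_nonneg)
  then show ?thesis using assms by (simp add: kw_primitive_def divide_right_mono)
qed

text \<open>The bounded primitive on [0, n] and monotone convergence in n. This makes the total mass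
  produced by the nonlinearity finite.\<close>

lemma nn_integral_kw_le:
  assumes "A > 1" "S \<subseteq> {0<..}"
  shows "(\<integral>\<^sup>+s\<in>S. ennreal (kw A s) \<partial>lborel) \<le> ennreal (1 / (A - 1))"
proof -
  have b: "(\<integral>\<^sup>+s\<in>{0..real n}. ennreal (kw A s) \<partial>lborel) \<le> ennreal (1 / (A - 1))" for n
  proof -
    have "(\<integral>\<^sup>+s\<in>{0..real n}. ennreal (kw A s) \<partial>lborel) = ennreal (kw_primitive A (real n) - kw_primitive A 0)"
      using assms
      by (intro nn_integral_FTC_interior kw_primitive_cont kw_primitive_deriv kw_nonneg) auto
    also have "\<dots> \<le> ennreal (1 / (A - 1))"
      using kw_primitive_bounds[OF assms(1), of "real n"] by (intro ennreal_leI) (auto simp: kw_primitive_def)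
    finally show ?thesis .
  qed
  have "(\<integral>\<^sup>+s\<in>S. ennreal (kw A s) \<partial>lborel) \<le> (\<integral>\<^sup>+s. (SUP n. ennreal (kw A s) * indicator {0..real n} s) \<partial>lborel)"
  proof (rule nn_integral_mono)
    fix s :: real
    obtain n where n: "s \<le> real n" using real_arch_simple by blast
    have "ennreal (kw A s) * indicator S s \<le> ennreal (kw A s) * indicator {0..real n} s"
      using assms(2) n by (intro mult_left_mono) (auto simp: indicator_def)
    also have "\<dots> \<le> (SUP n. ennreal (kw A s) * indicator {0..real n} s)"
      by (rule SUP_upper) simp
    finally show "ennreal (kw A s) * indicator S s \<le> (SUP n. ennreal (kw A s) * indicator {0..real n} s)" .
  qed
  also have "\<dots> = (SUP n. \<integral>\<^sup>+s. ennreal (kw A s) * indicator {0..real n} s \<partial>lborel)"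
    by (intro nn_integral_monotone_convergence_SUP)
      (auto simp: incseq_def le_fun_def indicator_def)
  also have "\<dots> \<le> ennreal (1 / (A - 1))"
    by (intro SUP_least b)
  finally show ?thesis .
qed

text \<open>Near the singularity \<open>h\<close> is replaced by its bound, and the Abel factor has
  the primitive - 2 sqrt (t - s).\<close>

lemma nn_integral_abel_tail:
  fixes \<tau> t m :: real
  assumes "\<tau> < t" and m: "\<And>s. \<tau> \<le> s \<Longrightarrow> s < t \<Longrightarrow> h s \<le> m" "0 \<le> m"
  shows "(\<integral>\<^sup>+s\<in>{\<tau>..<t}. ennreal ((t - s) powr (- (1/2)) * h s) \<partial>lborel) \<le> ennreal (2 * sqrt (t - \<tau>) * m)"
proof -
  have "(\<integral>\<^sup>+s\<in>{\<tau>..t}. ennreal ((t - s) powr (- (1/2)) * m) \<partial>lborel) = ennreal (- 2 * m * sqrt (t - t) - (- 2 * m * sqrt (t - \<tau>)))"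
  proof (rule nn_integral_FTC_interior)
    show "continuous_on {\<tau>..t} (\<lambda>s. - 2 * m * sqrt (t - s))" by (intro continuous_intros)
    show "((\<lambda>s. - 2 * m * sqrt (t - s)) has_real_derivative (t - s) powr (- (1/2)) * m) (at s)" if "\<tau> < s" "s < t" for s
      using that by (auto intro!: derivative_eq_intros simp: powr_minus_half field_simps)
  qed (use assms in auto)
  moreover have "(\<integral>\<^sup>+s\<in>{\<tau>..<t}. ennreal ((t - s) powr (- (1/2)) * h s) \<partial>lborel)
      \<le> (\<integral>\<^sup>+s\<in>{\<tau>..t}. ennreal ((t - s) powr (- (1/2)) * m) \<partial>lborel)"
    using m by (intro nn_integral_mono) (auto simp: indicator_def intro!: ennreal_leI mult_left_mono)
  ultimately show ?thesis by (simp add: mult_ac)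
qed

lemma abel_kw_tail:
  assumes A: "A > 1" and t: "t > 0"
  shows "(\<integral>\<^sup>+s\<in>{t/2..<t}. ennreal ((t - s) powr (- (1/2)) * kw A s) \<partial>lborel)
    \<le> ennreal (4 * t powr (- (1/2)) * (1 + sqrt (t / 2)) powr (2 - 2 * A))"
proof -
  have "(\<integral>\<^sup>+s\<in>{t/2..<t}. ennreal ((t - s) powr (- (1/2)) * kw A s) \<partial>lborel) \<le> ennreal (2 * sqrt (t - t/2) * kw A (t/2))"
    using t kw_antimono[OF A, of "t/2"] kw_nonneg by (intro nn_integral_abel_tail) auto
  also have "\<dots> \<le> ennreal (4 * t powr (- (1/2)) * (1 + sqrt (t / 2)) powr (2 - 2 * A))"
  proof (rule ennreal_leI)
    have "sqrt (t - t/2) \<le> sqrt t" using t by simp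
    then have "2 * sqrt (t - t/2) * kw A (t/2) \<le> 2 * sqrt t * kw A (t/2)"
      using kw_nonneg by (intro mult_right_mono) auto
    also have "\<dots> = 4 * t powr (- (1/2)) * ((t/2) * kw A (t/2))"
      using t by (simp add: powr_minus_half field_simps)
    also have "\<dots> \<le> 4 * t powr (- (1/2)) * (1 + sqrt (t / 2)) powr (2 - 2 * A)"
      using mult_kw_le[OF A, of "t/2"] t by (intro mult_left_mono) auto
    finally show "2 * sqrt (t - t/2) * kw A (t/2) \<le> 4 * t powr (- (1/2)) * (1 + sqrt (t / 2)) powr (2 - 2 * A)" .
  qed
  finally show ?thesis .
qed

text \<open>One number p serves both components of the jet: it bounds the gradient part directly
  and, times sqrt t, the value part. Monotonicity of \<beta> is there for the comparison of delayed
  with current times, the bound B for estimates uniform in time.\<close>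

lemma exists_supersolution:
  assumes A: "A > 1" and c: "c > 0" and K: "K > 0"
  obtains \<beta> :: "real \<Rightarrow> real" and B where
    "\<beta> \<in> borel_measurable borel" "\<And>s. 0 < \<beta> s" "\<And>s. 0 < s \<Longrightarrow> \<beta> s \<le> B"
    "\<And>r s. 0 < r \<Longrightarrow> r \<le> s \<Longrightarrow> \<beta> r \<le> \<beta> s"
    "\<And>t. t > 0 \<Longrightarrow> \<exists>p\<ge>0. (\<integral>\<^sup>+s\<in>{0<..<t}. ennreal ((t - s) powr (- (1/2)) * (K * kw A s * \<beta> s)) \<partial>lborel) \<le> ennreal p
        \<and> c * (1 + sqrt t * p) \<le> \<beta> t"
proof -
  \<comment> \<open>\<open>\<beta> = b exp (l J)\<close> with \<open>J' = kw A\<close>: on \<open>s < (1 - d) t\<close> the integral is absorbed by choosing \<open>l\<close> large,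
    on \<open>s > (1 - d) t\<close> by choosing \<open>d\<close> small.\<close>
  define d where "d = min (1/2) ((1 / (16 * c * K))\<^sup>2)"
  \<comment> \<open>With this \<open>l\<close> the part of the integral before (1 - d) t contributes
    \<beta> t / (4 c) to sqrt t p, and the choice of \<open>d\<close> makes the rest contribute at
    most as much. So c sqrt t p \<le> \<beta> t / 2, and the factor 2 c in \<beta> leaves the other
    half for the free term c.\<close>
  define l where "l = 4 * c * K / sqrt d"
  define \<beta> where "\<beta> s = 2 * c * exp (l * kw_primitive A s)" for s
  have d: "0 < d" "d \<le> 1/2" using c K by (auto simp: d_def)
  have d': "sqrt d \<le> 1 / (16 * c * K)"
  proof -
    have "sqrt d \<le> sqrt ((1 / (16 * c * K))\<^sup>2)"
      unfolding d_def by (intro real_sqrt_le_mono min.cobounded2)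
    also have "\<dots> = 1 / (16 * c * K)"
      using c K by (intro real_sqrt_unique) auto
    finally show ?thesis .
  qed
  have l: "0 < l" using c K d by (simp add: l_def)
  have mono: "\<beta> r \<le> \<beta> s" if "0 \<le> r" "r \<le> s" for r s
    using kw_primitive_mono[OF A that] l c by (simp add: \<beta>_def)
  \<comment> \<open>By construction \<beta> / l is a primitive of \<open>kw A\<close> times \<beta>,
    so the integral gains the factor 1 / l.\<close>
  have int: "(\<integral>\<^sup>+s\<in>{0..\<tau>}. ennreal (K * kw A s * \<beta> s) \<partial>lborel) \<le> ennreal (K * \<beta> \<tau> / l)" if "\<tau> > 0" for \<tau>
  proof -
    have "(\<integral>\<^sup>+s\<in>{0..\<tau>}. ennreal (K * kw A s * \<beta> s) \<partial>lborel) = ennreal (K * \<beta> \<tau> / l - K * \<beta> 0 / l)"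
    proof (rule nn_integral_FTC_interior)
      show "continuous_on {0..\<tau>} (\<lambda>s. K * \<beta> s / l)"
        unfolding \<beta>_def using l by (intro continuous_intros kw_primitive_cont A) auto
      show "((\<lambda>s. K * \<beta> s / l) has_real_derivative K * kw A s * \<beta> s) (at s)" if "0 < s" for s
        unfolding \<beta>_def using l by (auto intro!: derivative_eq_intros kw_primitive_deriv[OF A that])
      show "0 \<le> K * kw A s * \<beta> s" for s using K c by (simp add: \<beta>_def kw_nonneg)
    qed (use that in auto)
    also have "\<dots> \<le> ennreal (K * \<beta> \<tau> / l)"
      using K c l by (intro ennreal_leI) (simp add: \<beta>_def)
    finally show ?thesis .
  qed
  show ?thesis
  proof (rule that[of \<beta> "2 * c * exp (l * (1 / (A - 1)))"])
    show "\<beta> \<in> borel_measurable borel" unfolding \<beta>_def kw_primitive_def by measurable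
    show "0 < \<beta> s" for s using c by (simp add: \<beta>_def)
    show "\<beta> s \<le> 2 * c * exp (l * (1 / (A - 1)))" if "0 < s" for s
    proof -
      have "l * kw_primitive A s \<le> l * (1 / (A - 1))"
        using kw_primitive_bounds(2)[OF A, of s] l that by (intro mult_left_mono) auto
      then show ?thesis using c by (simp add: \<beta>_def)
    qed
    show "\<beta> r \<le> \<beta> s" if "0 < r" "r \<le> s" for r s using mono that by simp
    fix t :: real assume t: "t > 0"
    \<comment> \<open>Since d \<le> 1/2, the interval after \<tau> lies in the second half of (0,
      t), where \<open>kw A\<close> is at most its value at t / 2.\<close>
    define \<tau> where "\<tau> = (1 - d) * t"
    have \<tau>: "0 < \<tau>" "\<tau> < t" "t / 2 \<le> \<tau>" "t - \<tau> = d * t"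
    proof -
    have "d * t \<le> 1 / 2 * t" using d t by (intro mult_right_mono) auto
    moreover have "0 < d * t" using d t by simp
    ultimately show "0 < \<tau>" "\<tau> < t" "t / 2 \<le> \<tau>" "t - \<tau> = d * t"
      using t by (auto simp: \<tau>_def left_diff_distrib)
  qed
    \<comment> \<open>Before \<tau> the Abel factor is at most (d t)^(-1/2) and the rest is the
      integral \<open>int\<close>; after \<tau> the rest is bounded by its values at t / 2 and t,
      and the Abel factor integrates to 2 sqrt (d t).\<close>
    define p where "p = (d * t) powr (- (1/2)) * (K * \<beta> t / l) + 2 * sqrt (d * t) * (K * kw A (t / 2) * \<beta> t)"
    have \<beta>0: "0 \<le> \<beta> s" for s using c by (simp add: \<beta>_def)
    have p0: "0 \<le> p" unfolding p_def using K l \<beta>0 kw_nonneg d t by (intro add_nonneg_nonneg mult_nonneg_nonneg divide_nonneg_nonneg) auto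
    have 1: "(\<integral>\<^sup>+s\<in>{0<..<\<tau>}. ennreal ((t - s) powr (- (1/2)) * (K * kw A s * \<beta> s)) \<partial>lborel)
       \<le> ennreal ((d * t) powr (- (1/2)) * (K * \<beta> t / l))"
    proof -
      have "(\<integral>\<^sup>+s\<in>{0<..<\<tau>}. ennreal ((t - s) powr (- (1/2)) * (K * kw A s * \<beta> s)) \<partial>lborel)
        \<le> (\<integral>\<^sup>+s. ennreal ((d * t) powr (- (1/2))) * (ennreal (K * kw A s * \<beta> s) * indicator {0..\<tau>} s) \<partial>lborel)"
      proof (rule nn_integral_mono)
        fix s
        have k0: "0 \<le> K * kw A s * \<beta> s" using K \<beta>0 kw_nonneg by simp
        have "ennreal ((t - s) powr (- (1/2)) * (K * kw A s * \<beta> s)) \<le> ennreal ((d * t) powr (- (1/2))) * ennreal (K * kw A s * \<beta> s)" if "s < \<tau>"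
        proof -
          have "d * t \<le> t - s" using \<tau>(4) that by simp
          then have "(t - s) powr (- (1/2)) \<le> (d * t) powr (- (1/2))"
            using d t by (intro powr_mono2') auto
          then show ?thesis
            unfolding ennreal_mult[OF powr_ge_zero k0, symmetric] by (intro ennreal_leI mult_right_mono k0)
        qed
        then show "ennreal ((t - s) powr (- (1/2)) * (K * kw A s * \<beta> s)) * indicator {0<..<\<tau>} s
          \<le> ennreal ((d * t) powr (- (1/2))) * (ennreal (K * kw A s * \<beta> s) * indicator {0..\<tau>} s)"
          by (auto simp: indicator_def)
      qed
      also have "\<dots> = ennreal ((d * t) powr (- (1/2))) * (\<integral>\<^sup>+s\<in>{0..\<tau>}. ennreal (K * kw A s * \<beta> s) \<partial>lborel)"
      proof (rule nn_integral_cmult)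
        have [measurable]: "\<beta> \<in> borel_measurable borel" unfolding \<beta>_def kw_primitive_def by measurable
        show "(\<lambda>s. ennreal (K * kw A s * \<beta> s) * indicator {0..\<tau>} s) \<in> borel_measurable lborel"
          by measurable
      qed
      also have "\<dots> \<le> ennreal ((d * t) powr (- (1/2))) * ennreal (K * \<beta> \<tau> / l)"
        by (intro mult_left_mono int \<tau>) auto
      also have "\<dots> = ennreal ((d * t) powr (- (1/2)) * (K * \<beta> \<tau> / l))"
        by (rule ennreal_mult[symmetric]) (use K \<beta>0 l in auto)
      also have "\<dots> \<le> ennreal ((d * t) powr (- (1/2)) * (K * \<beta> t / l))"
        using mono[of \<tau> t] \<tau> K l by (intro ennreal_leI mult_left_mono divide_right_mono) auto
      finally show ?thesis .
    qed
    have 2: "(\<integral>\<^sup>+s\<in>{\<tau>..<t}. ennreal ((t - s) powr (- (1/2)) * (K * kw A s * \<beta> s)) \<partial>lborel)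
       \<le> ennreal (2 * sqrt (d * t) * (K * kw A (t / 2) * \<beta> t))"
      unfolding \<tau>(4)[symmetric]
    proof (rule nn_integral_abel_tail)
      fix s assume s: "\<tau> \<le> s" "s < t"
      have "kw A s \<le> kw A (t / 2)" using s \<tau> t by (intro kw_antimono A) auto
      moreover have "\<beta> s \<le> \<beta> t" using s \<tau> by (intro mono) auto
      ultimately show "K * kw A s * \<beta> s \<le> K * kw A (t / 2) * \<beta> t"
        using K \<beta>0 kw_nonneg by (intro mult_mono mult_left_mono) auto
    qed (use \<tau> K \<beta>0 kw_nonneg in auto)
    have "(\<integral>\<^sup>+s\<in>{0<..<t}. ennreal ((t - s) powr (- (1/2)) * (K * kw A s * \<beta> s)) \<partial>lborel)
      = (\<integral>\<^sup>+s. ennreal ((t - s) powr (- (1/2)) * (K * kw A s * \<beta> s)) * indicator {0<..<\<tau>} s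
           + ennreal ((t - s) powr (- (1/2)) * (K * kw A s * \<beta> s)) * indicator {\<tau>..<t} s \<partial>lborel)"
      using \<tau> by (intro nn_integral_cong) (auto simp: indicator_def)
    also have "\<dots> = (\<integral>\<^sup>+s\<in>{0<..<\<tau>}. ennreal ((t - s) powr (- (1/2)) * (K * kw A s * \<beta> s)) \<partial>lborel)
      + (\<integral>\<^sup>+s\<in>{\<tau>..<t}. ennreal ((t - s) powr (- (1/2)) * (K * kw A s * \<beta> s)) \<partial>lborel)"
    proof (rule nn_integral_add)
      have [measurable]: "\<beta> \<in> borel_measurable borel" unfolding \<beta>_def kw_primitive_def by measurable
      show "(\<lambda>s. ennreal ((t - s) powr (- (1/2)) * (K * kw A s * \<beta> s)) * indicator {0<..<\<tau>} s) \<in> borel_measurable lborel"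
        "(\<lambda>s. ennreal ((t - s) powr (- (1/2)) * (K * kw A s * \<beta> s)) * indicator {\<tau>..<t} s) \<in> borel_measurable lborel"
        by measurable
    qed
    also have "\<dots> \<le> ennreal ((d * t) powr (- (1/2)) * (K * \<beta> t / l)) + ennreal (2 * sqrt (d * t) * (K * kw A (t / 2) * \<beta> t))"
      by (intro add_mono 1 2)
    also have "\<dots> = ennreal p"
      unfolding p_def using K l \<beta>0 kw_nonneg d t
      by (intro ennreal_plus[symmetric] mult_nonneg_nonneg divide_nonneg_nonneg) auto
    finally have 3: "(\<integral>\<^sup>+s\<in>{0<..<t}. ennreal ((t - s) powr (- (1/2)) * (K * kw A s * \<beta> s)) \<partial>lborel) \<le> ennreal p" .
    have "sqrt t * p = K * \<beta> t / (sqrt d * l) + 4 * sqrt d * K * \<beta> t * ((t / 2) * kw A (t / 2))"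
      unfolding p_def using d t by (simp add: powr_minus_half real_sqrt_mult field_simps)
    also have "\<dots> \<le> K * \<beta> t / (sqrt d * l) + 4 * sqrt d * K * \<beta> t * 1"
    proof -
      have "(1 + sqrt (t / 2)) powr (2 - 2 * A) \<le> 1" using A t by (intro powr_nonpos_le_one) auto
      then have "(t / 2) * kw A (t / 2) \<le> 1" using mult_kw_le[OF A, of "t / 2"] t by simp
      then show ?thesis using K \<beta>0 d by (intro add_left_mono mult_left_mono) auto
    qed
    also have "\<dots> \<le> \<beta> t / (4 * c) + \<beta> t / (4 * c)"
    proof (rule add_mono)
      show "K * \<beta> t / (sqrt d * l) \<le> \<beta> t / (4 * c)"
        using d K c by (simp add: l_def)
      have "4 * sqrt d * K * \<beta> t * 1 \<le> 4 * (1 / (16 * c * K)) * K * \<beta> t"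
        using mult_right_mono[OF d', of "4 * (K * \<beta> t)"] K \<beta>0[of t] by (simp add: mult_ac)
      also have "\<dots> = \<beta> t / (4 * c)" using K by simp
      finally show "4 * sqrt d * K * \<beta> t * 1 \<le> \<beta> t / (4 * c)" .
    qed
    finally have "sqrt t * p \<le> \<beta> t / (4 * c) + \<beta> t / (4 * c)" .
    then have "c * (sqrt t * p) \<le> c * (\<beta> t / (4 * c) + \<beta> t / (4 * c))"
      using c by (intro mult_left_mono) auto
    also have "\<dots> = \<beta> t / 2" using c by (simp add: field_simps)
    finally have 4: "c * (sqrt t * p) \<le> \<beta> t / 2" .
    have "2 * c \<le> \<beta> t"
      using kw_primitive_bounds(1)[OF A, of t] t l c by (simp add: \<beta>_def)
    then have "c * (1 + sqrt t * p) \<le> \<beta> t" using 4 by (simp add: algebra_simps)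
    then show "\<exists>p\<ge>0. (\<integral>\<^sup>+s\<in>{0<..<t}. ennreal ((t - s) powr (- (1/2)) * (K * kw A s * \<beta> s)) \<partial>lborel) \<le> ennreal p
        \<and> c * (1 + sqrt t * p) \<le> \<beta> t"
      using 3 p0 by blast
  qed
qed

text \<open>The factor 2^A comes from (1 + sqrt s)^2 \<le> 2 (1 + s), the remaining 2 from sqrt s +
  sqrt (1 + s) \<le> 2 (1 + sqrt s).\<close>

lemma decay_weight_le_kw:
  assumes A: "A > 1" and s: "s > 0"
  shows "(1 + s) powr (- A) * (1 + (1 + s) powr (1/2) * s powr (- (1/2))) \<le> 2 powr (A + 1) * kw A s"
proof -
  have r: "0 < sqrt s" "sqrt s * sqrt s = s" using s by auto
  have "2 * sqrt s \<le> 1 + s"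
    using sum_squares_bound[of 1 "sqrt s"] r by (simp add: power2_eq_square)
  have "1 + sqrt s > 0" using r(1) by linarith
  then have p0: "(1 + sqrt s) powr 2 > 0" by (metis powr_gt_zero less_irrefl)
  from \<open>2 * sqrt s \<le> 1 + s\<close> have sq: "(1 + sqrt s) powr 2 \<le> 2 * (1 + s)"
    using r by (simp add: power2_eq_square algebra_simps)
  have "(1 + s) powr (- A) = 2 powr A * (2 * (1 + s)) powr (- A)"
    unfolding powr_mult by (simp add: powr_minus)
  also have "\<dots> \<le> 2 powr A * ((1 + sqrt s) powr 2) powr (- A)"
    by (rule mult_left_mono[OF powr_mono2'[OF _ p0 sq]]) (use A in auto)
  also have "\<dots> = 2 powr A * (1 + sqrt s) powr (- 2 * A)"
    by (simp add: powr_powr)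
  finally have 1: "(1 + s) powr (- A) \<le> 2 powr A * (1 + sqrt s) powr (- 2 * A)" .
  have "sqrt (1 + s) \<le> 1 + sqrt s"
    using sqrt_add_le_add_sqrt[of 1 s] s by simp
  then have "sqrt s + sqrt (1 + s) \<le> sqrt s + (1 + sqrt s)"
    by (intro add_left_mono)
  also have "\<dots> \<le> 2 * (1 + sqrt s)"
    by simp
  finally have "sqrt s + sqrt (1 + s) \<le> 2 * (1 + sqrt s)" .
  from divide_right_mono[OF this, of "sqrt s"]
  have "1 + sqrt (1 + s) / sqrt s \<le> 2 * (1 + sqrt s) / sqrt s"
    using r(1) by (simp add: add_divide_distrib)
  then have 2: "1 + (1 + s) powr (1/2) * s powr (- (1/2)) \<le> 2 * (1 + sqrt s) / sqrt s"
    using s by (simp add: powr_minus_half powr_half_sqrt)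
  have "(1 + s) powr (- A) * (1 + (1 + s) powr (1/2) * s powr (- (1/2)))
     \<le> (2 powr A * (1 + sqrt s) powr (- 2 * A)) * (2 * (1 + sqrt s) / sqrt s)"
    by (rule mult_mono[OF 1 2]) auto
  also have "\<dots> = (2 powr A * 2) * ((1 / sqrt s) * ((1 + sqrt s) powr (- 2 * A) * (1 + sqrt s)))"
    by simp
  also have "(1 + sqrt s) powr (- 2 * A) * (1 + sqrt s) = (1 + sqrt s) powr (1 - 2 * A)"
  proof -
    have "(1 + sqrt s) powr (- 2 * A) * (1 + sqrt s) powr 1 = (1 + sqrt s) powr (- 2 * A + 1)"
      by (rule powr_add[symmetric])
    then show ?thesis using r(1) by (simp add: add.commute)
  qed
  also have "2 powr A * 2 = 2 powr (A + 1)" by (simp add: powr_add)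
  finally show ?thesis using s by (simp add: kw_def powr_minus_half)
qed

subsection \<open>Existence by delayed approximation\<close>

text \<open>The Arzela-Ascoli argument: a diagonal subsequence on a countable dense set, extended by
  equicontinuity. The conclusion allows moving points \<open>X n\<close>, because the approximate
  solutions will be read at delayed times that vary with n.\<close>

lemma equicontinuous_pointwise_subsequence:
  fixes W :: "nat \<Rightarrow> 'z::{metric_space,second_countable_topology} \<Rightarrow> 'v::euclidean_space"
  assumes bd: "\<And>n z. z \<in> U \<Longrightarrow> norm (W n z) \<le> R z"
    and eq: "\<And>z0 e. z0 \<in> U \<Longrightarrow> e > 0 \<Longrightarrow> \<exists>d>0. \<forall>z. dist z z0 < d \<longrightarrow> z \<in> U \<and> (\<forall>n. norm (W n z - W n z0) < e)"
  obtains k g where "strict_mono (k :: nat \<Rightarrow> nat)"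
    "\<And>z X. z \<in> U \<Longrightarrow> X \<longlonglongrightarrow> z \<Longrightarrow> (\<lambda>n. W (k n) (X n)) \<longlonglongrightarrow> g z"
proof -
  obtain D :: "'z set" where D: "countable D" "\<And>X. open X \<Longrightarrow> X \<noteq> {} \<Longrightarrow> \<exists>d\<in>D. d \<in> X"
    using countable_dense_exists by blast
  \<comment> \<open>The diagonal lemma wants a bound uniform in z, while R may be unbounded;
    dividing by 1 + |R z| does not affect convergence at a fixed point.\<close>
  define V where "V n z = W n z /\<^sub>R (1 + \<bar>R z\<bar>)" for n z
  have Vb: "norm (V n z) \<le> 1" if "z \<in> D \<inter> U" for n z
  proof -
    have "norm (W n z) \<le> 1 + \<bar>R z\<bar>" using bd[of z n] that by auto
    moreover have "0 < 1 + \<bar>R z\<bar>" by simp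
    ultimately show ?thesis unfolding V_def
      by (simp add: divide_simps)
  qed
  have cD: "countable (D \<inter> U)" using D(1) by auto
  have "\<exists>k. strict_mono (k :: nat \<Rightarrow> nat) \<and> (\<forall>z\<in>D \<inter> U. \<exists>l. (\<lambda>n. V (k n) z) \<longlonglongrightarrow> l)"
  proof (rule function_convergent_subsequence[OF cD, of V 1])
    show "norm (V n z) \<le> 1" if "z \<in> D \<inter> U" for n z by (rule Vb[OF that])
  next
    fix k :: "nat \<Rightarrow> nat"
    assume "strict_mono k" "\<And>z. z \<in> D \<inter> U \<Longrightarrow> \<exists>l. (\<lambda>n. V (k n) z) \<longlonglongrightarrow> l"
    then show ?thesis by (intro exI[of _ k] conjI ballI)
  qed
  then obtain k where k: "strict_mono (k :: nat \<Rightarrow> nat)"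
    "\<And>z. z \<in> D \<inter> U \<Longrightarrow> \<exists>l. (\<lambda>n. V (k n) z) \<longlonglongrightarrow> l"
    by auto
  have conv: "convergent (\<lambda>n. W (k n) z)" if z: "z \<in> D \<inter> U" for z
  proof -
    obtain l where "(\<lambda>n. V (k n) z) \<longlonglongrightarrow> l" using k(2)[OF z] by blast
    then have "(\<lambda>n. (1 + \<bar>R z\<bar>) *\<^sub>R V (k n) z) \<longlonglongrightarrow> (1 + \<bar>R z\<bar>) *\<^sub>R l"
      by (intro tendsto_intros)
    moreover have "1 + \<bar>R z\<bar> \<noteq> 0" using abs_ge_zero[of "R z"] by linarith
    then have "(1 + \<bar>R z\<bar>) *\<^sub>R V (k n) z = W (k n) z" for n
      by (simp add: V_def)
    ultimately show ?thesis by (auto simp: convergent_def)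
  qed
  have cauchy: "Cauchy (\<lambda>n. W (k n) z0)" if z0: "z0 \<in> U" for z0
  proof (rule CauchyI)
    fix e :: real assume "e > 0"
    then have e3: "e / 3 > 0" by simp
    obtain d where d: "d > 0" "\<And>z. dist z z0 < d \<Longrightarrow> z \<in> U" "\<And>z n. dist z z0 < d \<Longrightarrow> norm (W n z - W n z0) < e / 3"
      using eq[OF z0 e3] by auto
    obtain z where z: "z \<in> D" "z \<in> ball z0 d"
      using D(2)[of "ball z0 d"] d(1) by auto
    then have dz: "dist z z0 < d" by (simp add: dist_commute)
    then have "convergent (\<lambda>n. W (k n) z)" using conv z d(2) by auto
    then have "Cauchy (\<lambda>n. W (k n) z)" by (rule convergent_Cauchy)
    from CauchyD[OF this e3] obtain M where M: "\<And>m n. m \<ge> M \<Longrightarrow> n \<ge> M \<Longrightarrow> norm (W (k m) z - W (k n) z) < e / 3" by blast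
    show "\<exists>M. \<forall>m\<ge>M. \<forall>n\<ge>M. norm (W (k m) z0 - W (k n) z0) < e"
    proof (intro exI[of _ M] allI impI)
      fix m n assume mn: "M \<le> m" "M \<le> n"
      \<comment> \<open>Through a nearby dense point z the difference splits into three parts below
        e / 3.\<close>
      have "W (k m) z0 - W (k n) z0 = (W (k m) z - W (k n) z) + (W (k n) z - W (k n) z0) - (W (k m) z - W (k m) z0)"
        by simp
      also have "norm \<dots> \<le> norm (W (k m) z - W (k n) z) + norm (W (k n) z - W (k n) z0) + norm (W (k m) z - W (k m) z0)"
        by (intro order_trans[OF norm_triangle_ineq4] add_right_mono norm_triangle_ineq)
      also have "\<dots> < e"
        using M[OF mn] d(3)[OF dz, of "k n"] d(3)[OF dz, of "k m"] by linarith
      finally show "norm (W (k m) z0 - W (k n) z0) < e" .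
    qed
  qed
  define g where "g z = lim (\<lambda>n. W (k n) z)" for z
  have g: "(\<lambda>n. W (k n) z) \<longlonglongrightarrow> g z" if "z \<in> U" for z
    using cauchy[OF that] by (simp add: g_def Cauchy_convergent_iff convergent_LIMSEQ_iff)
  show ?thesis
  proof (rule that[OF k(1), of g])
    fix z X assume z: "z \<in> U" and X: "X \<longlonglongrightarrow> z"
    have "(\<lambda>n. W (k n) (X n) - W (k n) z) \<longlonglongrightarrow> 0"
    proof (rule tendstoI)
      fix e :: real assume "e > 0"
      from eq[OF z this] obtain d where d: "d > 0" "\<And>y n. dist y z < d \<Longrightarrow> norm (W n y - W n z) < e" by blast
      from tendstoD[OF X d(1)]
      show "\<forall>\<^sub>F n in sequentially. dist (W (k n) (X n) - W (k n) z) 0 < e"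
        by eventually_elim (simp add: d(2))
    qed
    from tendsto_add[OF this g[OF z]] show "(\<lambda>n. W (k n) (X n)) \<longlonglongrightarrow> g z" by simp
  qed
qed

lemma (in heat_source) potential_measurable[measurable]:
  assumes F: "F \<in> borel_measurable M"
  shows "potential F \<in> borel_measurable borel"
proof -
  have "(\<lambda>p. fst p - pos (snd p)) \<in> borel_measurable (borel \<Otimes>\<^sub>M M)"
    by (intro borel_measurable_diff measurable_fst measurable_compose[OF measurable_snd pos_measurable])
  from measurable_compose[OF this borel_measurable_heat_jet]
  have "(\<lambda>p. F (snd p) *\<^sub>R heat_jet (fst p - pos (snd p))) \<in> borel_measurable (borel \<Otimes>\<^sub>M M)"
    by (intro borel_measurable_scaleR measurable_compose[OF measurable_snd F])
  then have "(\<lambda>z. \<integral>b. F b *\<^sub>R heat_jet (z - pos b) \<partial>M) \<in> borel_measurable borel"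
    by (intro borel_measurable_lebesgue_integral) (simp add: case_prod_beta')
  then show ?thesis by (simp add: potential_def[abs_def])
qed

lemma (in heat_source) potential_nonpos_time:
  assumes "snd z \<le> 0" "\<And>b. snd (pos b) < 0 \<Longrightarrow> F b = 0"
  shows "potential F z = 0"
proof -
  have z0: "F b *\<^sub>R heat_jet (z - pos b) = 0" for b
    using assms(1) assms(2)[of b] by (cases "snd (pos b) < 0") (auto simp: heat_jet_def)
  show ?thesis unfolding potential_def z0 by simp
qed

text \<open>The constant K bounds the source by K \<open>kw\<close> \<beta> \<open>H\<close>: C 2^(A
  + 1) is the growth condition rewritten with \<open>kw\<close>, and 2 times 2^(N/2) pays for
  reading the solution at a delayed time. The function \<beta> is a supersolution for exactly this K
  and for the loss 2^(N/2) of the kernel estimates.\<close>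

locale decaying_nonlinearity = initial_datum \<phi>
  for \<phi> :: "'a::euclidean_space \<Rightarrow> real" +
  fixes f :: "'a \<Rightarrow> real \<Rightarrow> real \<Rightarrow> 'a \<Rightarrow> real" and C A :: real
    and \<beta> :: "real \<Rightarrow> real" and B K :: real
  assumes f_cont: "continuous_on (UNIV \<times> {0<..} \<times> UNIV \<times> UNIV) (\<lambda>(x, t, p, q). f x t p q)"
    and C: "C > 0" and A: "A > 1"
    and f_bound: "\<And>x t p q. t > 0 \<Longrightarrow>
        \<bar>f x t p q\<bar> \<le> C * (1 + t) powr (- A) * (\<bar>p\<bar> + (1 + t) powr (1/2) * norm q)"
    and K_eq: "K = 2 * 2 powr (real DIM('a) / 2) * (C * 2 powr (A + 1))"
    and \<beta>_measurable[measurable]: "\<beta> \<in> borel_measurable borel"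
    and \<beta>_pos: "0 < \<beta> s" and \<beta>_le: "0 < s \<Longrightarrow> \<beta> s \<le> B"
    and \<beta>_mono: "0 < r \<Longrightarrow> r \<le> s \<Longrightarrow> \<beta> r \<le> \<beta> s"
    and super: "t > 0 \<Longrightarrow> \<exists>p\<ge>0. (\<integral>\<^sup>+s\<in>{0<..<t}. ennreal ((t - s) powr (- (1/2)) * (K * kw A s * \<beta> s)) \<partial>lborel) \<le> ennreal p
        \<and> 2 powr (real DIM('a) / 2) * (1 + sqrt t * p) \<le> \<beta> t"
begin

lemma K_pos: "0 < K"
  using C by (simp add: K_eq)

lemma B_pos: "0 < B"
  using \<beta>_pos[of 1] \<beta>_le[of 1] by simp

section \<open>Invariance of the pointwise bounds under the delayed Duhamel map\<close>

definition dominated :: "('a \<times> real \<Rightarrow> real \<times> 'a) \<Rightarrow> bool" where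
  "dominated w \<longleftrightarrow> (\<forall>x t. t > 0 \<longrightarrow> \<bar>fst (w (x, t))\<bar> \<le> \<beta> t * H (x, t)
     \<and> norm (snd (w (x, t))) \<le> t powr (- (1/2)) * (\<beta> t * H (x, t)))"

text \<open>The cutoff at 2 \<delta>, rather than at \<delta>, guarantees s \<le> 2 (s - \<delta>),
  so that the delayed time is comparable with s. For \<delta> = 0 this is the nonlinearity itself,
  extended by zero to nonpositive times.\<close>

definition src :: "real \<Rightarrow> ('a \<times> real \<Rightarrow> real \<times> 'a) \<Rightarrow> 'a \<times> real \<Rightarrow> real" where
  "src \<delta> w b = (if 2 * \<delta> < snd b then
     f (fst b) (snd b) (fst (w (fst b, snd b - \<delta>))) (snd (w (fst b, snd b - \<delta>))) else 0)"

definition duhamel_map :: "real \<Rightarrow> ('a \<times> real \<Rightarrow> real \<times> 'a) \<Rightarrow> 'a \<times> real \<Rightarrow> real \<times> 'a" where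
  "duhamel_map \<delta> w z = init.potential \<phi> z + duh.potential (src \<delta> w) z"

lemma src_measurable:
  assumes "w \<in> borel_measurable borel" and \<delta>: "0 \<le> \<delta>"
  shows "src \<delta> w \<in> borel_measurable borel"
proof -
  let ?U = "UNIV \<times> {0<..} \<times> UNIV \<times> UNIV :: ('a \<times> real \<times> real \<times> 'a) set"
  \<comment> \<open>Continuity of f is known for positive times only; extension by zero off this
    open set is Borel and agrees with f wherever the cutoff is inactive.\<close>
  let ?F = "\<lambda>v. indicator ?U v *\<^sub>R (case v of (x, t, p, q) \<Rightarrow> f x t p q)"
  have "open ?U" by (intro open_Times open_greaterThan open_UNIV)
  then have F: "?F \<in> borel_measurable borel"
    by (intro borel_measurable_continuous_on_indicator f_cont) auto
  let ?w = "\<lambda>b. w (fst b, snd b - \<delta>)"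
  have "(\<lambda>b::'a \<times> real. (fst b, snd b - \<delta>)) \<in> borel_measurable borel"
    by (intro borel_measurable_Pair) measurable
  then have w: "?w \<in> borel_measurable borel"
    by (rule measurable_compose) fact
  have m: "(\<lambda>b. (fst b, snd b, fst (?w b), snd (?w b))) \<in> borel_measurable borel"
    by (intro borel_measurable_Pair measurable_compose[OF w] borel_measurable_fst_borel borel_measurable_snd_borel)
  have Fm: "(\<lambda>b. ?F (fst b, snd b, fst (?w b), snd (?w b))) \<in> borel_measurable borel"
    by (rule measurable_compose[OF m F])
  have "{b :: 'a \<times> real. 2 * \<delta> < snd b} \<in> sets borel"
    by (intro borel_open open_Collect_less continuous_intros)
  then have "(\<lambda>b. if 2 * \<delta> < snd b then ?F (fst b, snd b, fst (?w b), snd (?w b)) else 0) \<in> borel_measurable borel"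
    by (intro measurable_If Fm borel_measurable_const) (simp only: space_borel UNIV_I simp_thms)
  moreover have "src \<delta> w = (\<lambda>b. if 2 * \<delta> < snd b then ?F (fst b, snd b, fst (?w b), snd (?w b)) else 0)"
  proof (rule ext)
    fix b
    show "src \<delta> w b = (if 2 * \<delta> < snd b then ?F (fst b, snd b, fst (?w b), snd (?w b)) else 0)"
      using \<delta> by (cases "2 * \<delta> < snd b") (simp_all add: src_def case_prod_beta)
  qed
  ultimately show ?thesis
    by (simp only:)
qed

lemma H_time_mono:
  assumes "0 < a" "a \<le> b" "b \<le> 2 * a"
  shows "H (x, a) \<le> 2 powr (real DIM('a) / 2) * H (x, b)"
proof -
  have "H (x, a) \<le> (\<integral>\<xi>. 2 powr (real DIM('a) / 2) * (heat_kernel (x - \<xi>) (2 * b) * \<bar>\<phi> \<xi>\<bar>) \<partial>lborel)"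
    unfolding H_def fst_conv snd_conv
  proof (rule integral_mono)
    show "heat_kernel (x - \<xi>) (2 * a) * \<bar>\<phi> \<xi>\<bar> \<le> 2 powr (real DIM('a) / 2) * (heat_kernel (x - \<xi>) (2 * b) * \<bar>\<phi> \<xi>\<bar>)" for \<xi>
      using mult_right_mono[OF heat_kernel_time_mono[of "2 * a" "2 * b" "x - \<xi>"], of "\<bar>\<phi> \<xi>\<bar>"] assms by (simp add: mult_ac)
  qed (use assms integrable_heat_kernel_phi in auto)
  then show ?thesis by (simp add: H_def)
qed

text \<open>With r = s - \<delta> \<ge> s / 2, each ingredient at r is controlled by its value at s:
  \<beta> is increasing, \<open>H\<close> loses 2^(N/2), and r^(-1/2) loses less than 2. The bound
  is free of \<delta>.\<close>

lemma src_bound: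
  assumes w: "dominated w" and \<delta>: "0 \<le> \<delta>" and s: "0 < s"
  shows "\<bar>src \<delta> w (y, s)\<bar> \<le> K * kw A s * \<beta> s * H (y, s)"
proof (cases "2 * \<delta> < s")
  case True
  define r where "r = s - \<delta>"
  have r: "0 < r" "r \<le> s" "s \<le> 2 * r" using True \<delta> by (auto simp: r_def)
  define h where "h = 2 * 2 powr (real DIM('a) / 2) * (\<beta> s * H (y, s))"
  have h0: "0 \<le> h" using \<beta>_pos[of s] H_nonneg[of "(y, s)"] by (simp add: h_def)
  have "\<beta> r * H (y, r) \<le> \<beta> s * (2 powr (real DIM('a) / 2) * H (y, s))"
    using \<beta>_mono[OF r(1,2)] H_time_mono[OF r] \<beta>_pos H_nonneg by (intro mult_mono) (auto simp: less_imp_le)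
  then have bh: "2 * (\<beta> r * H (y, r)) \<le> h" by (simp add: h_def mult_ac)
  have bh0: "0 \<le> \<beta> r * H (y, r)" using \<beta>_pos[of r] H_nonneg[of "(y, r)"] by simp
  have wr: "\<bar>fst (w (y, r))\<bar> \<le> \<beta> r * H (y, r)" "norm (snd (w (y, r))) \<le> r powr (- (1/2)) * (\<beta> r * H (y, r))"
    using w r(1) unfolding dominated_def by blast+
  then have p: "\<bar>fst (w (y, r))\<bar> \<le> h"
    using bh bh0 by linarith
  have "r powr (- (1/2)) \<le> 2 * s powr (- (1/2))"
  proof -
    have "sqrt s \<le> sqrt (2 * 2 * r)" using r by simp
    then have "sqrt s \<le> 2 * sqrt r" by (simp add: real_sqrt_mult)
    then show ?thesis using r s by (simp add: powr_minus_half field_simps)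
  qed
  then have "r powr (- (1/2)) * (\<beta> r * H (y, r)) \<le> 2 * s powr (- (1/2)) * (\<beta> r * H (y, r))"
    by (rule mult_right_mono[OF _ bh0])
  also have "\<dots> \<le> s powr (- (1/2)) * h"
    using mult_left_mono[OF bh, of "s powr (- (1/2))"] by (simp add: mult_ac)
  finally have q: "norm (snd (w (y, r))) \<le> s powr (- (1/2)) * h"
    using wr(2) by linarith
  have "\<bar>src \<delta> w (y, s)\<bar> \<le> C * (1 + s) powr (- A) * (\<bar>fst (w (y, r))\<bar> + (1 + s) powr (1/2) * norm (snd (w (y, r))))"
    using True f_bound[OF s] by (simp add: src_def r_def)
  also have "\<dots> \<le> C * (1 + s) powr (- A) * (h + (1 + s) powr (1/2) * (s powr (- (1/2)) * h))"
    using C p q by (intro mult_left_mono add_mono) auto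
  also have "\<dots> = C * h * ((1 + s) powr (- A) * (1 + (1 + s) powr (1/2) * s powr (- (1/2))))"
    by (simp add: algebra_simps)
  also have "\<dots> \<le> C * h * (2 powr (A + 1) * kw A s)"
    using C h0 by (intro mult_left_mono decay_weight_le_kw A s) auto
  also have "\<dots> = K * kw A s * \<beta> s * H (y, s)"
    by (simp add: K_eq h_def mult_ac)
  finally show ?thesis .
next
  case False
  then show ?thesis
    using K_pos kw_nonneg[of A s] \<beta>_pos[of s] H_nonneg[of "(y, s)"] by (simp add: src_def)
qed

lemma src_le_\<rho>:
  assumes w: "dominated w" and \<delta>: "0 \<le> \<delta>"
  shows "\<bar>src \<delta> w b\<bar> \<le> K * B * \<rho> b"
proof (cases "0 < snd b")
  case True
  obtain y s where b: "b = (y, s)" by (cases b)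
  have "\<bar>src \<delta> w b\<bar> \<le> K * kw A s * \<beta> s * H (y, s)"
    unfolding b using src_bound[OF w \<delta>] True b by simp
  also have "\<dots> \<le> K * s powr (- (1/2)) * B * H (y, s)"
    using kw_le[OF A, of s] \<beta>_le[of s] True b K_pos \<beta>_pos[of s] H_nonneg[of "(y, s)"] kw_nonneg[of A s]
    by (intro mult_right_mono mult_mono) auto
  finally show ?thesis using True b by (simp add: \<rho>_def mult_ac)
next
  case False
  then show ?thesis using \<delta> by (simp add: src_def \<rho>_def)
qed

lemma duhamel_map_measurable:
  "w \<in> borel_measurable borel \<Longrightarrow> 0 \<le> \<delta> \<Longrightarrow> duhamel_map \<delta> w \<in> borel_measurable borel"
  unfolding duhamel_map_def[abs_def]
  by (intro borel_measurable_add init.potential_measurable duh.potential_measurable)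
    (simp_all add: src_measurable)

text \<open>With c = 2^(N/2), the initial datum contributes c \<open>H\<close> and the Duhamel term
  at most c sqrt t p \<open>H\<close>, both for the value and for sqrt t times the gradient; the
  supersolution inequality bounds their sum by \<beta> \<open>H\<close>.\<close>

lemma dominated_duhamel_map:
  assumes w: "dominated w" and \<delta>: "0 \<le> \<delta>"
  shows "dominated (duhamel_map \<delta> w)"
  unfolding dominated_def
proof (intro allI impI)
  fix x :: 'a and t :: real assume t: "t > 0"
  let ?c = "2 powr (real DIM('a) / 2) :: real"
  define a where "a s = K * kw A s * \<beta> s" for s
  have a0: "0 \<le> a s" for s using K_pos kw_nonneg[of A s] \<beta>_pos[of s] by (simp add: a_def)
  have [measurable]: "a \<in> borel_measurable borel" unfolding a_def by measurable
  have F: "\<bar>src \<delta> w (y, s)\<bar> \<le> a s * indicator UNIV s * H (y, s)" if "s > 0" for y s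
    using src_bound[OF w \<delta> that, of y] by (simp add: a_def)
  have F0: "src \<delta> w (y, s) = 0" if "s \<le> 0" for y s
    using that \<delta> by (simp add: src_def)
  obtain p where p: "p \<ge> 0" "(\<integral>\<^sup>+s\<in>{0<..<t}. ennreal ((t - s) powr (- (1/2)) * a s) \<partial>lborel) \<le> ennreal p"
    "?c * (1 + sqrt t * p) \<le> \<beta> t"
    using super[OF t] by (auto simp: a_def)
  let ?h = "H (x, t)"
  have h0: "0 \<le> ?h" by (rule H_nonneg)
  have tail: "(\<integral>\<^sup>+s\<in>{0<..<t} \<inter> UNIV. ennreal ((t - s) powr (- (1/2)) * a s) \<partial>lborel) \<le> ennreal p"
    using p(2) by simp
  have f: "\<bar>fst (duh.potential (src \<delta> w) (x, t))\<bar> \<le> ?c * ?h * (sqrt t * p)"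
    and s: "norm (snd (duh.potential (src \<delta> w) (x, t))) \<le> ?c * ?h * p"
    by (intro duhamel_jet_bound[OF _ a0 _ F F0 t p(1) tail]; simp)+
  have fin: "?c * ?h + ?c * ?h * (sqrt t * p) \<le> \<beta> t * ?h"
    using mult_right_mono[OF p(3) h0] by (simp add: algebra_simps)
  have "\<bar>fst (duhamel_map \<delta> w (x, t))\<bar> \<le> ?c * ?h + ?c * ?h * (sqrt t * p)"
    using init_potential_bound(1)[OF t, of x] f
    by (simp add: duhamel_map_def abs_le_iff)
  moreover have "norm (snd (duhamel_map \<delta> w (x, t))) \<le> t powr (- (1/2)) * (?c * ?h + ?c * ?h * (sqrt t * p))"
  proof -
    have "norm (snd (duhamel_map \<delta> w (x, t))) \<le> ?c * (t powr (- (1/2)) * ?h) + ?c * ?h * p"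
      unfolding duhamel_map_def snd_add
      using init_potential_bound(2)[OF t, of x] s by (intro norm_triangle_le add_mono)
    also have "\<dots> = t powr (- (1/2)) * (?c * ?h + ?c * ?h * (sqrt t * p))"
      using t by (simp add: powr_minus_half field_simps)
    finally show ?thesis .
  qed
  moreover have "t powr (- (1/2)) * (?c * ?h + ?c * ?h * (sqrt t * p)) \<le> t powr (- (1/2)) * (\<beta> t * ?h)"
    by (intro mult_left_mono fin) auto
  ultimately show "\<bar>fst (duhamel_map \<delta> w (x, t))\<bar> \<le> \<beta> t * ?h \<and> norm (snd (duhamel_map \<delta> w (x, t))) \<le> t powr (- (1/2)) * (\<beta> t * ?h)"
    using fin by linarith
qed

text \<open>Causality with delay: only sources at times s < t reach time t, and these read the
  function at s - \<delta>.\<close>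

lemma duhamel_map_cong:
  assumes "\<And>y s. s \<le> t - \<delta> \<Longrightarrow> w (y, s) = w' (y, s)"
  shows "duhamel_map \<delta> w (x, t) = duhamel_map \<delta> w' (x, t)"
proof -
  have e: "src \<delta> w b *\<^sub>R heat_jet ((x, t) - b) = src \<delta> w' b *\<^sub>R heat_jet ((x, t) - b)" for b
    using assms by (cases "snd b < t") (auto simp: src_def heat_jet_def)
  show ?thesis
    unfolding duhamel_map_def duh.potential_def e ..
qed

definition iter :: "real \<Rightarrow> nat \<Rightarrow> 'a \<times> real \<Rightarrow> real \<times> 'a" where
  "iter \<delta> m = (duhamel_map \<delta> ^^ m) (\<lambda>_. 0)"

lemma iter_0: "iter \<delta> 0 = (\<lambda>_. 0)"
  by (simp add: iter_def)

lemma iter_Suc: "iter \<delta> (Suc m) = duhamel_map \<delta> (iter \<delta> m)"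
  by (simp add: iter_def)

lemma iter_measurable: "0 \<le> \<delta> \<Longrightarrow> iter \<delta> m \<in> borel_measurable borel"
  by (induction m) (simp_all add: iter_0 iter_Suc duhamel_map_measurable)

lemma iter_dominated: "0 \<le> \<delta> \<Longrightarrow> dominated (iter \<delta> m)"
proof (induction m)
  case 0
  then show ?case using \<beta>_pos H_nonneg by (simp add: iter_0 dominated_def less_imp_le)
qed (simp add: iter_Suc dominated_duhamel_map)

text \<open>Since the right-hand side only sees times before \<open>t - \<delta>\<close>, every iteration makes the
  approximation exact on one more time step of length \<open>\<delta>\<close>.\<close>

lemma iter_fixed_point:
  "0 < \<delta> \<Longrightarrow> t \<le> real m * \<delta> \<Longrightarrow> duhamel_map \<delta> (iter \<delta> m) (x, t) = iter \<delta> m (x, t)"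
proof (induction m arbitrary: x t)
  case 0
  then have t: "t \<le> 0" by simp
  have "init.potential \<phi> (x, t) = 0"
    using t by (intro init.potential_nonpos_time) auto
  moreover have "duh.potential (src \<delta> (iter \<delta> 0)) (x, t) = 0"
    using t \<open>0 < \<delta>\<close> by (intro duh.potential_nonpos_time) (auto simp: src_def)
  ultimately show ?case unfolding duhamel_map_def iter_0 by simp
next
  case (Suc m)
  have "duhamel_map \<delta> (iter \<delta> (Suc m)) (x, t) = duhamel_map \<delta> (iter \<delta> m) (x, t)"
  proof (rule duhamel_map_cong)
    fix y s assume "s \<le> t - \<delta>"
    then have "s \<le> real m * \<delta>" using Suc.prems by (simp add: algebra_simps)
    then show "iter \<delta> (Suc m) (y, s) = iter \<delta> m (y, s)"
      unfolding iter_Suc by (rule Suc.IH[OF Suc.prems(1)])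
  qed
  then show ?case unfolding iter_Suc .
qed

lemma exists_mild_solution:
  obtains W where "W \<in> borel_measurable borel" "dominated W"
    "\<And>x t. t > 0 \<Longrightarrow> W (x, t) = init.potential \<phi> (x, t) + duh.potential (src 0 W) (x, t)"
proof -
  define \<delta> where "\<delta> n = 1 / real (Suc n)" for n
  have \<delta>: "0 < \<delta> n" for n by (simp add: \<delta>_def)
  have \<delta>0: "\<delta> \<longlonglongrightarrow> 0" unfolding \<delta>_def[abs_def] using LIMSEQ_inverse_real_of_nat by (simp add: inverse_eq_divide)
  \<comment> \<open>With step 1 / (n + 1), the (n + 1)^2 iterations make \<open>W n\<close> exact up
    to time n + 1, so every fixed time is reached eventually.\<close>
  define W where "W n = iter (\<delta> n) (Suc n * Suc n)" for n
  have Wm: "W n \<in> borel_measurable borel" for n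
    unfolding W_def by (rule iter_measurable) (use \<delta>[of n] in simp)
  have Wd: "dominated (W n)" for n
    unfolding W_def by (rule iter_dominated) (use \<delta>[of n] in simp)
  have Wf: "duhamel_map (\<delta> n) (W n) (x, t) = W n (x, t)" if "t \<le> real (Suc n)" for n x t
  proof -
    have "real (Suc n * Suc n) * \<delta> n = real (Suc n)"
      unfolding \<delta>_def of_nat_mult by (simp del: of_nat_Suc)
    then show ?thesis
      unfolding W_def using that by (intro iter_fixed_point[OF \<delta>]) simp
  qed
  \<comment> \<open>The previous iterate exhibits \<open>W n\<close> as a Duhamel image at all
    times, also where the fixed point equation is not yet available; equicontinuity needs only this
    form.\<close>
  define W' where "W' n = iter (\<delta> n) (Suc n * Suc n - 1)" for n
  have W': "W n = duhamel_map (\<delta> n) (W' n)" "dominated (W' n)" "W' n \<in> borel_measurable borel" for n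
  proof -
    have "Suc n * Suc n = Suc (Suc n * Suc n - 1)" by simp
    then show "W n = duhamel_map (\<delta> n) (W' n)" unfolding W_def W'_def by (metis iter_Suc)
    show "dominated (W' n)" "W' n \<in> borel_measurable borel"
      using \<delta>[of n] unfolding W'_def by (auto intro!: iter_dominated iter_measurable)
  qed
  let ?U = "{z::'a \<times> real. snd z > 0}"
  have bd: "norm (W n z) \<le> (1 + snd z powr (- (1/2))) * (\<beta> (snd z) * H z)" if "z \<in> ?U" for n z
  proof -
    obtain x t where z: "z = (x, t)" by (cases z)
    have t: "t > 0" using that z by simp
    have "\<bar>fst (W n (x, t))\<bar> \<le> \<beta> t * H (x, t)" "norm (snd (W n (x, t))) \<le> t powr (- (1/2)) * (\<beta> t * H (x, t))"
      using Wd[of n] t unfolding dominated_def by blast+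
    then have "norm (W n (x, t)) \<le> \<beta> t * H (x, t) + t powr (- (1/2)) * (\<beta> t * H (x, t))"
      using norm_pair_le[of "W n (x, t)"] by (simp only: real_norm_def)
    then show ?thesis by (simp add: z distrib_right)
  qed
  \<comment> \<open>The free part is the same for all n, and all sources lie below K B \<rho>, so
    \<open>duh.modulus\<close> gives a radius independent of n.\<close>
  have eq: "\<exists>d>0. \<forall>z. dist z z0 < d \<longrightarrow> z \<in> ?U \<and> (\<forall>n. norm (W n z - W n z0) < e)"
    if z0: "z0 \<in> ?U" and e: "e > 0" for z0 e
  proof -
    have z0': "snd z0 > 0" using z0 by simp
    have op: "open ?U" by (intro open_Collect_less continuous_intros)
    have c: "continuous_on ?U (init.potential \<phi>)"
      by (rule init.continuous_on_potential[where L = 1]) auto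
    have "isCont (init.potential \<phi>) z0"
      by (rule continuous_on_eq_continuous_at[OF op, THEN iffD1, OF c, THEN bspec, OF z0])
    then obtain d1 where d1: "d1 > 0" "\<And>z. dist z z0 < d1 \<Longrightarrow> dist (init.potential \<phi> z) (init.potential \<phi> z0) < e / 2"
      unfolding continuous_at_eps_delta using e by (metis half_gt_zero)
    have KB: "0 < K * B" using K_pos B_pos by simp
    then have e2: "e / 2 / (K * B) > 0" using e by simp
    obtain d2 where d2: "d2 > 0" "\<And>z. dist z z0 < d2 \<Longrightarrow> snd z > 0" "\<And>z. dist z z0 < d2 \<Longrightarrow> duh.modulus z z0 < e / 2 / (K * B)"
      using duh.modulus_small[OF z0' e2] by blast
    show ?thesis
    proof (intro exI[of _ "min d1 d2"] conjI allI impI)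
      fix z assume z: "dist z z0 < min d1 d2"
      then show "z \<in> ?U" using d2 by simp
      fix n
      have "norm (W n z - W n z0) = norm ((init.potential \<phi> z - init.potential \<phi> z0) + (duh.potential (src (\<delta> n) (W' n)) z - duh.potential (src (\<delta> n) (W' n)) z0))"
        unfolding W'(1) duhamel_map_def by (simp add: algebra_simps)
      also have "\<dots> \<le> norm (init.potential \<phi> z - init.potential \<phi> z0) + norm (duh.potential (src (\<delta> n) (W' n)) z - duh.potential (src (\<delta> n) (W' n)) z0)"
        by (rule norm_triangle_ineq)
      also have "norm (duh.potential (src (\<delta> n) (W' n)) z - duh.potential (src (\<delta> n) (W' n)) z0) \<le> K * B * duh.modulus z z0"
        using z d2(2)[of z] z0' W'(2,3)[of n] \<delta>[of n]
        by (intro duh.potential_diff_le src_le_\<rho>) (auto intro: src_measurable)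
      also have "K * B * duh.modulus z z0 < e / 2"
        using d2(3)[of z] z KB by (simp add: field_simps)
      also have "norm (init.potential \<phi> z - init.potential \<phi> z0) < e / 2"
        using d1(2)[of z] z by (simp add: dist_norm)
      finally show "norm (W n z - W n z0) < e" by simp
    qed (use d1 d2 in auto)
  qed
  obtain k g where k: "strict_mono (k :: nat \<Rightarrow> nat)"
    and g: "\<And>z X. z \<in> ?U \<Longrightarrow> X \<longlonglongrightarrow> z \<Longrightarrow> (\<lambda>n. W (k n) (X n)) \<longlonglongrightarrow> g z"
    using equicontinuous_pointwise_subsequence[of ?U W, OF bd eq] by blast
  \<comment> \<open>Convergence is known at positive times only; zero elsewhere makes the limit
    measurable on the whole space.\<close>
  define G where "G z = (if snd z > 0 then g z else 0)" for z
  have kn: "n \<le> k n" for n by (rule seq_suble[OF k])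
  have \<delta>k: "(\<lambda>n. \<delta> (k n)) \<longlonglongrightarrow> 0"
    using LIMSEQ_subseq_LIMSEQ[OF \<delta>0 k] by (simp add: o_def)
  have Wg: "(\<lambda>n. W (k n) z) \<longlonglongrightarrow> G z" if "snd z > 0" for z
    using g[of z "\<lambda>_. z"] that by (simp add: G_def)
  have Gm: "G \<in> borel_measurable borel"
  proof (rule borel_measurable_LIMSEQ_metric)
    show "(\<lambda>z. if snd z > 0 then W (k n) z else 0) \<in> borel_measurable borel" for n
      using Wm[of "k n"] by measurable
    show "(\<lambda>n. if snd z > 0 then W (k n) z else 0) \<longlonglongrightarrow> G z" for z
      using Wg[of z] by (cases "snd z > 0") (auto simp: G_def)
  qed
  have Gd: "dominated G"
    unfolding dominated_def
  proof (intro allI impI conjI)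
    fix x :: 'a and t :: real assume t: "t > 0"
    then have l: "(\<lambda>n. W (k n) (x, t)) \<longlonglongrightarrow> G (x, t)" using Wg by simp
    have "(\<lambda>n. \<bar>fst (W (k n) (x, t))\<bar>) \<longlonglongrightarrow> \<bar>fst (G (x, t))\<bar>" by (intro tendsto_intros l)
    then show "\<bar>fst (G (x, t))\<bar> \<le> \<beta> t * H (x, t)"
      by (rule LIMSEQ_le_const2) (use Wd t in \<open>auto simp: dominated_def\<close>)
    have "(\<lambda>n. norm (snd (W (k n) (x, t)))) \<longlonglongrightarrow> norm (snd (G (x, t)))" by (intro tendsto_intros l)
    then show "norm (snd (G (x, t))) \<le> t powr (- (1/2)) * (\<beta> t * H (x, t))"
      by (rule LIMSEQ_le_const2) (use Wd t in \<open>auto simp: dominated_def\<close>)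
  qed
  have lim_src: "(\<lambda>n. src (\<delta> (k n)) (W (k n)) b) \<longlonglongrightarrow> src 0 G b" for b
  proof (cases "snd b > 0")
    case True
    obtain y s where b: "b = (y, s)" and s: "s > 0" using True by (cases b) auto
    \<comment> \<open>Here convergence along moving points is used: the arguments of f are taken at
      the delayed time, which depends on n.\<close>
    have "(\<lambda>n. (y, s - \<delta> (k n))) \<longlonglongrightarrow> (y, s - 0)" by (intro tendsto_intros \<delta>k)
    then have "(\<lambda>n. W (k n) (y, s - \<delta> (k n))) \<longlonglongrightarrow> g (y, s)"
      using s by (intro g) auto
    then have l: "(\<lambda>n. W (k n) (y, s - \<delta> (k n))) \<longlonglongrightarrow> G (y, s)"
      using s by (simp add: G_def)
    have "(\<lambda>n. case (y, s, fst (W (k n) (y, s - \<delta> (k n))), snd (W (k n) (y, s - \<delta> (k n)))) of (x, t, p, q) \<Rightarrow> f x t p q)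
      \<longlonglongrightarrow> (case (y, s, fst (G (y, s)), snd (G (y, s))) of (x, t, p, q) \<Rightarrow> f x t p q)"
      using s by (intro continuous_on_tendsto_compose[OF f_cont] tendsto_intros l) auto
    then have l2: "(\<lambda>n. f y s (fst (W (k n) (y, s - \<delta> (k n)))) (snd (W (k n) (y, s - \<delta> (k n))))) \<longlonglongrightarrow> src 0 G b"
      using s by (simp add: src_def b case_prod_beta)
    \<comment> \<open>From here on the cutoff in \<open>src\<close> does not act at time s.\<close>
    have "eventually (\<lambda>n. \<delta> (k n) < s / 2) sequentially"
      using order_tendstoD(2)[OF \<delta>k, of "s / 2"] s by simp
    then have "eventually (\<lambda>n. f y s (fst (W (k n) (y, s - \<delta> (k n)))) (snd (W (k n) (y, s - \<delta> (k n)))) = src (\<delta> (k n)) (W (k n)) b) sequentially"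
      by eventually_elim (simp add: src_def b)
    with l2 show ?thesis by (rule Lim_transform_eventually)
  next
    case False
    then have "src (\<delta> (k n)) (W (k n)) b = 0" for n using \<delta>[of "k n"] by (simp add: src_def)
    then show ?thesis using False by (simp add: src_def)
  qed
  show ?thesis
  proof (rule that[OF Gm Gd])
    fix x :: 'a and t :: real assume t: "t > 0"
    have "(\<lambda>n. duh.potential (src (\<delta> (k n)) (W (k n))) (x, t)) \<longlonglongrightarrow> duh.potential (src 0 G) (x, t)"
      unfolding duh.potential_def
    proof (rule integral_dominated_convergence)
      \<comment> \<open>At a fixed evaluation point ordinary domination is enough, with the common
        majorant K B \<rho> of all the sources.\<close>
      show "integrable lborel (\<lambda>b. norm ((K * B * \<rho> b) *\<^sub>R heat_jet ((x, t) - b)))"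
        using t K_pos B_pos \<rho>_ge_0
        by (intro integrable_norm duh.jet_integrable[where L = "K * B"]) auto
      have [measurable]: "src (\<delta> (k n)) (W (k n)) \<in> borel_measurable borel" for n
        using Wm \<delta>[of "k n"] by (intro src_measurable) auto
      have [measurable]: "src 0 G \<in> borel_measurable borel"
        using Gm by (intro src_measurable) auto
      show "(\<lambda>b. src 0 G b *\<^sub>R heat_jet ((x, t) - b)) \<in> borel_measurable lborel" by measurable
      show "(\<lambda>b. src (\<delta> (k n)) (W (k n)) b *\<^sub>R heat_jet ((x, t) - b)) \<in> borel_measurable lborel" for n by measurable
      show "AE b in lborel. (\<lambda>n. src (\<delta> (k n)) (W (k n)) b *\<^sub>R heat_jet ((x, t) - b)) \<longlonglongrightarrow> src 0 G b *\<^sub>R heat_jet ((x, t) - b)"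
        by (intro AE_I2 tendsto_intros lim_src)
      show "AE b in lborel. norm (src (\<delta> (k n)) (W (k n)) b *\<^sub>R heat_jet ((x, t) - b)) \<le> norm ((K * B * \<rho> b) *\<^sub>R heat_jet ((x, t) - b))" for n
      proof (rule AE_I2)
        fix b
        have "\<bar>src (\<delta> (k n)) (W (k n)) b\<bar> \<le> \<bar>K * B * \<rho> b\<bar>"
          using src_le_\<rho>[OF Wd[of "k n"], of "\<delta> (k n)" b] \<delta>[of "k n"] by (auto intro: order_trans)
        then show "norm (src (\<delta> (k n)) (W (k n)) b *\<^sub>R heat_jet ((x, t) - b)) \<le> norm ((K * B * \<rho> b) *\<^sub>R heat_jet ((x, t) - b))"
          unfolding norm_scaleR by (intro mult_right_mono) auto
      qed
    qed
    then have lim: "(\<lambda>n. duhamel_map (\<delta> (k n)) (W (k n)) (x, t)) \<longlonglongrightarrow> init.potential \<phi> (x, t) + duh.potential (src 0 G) (x, t)"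
      unfolding duhamel_map_def by (intro tendsto_intros)
    obtain n0 :: nat where n0: "t \<le> real n0" using real_arch_simple by blast
    \<comment> \<open>As soon as n + 1 exceeds t, the approximation solves its delayed equation at
      time t, so both sides of the equation converge.\<close>
    have "eventually (\<lambda>n. duhamel_map (\<delta> (k n)) (W (k n)) (x, t) = W (k n) (x, t)) sequentially"
      using eventually_ge_at_top[of n0]
    proof eventually_elim
      case (elim n)
      then have "real n0 \<le> real (Suc (k n))" using kn[of n] by simp
      then show ?case using n0 by (intro Wf) linarith
    qed
    with lim have "(\<lambda>n. W (k n) (x, t)) \<longlonglongrightarrow> init.potential \<phi> (x, t) + duh.potential (src 0 G) (x, t)"
      by (rule Lim_transform_eventually)
    moreover have "(\<lambda>n. W (k n) (x, t)) \<longlonglongrightarrow> G (x, t)" using Wg t by simp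
    ultimately show "G (x, t) = init.potential \<phi> (x, t) + duh.potential (src 0 G) (x, t)"
      by (metis LIMSEQ_unique)
  qed
qed

end

subsection \<open>Comparison of shifted heat kernels for large times\<close>

text \<open>The factor sqrt t is the parabolic weight of a derivative: with it both components scale
  by the same power of t.\<close>

definition jet_norm :: "real \<Rightarrow> real \<times> 'a::euclidean_space \<Rightarrow> real" where
  "jet_norm t p = \<bar>fst p\<bar> + sqrt t * norm (snd p)"

lemma jet_norm_nonneg: "0 \<le> t \<Longrightarrow> 0 \<le> jet_norm t p"
  by (simp add: jet_norm_def)

lemma jet_norm_triangle: "0 \<le> t \<Longrightarrow> jet_norm t (p + q) \<le> jet_norm t p + jet_norm t q"
proof -
  assume t: "0 \<le> t"
  have "sqrt t * norm (snd p + snd q) \<le> sqrt t * (norm (snd p) + norm (snd q))"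
    using t by (intro mult_left_mono norm_triangle_ineq) auto
  then show ?thesis
    unfolding jet_norm_def by (simp add: distrib_left)
qed

lemma jet_norm_minus: "jet_norm t (- p) = jet_norm t p"
  by (simp add: jet_norm_def)

lemma jet_norm_diff: "0 \<le> t \<Longrightarrow> jet_norm t (p - q) \<le> jet_norm t p + jet_norm t q"
  using jet_norm_triangle[of t p "- q"] by (simp add: jet_norm_minus)

lemma jet_norm_scaleR: "jet_norm t (c *\<^sub>R p) = \<bar>c\<bar> * jet_norm t p"
  by (simp add: jet_norm_def abs_mult distrib_left)

lemma jet_norm_measurable[measurable]: "jet_norm t \<in> borel_measurable borel"
  unfolding jet_norm_def by measurable

lemma jet_norm_heat_jet_le:
  fixes z :: "'a::euclidean_space \<times> real"
  assumes "0 < snd z" and that: "0 \<le> t"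
  shows "jet_norm t (heat_jet z) \<le> 2 powr (real DIM('a) / 2) * (1 + sqrt t * snd z powr (- (1/2))) * heat_kernel (fst z) (2 * snd z)"
proof -
  have "sqrt t * norm (snd (heat_jet z)) \<le> sqrt t * (2 powr (real DIM('a) / 2) * (snd z powr (- (1/2)) * heat_kernel (fst z) (2 * snd z)))"
    using norm_snd_heat_jet_le[of z] assms that by (intro mult_left_mono) (auto simp: heat_dom_def)
  then show ?thesis
    using norm_fst_heat_jet_le[OF assms(1)] by (simp add: jet_norm_def algebra_simps)
qed

lemma heat_kernel_scale:
  fixes y :: "'a::euclidean_space"
  assumes t: "t > 0"
  shows "heat_kernel (sqrt t *\<^sub>R y) (t * \<tau>) = t powr (- real DIM('a) / 2) * heat_kernel y \<tau>"
proof -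
  have "(norm (sqrt t *\<^sub>R y))\<^sup>2 = t * (norm y)\<^sup>2"
    using t by (simp add: power_mult_distrib)
  then have "- (norm (sqrt t *\<^sub>R y))\<^sup>2 / (4 * (t * \<tau>)) = - (norm y)\<^sup>2 / (4 * \<tau>)"
    using t by simp
  moreover have "(4 * pi * (t * \<tau>)) powr r = t powr r * (4 * pi * \<tau>) powr r" for r
    by (simp add: powr_mult mult_ac)
  ultimately show ?thesis
    unfolding heat_kernel_def by (simp add: mult.assoc)
qed

lemma heat_jet_scale:
  fixes y :: "'a::euclidean_space"
  assumes t: "t > 0"
  shows "heat_jet (sqrt t *\<^sub>R y, t * \<tau>) = t powr (- real DIM('a) / 2) *\<^sub>R
    (fst (heat_jet (y, \<tau>)), (1 / sqrt t) *\<^sub>R snd (heat_jet (y, \<tau>)))"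
proof (cases "\<tau> > 0")
  case True
  define P where "P = t powr (- real DIM('a) / 2)"
  define h where "h = heat_kernel y \<tau>"
  have hk: "heat_kernel (sqrt t *\<^sub>R y) (t * \<tau>) = P * h"
    unfolding P_def h_def by (rule heat_kernel_scale[OF t])
  have "- (P * h / (2 * (r * r * \<tau>))) * r = P * ((1 / r) * - (h / (2 * \<tau>)))" if "r > 0" for r
    using that True by (simp add: field_simps)
  from this[of "sqrt t"] have sc: "- (P * h / (2 * (t * \<tau>))) * sqrt t = P * ((1 / sqrt t) * - (h / (2 * \<tau>)))"
    using t by simp
  have "0 < t * \<tau>" using t True by simp
  then have "heat_jet (sqrt t *\<^sub>R y, t * \<tau>) = (P * h, (- (P * h / (2 * (t * \<tau>))) * sqrt t) *\<^sub>R y)"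
    unfolding heat_jet_def fst_conv snd_conv hk by simp
  also have "\<dots> = P *\<^sub>R (h, (1 / sqrt t) *\<^sub>R (- (h / (2 * \<tau>)) *\<^sub>R y))"
    unfolding sc by simp
  also have "\<dots> = P *\<^sub>R (fst (heat_jet (y, \<tau>)), (1 / sqrt t) *\<^sub>R snd (heat_jet (y, \<tau>)))"
    using True by (simp add: heat_jet_def h_def)
  finally show ?thesis by (simp only: P_def)
qed (use t in \<open>auto simp: heat_jet_def zero_less_mult_iff zero_prod_def\<close>)

text \<open>Self-similarity of the kernel: comparison of jets at times of order t reduces to times
  of order 1.\<close>

lemma jet_norm_scale:
  fixes y y' :: "'a::euclidean_space"
  assumes t: "t > 0"
  shows "jet_norm t (heat_jet (sqrt t *\<^sub>R y, t * \<tau>) - heat_jet (sqrt t *\<^sub>R y', t * \<sigma>))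
    = t powr (- real DIM('a) / 2) * jet_norm 1 (heat_jet (y, \<tau>) - heat_jet (y', \<sigma>))"
proof -
  have e: "heat_jet (sqrt t *\<^sub>R y, t * \<tau>) - heat_jet (sqrt t *\<^sub>R y', t * \<sigma>)
    = t powr (- real DIM('a) / 2) *\<^sub>R (fst (heat_jet (y, \<tau>) - heat_jet (y', \<sigma>)),
       (1 / sqrt t) *\<^sub>R snd (heat_jet (y, \<tau>) - heat_jet (y', \<sigma>)))"
    unfolding heat_jet_scale[OF t] by (simp add: scaleR_diff_right right_diff_distrib)
  have s: "jet_norm t (fst p, (1 / sqrt t) *\<^sub>R snd p) = jet_norm 1 p" for p :: "real \<times> 'a"
    using t by (simp add: jet_norm_def)
  show ?thesis
    unfolding e jet_norm_scaleR s by simp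
qed

text \<open>The rate 1/16 is the point: it is twice the rate 1/32 of \<open>heat_kernel y 8\<close>,
  so a Gaussian factor remains to make distant contributions small.\<close>

lemma jet_norm_unit_decay:
  fixes y a :: "'a::euclidean_space"
  assumes a: "norm a \<le> 1/2" and \<tau>: "1/2 \<le> \<tau>" "\<tau> \<le> 3/2"
  shows "jet_norm 1 (heat_jet (y - a, \<tau>)) \<le> 9 * 2 powr (real DIM('a) / 2) * exp (- (norm y)\<^sup>2 / 16)"
proof -
  have n: "(norm y)\<^sup>2 * (3/4) - 3 / 4 \<le> (norm (y - a))\<^sup>2"
  proof -
    have "norm y \<le> norm (y - a) + 1/2"
      using a norm_triangle_ineq[of "y - a" a] by simp
    then have "(norm y)\<^sup>2 \<le> (norm (y - a) + 1/2)\<^sup>2"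
      by (intro power_mono) auto
    \<comment> \<open>This square bounds the cross term of (|y - a| + 1/2)^2; the factor 3/4 it
      costs turns the rate 1/12 at doubled time 3 into 1/16.\<close>
    moreover have "0 \<le> (norm (y - a) / 3 - 1/2)\<^sup>2 * 3" by simp
    ultimately show ?thesis by (simp add: power2_eq_square algebra_simps)
  qed
  have "(norm (y - a))\<^sup>2 / 12 \<le> (norm (y - a))\<^sup>2 / (4 * (2 * \<tau>))"
    using \<tau> by (intro divide_left_mono) auto
  then have "- (norm (y - a))\<^sup>2 / (4 * (2 * \<tau>)) \<le> - (norm (y - a))\<^sup>2 / 12"
    by simp
  also have "\<dots> \<le> 1 - (norm y)\<^sup>2 / 16" using n by simp
  finally have e: "exp (- (norm (y - a))\<^sup>2 / (4 * (2 * \<tau>))) \<le> exp (1 - (norm y)\<^sup>2 / 16)"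
    by simp
  have "(4 * pi * (2 * \<tau>)) powr (- real DIM('a) / 2) \<le> 1"
  proof (rule powr_nonpos_le_one)
    have "1 \<le> pi * 1" using pi_ge_two by simp
    also have "\<dots> \<le> pi * (4 * (2 * \<tau>))" using \<tau> by (intro mult_left_mono) auto
    finally show "1 \<le> 4 * pi * (2 * \<tau>)" by (simp add: mult_ac)
  qed simp
  then have h: "heat_kernel (y - a) (2 * \<tau>) \<le> 1 * exp (1 - (norm y)\<^sup>2 / 16)"
    unfolding heat_kernel_def by (rule mult_mono[OF _ e]) auto
  have "exp (1 - (norm y)\<^sup>2 / 16) = exp 1 * exp (- (norm y)\<^sup>2 / 16)"
    using exp_add[of 1 "- (norm y)\<^sup>2 / 16"] by simp
  also have "\<dots> \<le> 3 * exp (- (norm y)\<^sup>2 / 16)"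
    by (intro mult_right_mono exp_le) auto
  finally have h': "heat_kernel (y - a) (2 * \<tau>) \<le> 3 * exp (- (norm y)\<^sup>2 / 16)"
    using h by linarith
  have p: "\<tau> powr (- (1/2)) \<le> 2"
  proof -
    have "sqrt (1/4) \<le> sqrt \<tau>" using \<tau> by simp
    then have "1/2 \<le> sqrt \<tau>" by (simp add: real_sqrt_divide)
    then show ?thesis using \<tau> by (simp add: powr_minus_half field_simps)
  qed
  have "jet_norm 1 (heat_jet (y - a, \<tau>)) \<le> 2 powr (real DIM('a) / 2) * (1 + 1 * \<tau> powr (- (1/2))) * heat_kernel (y - a) (2 * \<tau>)"
    using jet_norm_heat_jet_le[of "(y - a, \<tau>)" 1] \<tau>(1) by simp
  also have "\<dots> \<le> 2 powr (real DIM('a) / 2) * 3 * (3 * exp (- (norm y)\<^sup>2 / 16))"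
    using p h' by (intro mult_mono mult_left_mono) (auto simp: heat_kernel_nonneg)
  finally show ?thesis by simp
qed

text \<open>Inside a large ball the jet is uniformly continuous; outside, both jets decay faster
  than the comparison kernel. Comparing with a kernel rather than with a number gives the supremum
  and the L^1 bound simultaneously.\<close>

lemma jet_norm_shift_unit:
  assumes e: "e > 0"
  obtains d where "0 < d" "d \<le> 1/2"
    "\<And>(y::'a::euclidean_space) a \<tau> \<sigma>. norm a < d \<Longrightarrow> \<bar>\<tau> - 1\<bar> < d \<Longrightarrow> \<bar>\<sigma> - 1\<bar> < d \<Longrightarrow>
      jet_norm 1 (heat_jet (y - a, \<tau>) - heat_jet (y, \<sigma>)) \<le> e * heat_kernel y 8"
proof -
  define c where "c = 9 * 2 powr (real DIM('a) / 2)"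
  define k where "k = e * (4 * pi * 8) powr (- real DIM('a) / 2)"
  have c: "0 < c" and k: "0 < k" using e by (auto simp: c_def k_def)
  have hk: "e * heat_kernel (y::'a) 8 = k * exp (- (norm y)\<^sup>2 / 32)" for y
    by (simp add: heat_kernel_def k_def)
  have "((\<lambda>R::real. 2 * c * exp (- R\<^sup>2 / 32)) \<longlongrightarrow> 0) at_top"
    by real_asymp
  \<comment> \<open>Beyond radius R the sum of both jets is at most 2 c exp (- |y|^2 / 16); half of
    this exponent pays for the target, and the other half brings 2 c below k.\<close>
  then have "eventually (\<lambda>R. 2 * c * exp (- R\<^sup>2 / 32) < k \<and> 0 < R) at_top"
    using k by (intro eventually_conj order_tendstoD(2) eventually_gt_at_top) auto
  then obtain R where R: "2 * c * exp (- R\<^sup>2 / 32) < k" "0 < R"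
    by (auto simp: eventually_at_top_linorder)
  \<comment> \<open>Half of the smallest value of the target on the ball of radius R; the half
    compensates that \<open>jet_norm\<close> at t = 1 may be twice the norm of the pair.\<close>
  define e' where "e' = k * exp (- R\<^sup>2 / 32) / 2"
  have e': "0 < e'" using k by (simp add: e'_def)
  \<comment> \<open>The radius R + 1 leaves room for the shift by a, and the times stay away from 0,
    where the jet is singular.\<close>
  have "uniformly_continuous_on (cball (0::'a) (R + 1) \<times> {1/2..3/2}) heat_jet"
  proof (rule compact_uniformly_continuous)
    show "continuous_on (cball (0::'a) (R + 1) \<times> {1/2..3/2}) heat_jet"
      by (intro continuous_at_imp_continuous_on ballI isCont_heat_jet) auto
    show "compact (cball (0::'a) (R + 1) \<times> {1/2..3/2::real})"
      by (intro compact_Times) auto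
  qed
  then obtain d0 where d0: "0 < d0"
    "\<And>z z'. z \<in> cball (0::'a) (R + 1) \<times> {1/2..3/2} \<Longrightarrow> z' \<in> cball (0::'a) (R + 1) \<times> {1/2..3/2} \<Longrightarrow> dist z' z < d0 \<Longrightarrow> dist (heat_jet z') (heat_jet z) < e'"
    unfolding uniformly_continuous_on_def using e' by metis
  show ?thesis
  proof (rule that[of "min (1/2) (d0 / 3)"])
    show "0 < min (1/2) (d0 / 3)" "min (1/2) (d0 / 3) \<le> 1/2" using d0(1) by auto
    fix y a :: 'a and \<tau> \<sigma> :: real
    assume as: "norm a < min (1/2) (d0 / 3)" "\<bar>\<tau> - 1\<bar> < min (1/2) (d0 / 3)" "\<bar>\<sigma> - 1\<bar> < min (1/2) (d0 / 3)"
    then have h: "norm a < 1/2" "\<bar>\<tau> - 1\<bar> < 1/2" "\<bar>\<sigma> - 1\<bar> < 1/2"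
      and d3: "norm a < d0 / 3" "\<bar>\<tau> - 1\<bar> < d0 / 3" "\<bar>\<sigma> - 1\<bar> < d0 / 3"
      by simp_all
    have a: "norm a \<le> 1/2" and \<tau>: "1/2 \<le> \<tau>" "\<tau> \<le> 3/2" and \<sigma>: "1/2 \<le> \<sigma>" "\<sigma> \<le> 3/2"
      using h by linarith+
    show "jet_norm 1 (heat_jet (y - a, \<tau>) - heat_jet (y, \<sigma>)) \<le> e * heat_kernel y 8"
    proof (cases "norm y \<le> R")
      case True
      have m: "(y - a, \<tau>) \<in> cball 0 (R + 1) \<times> {1/2..3/2}" "(y, \<sigma>) \<in> cball 0 (R + 1) \<times> {1/2..3/2}"
        using True a \<tau> \<sigma> norm_triangle_ineq4[of y a] by auto
      have "dist (y - a, \<tau>) (y, \<sigma>) \<le> dist (y - a) y + dist \<tau> \<sigma>"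
        by (simp add: dist_Pair_Pair sqrt_sum_squares_le_sum)
      also have "\<dots> = norm a + \<bar>\<tau> - \<sigma>\<bar>" by (simp add: dist_norm)
      also have "\<dots> < d0" using d3 by linarith
      finally have "dist (heat_jet (y - a, \<tau>)) (heat_jet (y, \<sigma>)) < e'"
        by (rule d0(2)[OF m(2,1)])
      then have n: "norm (heat_jet (y - a, \<tau>) - heat_jet (y, \<sigma>)) < e'" by (simp add: dist_norm)
      have j2: "jet_norm 1 p \<le> 2 * norm p" for p :: "real \<times> 'a"
        using norm_fst_le[of "fst p" "snd p"] norm_snd_le[of "snd p" "fst p"] by (simp add: jet_norm_def)
      have "jet_norm 1 (heat_jet (y - a, \<tau>) - heat_jet (y, \<sigma>)) \<le> 2 * e'"
        using j2[of "heat_jet (y - a, \<tau>) - heat_jet (y, \<sigma>)"] n by linarith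
      also have "\<dots> = k * exp (- R\<^sup>2 / 32)" by (simp add: e'_def)
      also have "\<dots> \<le> k * exp (- (norm y)\<^sup>2 / 32)"
        using True k by (intro mult_left_mono) (auto intro: power_mono)
      finally show ?thesis by (simp only: hk)
    next
      case False
      have "jet_norm 1 (heat_jet (y - a, \<tau>) - heat_jet (y, \<sigma>)) \<le> jet_norm 1 (heat_jet (y - a, \<tau>)) + jet_norm 1 (heat_jet (y - 0, \<sigma>))"
        using jet_norm_diff[of 1 "heat_jet (y - a, \<tau>)" "heat_jet (y, \<sigma>)"] by simp
      also have "\<dots> \<le> c * exp (- (norm y)\<^sup>2 / 16) + c * exp (- (norm y)\<^sup>2 / 16)"
        unfolding c_def using a \<tau> \<sigma> by (intro add_mono jet_norm_unit_decay) auto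
      also have "\<dots> = 2 * c * exp (- (norm y)\<^sup>2 / 32) * exp (- (norm y)\<^sup>2 / 32)"
        by (simp add: mult.assoc exp_add[symmetric])
      also have "\<dots> \<le> k * exp (- (norm y)\<^sup>2 / 32)"
      proof (rule mult_right_mono)
        have "R\<^sup>2 \<le> (norm y)\<^sup>2" using False R(2) by (intro power_mono) auto
        then have "2 * c * exp (- (norm y)\<^sup>2 / 32) \<le> 2 * c * exp (- R\<^sup>2 / 32)"
          using c by (intro mult_left_mono) auto
        then show "2 * c * exp (- (norm y)\<^sup>2 / 32) \<le> k" using R(1) by linarith
      qed simp
      finally show ?thesis by (simp only: hk)
    qed
  qed
qed

text \<open>The three smallness conditions say that \<xi> / sqrt t is near 0 and that (t - s) / t
  and (1 + t) / t are near 1; the last one accounts for the unit time shift in g.\<close>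

lemma jet_norm_shift:
  assumes e: "e > 0"
  obtains d where "0 < d" "d \<le> 1/2"
    "\<And>(x::'a::euclidean_space) \<xi> s t. t > 0 \<Longrightarrow> norm \<xi> < d * sqrt t \<Longrightarrow> \<bar>s\<bar> < d * t \<Longrightarrow> 1 < d * t \<Longrightarrow>
      jet_norm t (heat_jet (x - \<xi>, t - s) - heat_jet (x, 1 + t)) \<le> e * heat_kernel x (8 * t)"
proof -
  obtain d where d: "0 < d" "d \<le> 1/2"
    "\<And>(y::'a) a \<tau> \<sigma>. norm a < d \<Longrightarrow> \<bar>\<tau> - 1\<bar> < d \<Longrightarrow> \<bar>\<sigma> - 1\<bar> < d \<Longrightarrow>
      jet_norm 1 (heat_jet (y - a, \<tau>) - heat_jet (y, \<sigma>)) \<le> e * heat_kernel y 8"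
    using jet_norm_shift_unit[OF e, where 'a = 'a] by blast
  show ?thesis
  proof (rule that[OF d(1,2)])
    fix x \<xi> :: 'a and s t :: real
    assume t: "t > 0" and as: "norm \<xi> < d * sqrt t" "\<bar>s\<bar> < d * t" "1 < d * t"
    define y where "y = x /\<^sub>R sqrt t"
    define a where "a = \<xi> /\<^sub>R sqrt t"
    define \<tau> where "\<tau> = (t - s) / t"
    define \<sigma> where "\<sigma> = (1 + t) / t"
    have x: "x = sqrt t *\<^sub>R y" and xi: "x - \<xi> = sqrt t *\<^sub>R (y - a)" and ts: "t - s = t * \<tau>" "1 + t = t * \<sigma>"
      using t by (auto simp: y_def a_def \<tau>_def \<sigma>_def scaleR_diff_right)
    have "norm a < d" using as(1) t by (simp add: a_def field_simps)
    moreover have "\<bar>\<tau> - 1\<bar> < d"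
    proof -
      have "\<tau> - 1 = - s / t" using t by (simp add: \<tau>_def diff_divide_distrib)
      then have "\<bar>\<tau> - 1\<bar> = \<bar>s\<bar> / t" using t by (simp add: abs_divide)
      then show ?thesis using as(2) t by (simp only: pos_divide_less_eq)
    qed
    moreover have "\<bar>\<sigma> - 1\<bar> < d"
    proof -
      have "\<sigma> - 1 = 1 / t" using t by (simp add: \<sigma>_def add_divide_distrib)
      then have "\<bar>\<sigma> - 1\<bar> = 1 / t" using t by simp
      then show ?thesis using as(3) t by (simp only: pos_divide_less_eq)
    qed
    ultimately have "jet_norm 1 (heat_jet (y - a, \<tau>) - heat_jet (y, \<sigma>)) \<le> e * heat_kernel y 8"
      by (rule d(3))
    then have "t powr (- real DIM('a) / 2) * jet_norm 1 (heat_jet (y - a, \<tau>) - heat_jet (y, \<sigma>)) \<le> t powr (- real DIM('a) / 2) * (e * heat_kernel y 8)"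
      by (intro mult_left_mono) auto
    then show "jet_norm t (heat_jet (x - \<xi>, t - s) - heat_jet (x, 1 + t)) \<le> e * heat_kernel x (8 * t)"
      unfolding xi ts jet_norm_scale[OF t, symmetric]
      using heat_kernel_scale[OF t, of y 8]
      by (simp add: x[symmetric] mult_ac)
  qed
qed

text \<open>The norms of the rescaled profiles in \<open>L\<^sup>\<infinity>\<close> and \<open>L\<^sup>1\<close> are controlled simultaneously;
  all other \<open>L\<^sup>q\<close> norms follow by interpolation.\<close>

definition controlled :: "real \<Rightarrow> ennreal \<Rightarrow> ('a::euclidean_space \<Rightarrow> ennreal) \<Rightarrow> bool" where
  "controlled t e h \<longleftrightarrow> h \<in> borel_measurable borel \<and> (\<forall>x. h x \<le> e * ennreal (t powr (- real DIM('a) / 2)))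
     \<and> (\<integral>\<^sup>+x. h x \<partial>lborel) \<le> e"

lemma controlled_add:
  assumes "controlled t e h" "controlled t e' h'"
  shows "controlled t (e + e') (\<lambda>x. h x + h' x)"
proof -
  have [measurable]: "h \<in> borel_measurable borel" "h' \<in> borel_measurable borel"
    using assms unfolding controlled_def by blast+
  have "(\<integral>\<^sup>+x. h x + h' x \<partial>lborel) = (\<integral>\<^sup>+x. h x \<partial>lborel) + (\<integral>\<^sup>+x. h' x \<partial>lborel)"
    by (rule nn_integral_add) auto
  then show ?thesis
    using assms unfolding controlled_def distrib_right by (simp add: add_mono)
qed

lemma controlled_cmult:
  assumes "controlled t e h"
  shows "controlled t (c * e) (\<lambda>x. c * h x)"
proof -
  have [measurable]: "h \<in> borel_measurable borel"
    using assms unfolding controlled_def by blast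
  have "(\<integral>\<^sup>+x. c * h x \<partial>lborel) = c * (\<integral>\<^sup>+x. h x \<partial>lborel)"
    by (rule nn_integral_cmult) auto
  then show ?thesis
    using assms unfolding controlled_def mult.assoc by (simp add: mult_left_mono)
qed

lemma controlled_mono:
  assumes "controlled t e h" "h' \<in> borel_measurable borel" "\<And>x. h' x \<le> h x" "e \<le> e'"
  shows "controlled t e' h'"
  unfolding controlled_def
proof (intro conjI allI)
  fix x
  have "h' x \<le> e * ennreal (t powr (- real DIM('a) / 2))"
    using assms(1,3) unfolding controlled_def by (blast intro: order_trans)
  also have "\<dots> \<le> e' * ennreal (t powr (- real DIM('a) / 2))"
    by (intro mult_right_mono assms) auto
  finally show "h' x \<le> e' * ennreal (t powr (- real DIM('a) / 2))" .
  have "(\<integral>\<^sup>+x. h' x \<partial>lborel) \<le> (\<integral>\<^sup>+x. h x \<partial>lborel)" by (intro nn_integral_mono assms)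
  also have "\<dots> \<le> e" using assms(1) unfolding controlled_def by blast
  finally show "(\<integral>\<^sup>+x. h' x \<partial>lborel) \<le> e'" using assms(4) by simp
qed fact

lemma controlled_heat_kernel:
  fixes m :: "'a::euclidean_space"
  assumes "0 < t" "t \<le> 4 * pi * r"
  shows "controlled t 1 (\<lambda>x. ennreal (heat_kernel (x - m) r))"
  unfolding controlled_def
proof (intro conjI allI)
  have r: "0 < r"
  proof (rule ccontr)
    assume "\<not> 0 < r"
    then have "4 * pi * r \<le> 0" by (intro mult_nonneg_nonpos) auto
    then show False using assms by linarith
  qed
  show "ennreal (heat_kernel (x - m) r) \<le> 1 * ennreal (t powr (- real DIM('a) / 2))" for x
    using heat_kernel_le[OF r, of "x - m"] powr_mono2'[of "- real DIM('a) / 2" t "4 * pi * r"] assms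
    by (auto intro!: ennreal_leI)
  show "(\<integral>\<^sup>+x. ennreal (heat_kernel (x - m) r) \<partial>lborel) \<le> 1"
    by (simp add: nn_integral_heat_kernel[OF r])
qed measurable

text \<open>Control passes to superpositions: the supremum bound pointwise under the integral, the
  L^1 bound by Tonelli. Sources of weight zero need no control, so weights can switch off times at
  which no estimate is at hand.\<close>

lemma controlled_nn_integral:
  fixes h :: "'b \<Rightarrow> 'a::euclidean_space \<Rightarrow> ennreal"
  assumes M: "sigma_finite_measure M" and w[measurable]: "w \<in> borel_measurable M" and e[measurable]: "e \<in> borel_measurable M"
    and h[measurable]: "(\<lambda>(x, b). h b x) \<in> borel_measurable (borel \<Otimes>\<^sub>M M)"
    and c: "\<And>b. b \<in> space M \<Longrightarrow> w b \<noteq> 0 \<Longrightarrow> controlled t (e b) (h b)"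
  shows "controlled t (\<integral>\<^sup>+b. w b * e b \<partial>M) (\<lambda>x. \<integral>\<^sup>+b. w b * h b x \<partial>M)"
proof -
  interpret S: sigma_finite_measure M by (rule M)
  interpret P: pair_sigma_finite "lborel :: 'a measure" M ..
  have wb: "w b * h b x \<le> (w b * e b) * ennreal (t powr (- real DIM('a) / 2))" if "b \<in> space M" for b x
    using c[OF that] unfolding controlled_def by (cases "w b = 0") (auto simp: mult.assoc intro!: mult_left_mono)
  have hb: "(\<integral>\<^sup>+x. w b * h b x \<partial>lborel) \<le> w b * e b" if "b \<in> space M" for b
    using c[OF that] unfolding controlled_def by (cases "w b = 0") (auto simp: nn_integral_cmult intro!: mult_left_mono)
  have wm: "(\<lambda>p. w (snd p) * h (snd p) (fst p)) \<in> borel_measurable (borel \<Otimes>\<^sub>M M)"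
    using h by (intro borel_measurable_times_ennreal measurable_compose[OF measurable_snd w]) (simp add: case_prod_beta')
  then have wm': "(\<lambda>p. w (snd p) * h (snd p) (fst p)) \<in> borel_measurable (lborel \<Otimes>\<^sub>M M)"
    by (simp add: measurable_cong_sets[OF sets_pair_measure_cong[OF sets_lborel refl] refl])
  show ?thesis
    unfolding controlled_def
  proof (intro conjI allI)
    show "(\<lambda>x. \<integral>\<^sup>+b. w b * h b x \<partial>M) \<in> borel_measurable borel"
      using S.borel_measurable_nn_integral[of "\<lambda>x b. w b * h b x" borel] wm by (simp add: case_prod_beta')
    fix x
    have "(\<integral>\<^sup>+b. w b * h b x \<partial>M) \<le> (\<integral>\<^sup>+b. (w b * e b) * ennreal (t powr (- real DIM('a) / 2)) \<partial>M)"
      by (intro nn_integral_mono wb)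
    also have "\<dots> = (\<integral>\<^sup>+b. w b * e b \<partial>M) * ennreal (t powr (- real DIM('a) / 2))"
      by (rule nn_integral_multc) measurable
    finally show "(\<integral>\<^sup>+b. w b * h b x \<partial>M) \<le> (\<integral>\<^sup>+b. w b * e b \<partial>M) * ennreal (t powr (- real DIM('a) / 2))" .
  next
    have "(\<integral>\<^sup>+x. (\<integral>\<^sup>+b. w b * h b x \<partial>M) \<partial>lborel) = (\<integral>\<^sup>+b. (\<integral>\<^sup>+x. w b * h b x \<partial>lborel) \<partial>M)"
      using P.Fubini[OF wm'] by simp
    also have "\<dots> \<le> (\<integral>\<^sup>+b. w b * e b \<partial>M)"
      by (intro nn_integral_mono hb)
    finally show "(\<integral>\<^sup>+x. (\<integral>\<^sup>+b. w b * h b x \<partial>M) \<partial>lborel) \<le> (\<integral>\<^sup>+b. w b * e b \<partial>M)" .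
  qed
qed

section \<open>Intermediate Lebesgue norms\<close>

lemma Lp_norm_nonneg:
  assumes "h \<in> borel_measurable (borel :: 'a::euclidean_space measure)"
  shows "0 \<le> Lp_norm q h"
proof (cases "q = \<infinity>")
  case True
  have "emeasure (lborel :: 'a measure) (space lborel) \<noteq> 0" by simp
  then have "esssup (lborel :: 'a measure) (\<lambda>x. 0 :: ereal) = 0" by (rule esssup_const)
  moreover have "esssup (lborel :: 'a measure) (\<lambda>x. 0 :: ereal) \<le> esssup lborel (\<lambda>x. ereal (norm (h x)))"
    using assms by (intro esssup_mono) auto
  ultimately show ?thesis using True by (simp add: Lp_norm_def)
qed (auto simp: Lp_norm_def Let_def)

text \<open>With S the supremum bound, |h|^r \<le> S^(r - 1) |h|; integrating and taking the r-th
  root gives the stated power of t.\<close>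

lemma Lp_norm_le_interpolation:
  fixes h :: "'a::euclidean_space \<Rightarrow> 'b::{second_countable_topology,real_normed_vector}"
  assumes h[measurable]: "h \<in> borel_measurable borel" and t: "0 < t" and e: "0 \<le> e" and q: "1 \<le> q"
    and bd: "\<And>x. norm (h x) \<le> e * t powr (- real DIM('a) / 2)" and int: "(\<integral>\<^sup>+x. ennreal (norm (h x)) \<partial>lborel) \<le> ennreal e"
  shows "Lp_norm q h \<le> ereal (e * t powr (- (real DIM('a) / 2 * (1 - inv_exp q))))"
proof (cases "q = \<infinity>")
  case True
  have "esssup lborel (\<lambda>x. ereal (norm (h x))) \<le> ereal (e * t powr (- real DIM('a) / 2))"
    using bd by (intro esssup_I AE_I2) auto
  then show ?thesis using True by (simp add: Lp_norm_def inv_exp_def)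
next
  case False
  then obtain r where r: "q = ereal r" "1 \<le> r" using q by (cases q) auto
  define S where "S = e * t powr (- real DIM('a) / 2)"
  let ?I = "\<integral>\<^sup>+x. ennreal (norm (h x) powr r) \<partial>lborel"
  show ?thesis
  proof (cases "e = 0")
    case True
    then have "norm (h x) = 0" for x using bd[of x] by simp
    then have "?I = 0" using r by simp
    then show ?thesis using False True r by (simp add: Lp_norm_def)
  next
    case e0: False
    have S: "0 < S" using e0 e t by (simp add: S_def)
    have "?I \<le> (\<integral>\<^sup>+x. ennreal (S powr (r - 1)) * ennreal (norm (h x)) \<partial>lborel)"
    proof (rule nn_integral_mono)
      fix x
      have "norm (h x) powr r \<le> S powr (r - 1) * norm (h x)"
      proof (cases "h x = 0")
        case False
        have "norm (h x) powr r = norm (h x) powr (r - 1) * norm (h x) powr 1"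
          unfolding powr_add[symmetric] by simp
        also have "\<dots> \<le> S powr (r - 1) * norm (h x) powr 1"
          using bd[of x] r by (intro mult_right_mono powr_mono2) (auto simp: S_def)
        finally show ?thesis using False by simp
      qed simp
      then show "ennreal (norm (h x) powr r) \<le> ennreal (S powr (r - 1)) * ennreal (norm (h x))"
        by (subst ennreal_mult[symmetric]) (auto intro: ennreal_leI)
    qed
    also have "\<dots> = ennreal (S powr (r - 1)) * (\<integral>\<^sup>+x. ennreal (norm (h x)) \<partial>lborel)"
      by (rule nn_integral_cmult) measurable
    also have "\<dots> \<le> ennreal (S powr (r - 1)) * ennreal e"
      by (intro mult_left_mono int) auto
    also have "\<dots> = ennreal (S powr (r - 1) * e)"
      by (rule ennreal_mult[symmetric]) (use e in auto)
    finally have I: "?I \<le> ennreal (S powr (r - 1) * e)" .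
    then have "?I \<noteq> \<infinity>" by (auto simp: top_unique)
    then have L: "Lp_norm q h = ereal (enn2real ?I powr (1 / r))"
      using r by (simp add: Lp_norm_def Let_def)
    have "enn2real ?I \<le> S powr (r - 1) * e"
      using I e by (intro enn2real_leI) auto
    then have "enn2real ?I powr (1 / r) \<le> (S powr (r - 1) * e) powr (1 / r)"
      using r by (intro powr_mono2) auto
    also have "S powr (r - 1) * e = e powr r * t powr (- real DIM('a) / 2 * (r - 1))"
    proof -
      have "S powr (r - 1) = e powr (r - 1) * t powr (- real DIM('a) / 2 * (r - 1))"
        unfolding S_def powr_mult powr_powr ..
      moreover have "e powr (r - 1) * e = e powr r"
      proof -
        have "e powr (r - 1) * e powr 1 = e powr r" unfolding powr_add[symmetric] by simp
        then show ?thesis using e by simp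
      qed
      ultimately show ?thesis by (simp add: mult_ac)
    qed
    also have "\<dots> powr (1 / r) = e powr (r * (1 / r)) * t powr (- real DIM('a) / 2 * (r - 1) * (1 / r))"
      unfolding powr_mult powr_powr ..
    also have "r * (1 / r) = 1" using r by simp
    also have "- real DIM('a) / 2 * (r - 1) * (1 / r) = - (real DIM('a) / 2 * (1 - 1 / r))"
      using r by (simp add: field_simps)
    finally show ?thesis
      unfolding L using e r by (simp add: inv_exp_def)
  qed
qed

subsection \<open>Large time asymptotics\<close>

lemma controlled_weaken:
  assumes "controlled t e h" "e \<le> e'"
  shows "controlled t e' h"
  by (rule controlled_mono[OF assms(1) _ order_refl assms(2)]) (use assms(1) in \<open>auto simp: controlled_def\<close>)

lemma jet_norm_integral_le:
  fixes g :: "'b \<Rightarrow> real \<times> 'a::euclidean_space"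
  assumes [measurable]: "g \<in> borel_measurable M" and t: "0 \<le> t"
  shows "ennreal (jet_norm t (\<integral>b. g b \<partial>M)) \<le> (\<integral>\<^sup>+b. ennreal (jet_norm t (g b)) \<partial>M)"
proof -
  have m: "(\<lambda>b. fst (g b)) \<in> borel_measurable M" "(\<lambda>b. snd (g b)) \<in> borel_measurable M"
    by (intro measurable_compose[OF assms(1) borel_measurable_fst_borel] measurable_compose[OF assms(1) borel_measurable_snd_borel])+
  have "ennreal (jet_norm t (\<integral>b. g b \<partial>M)) = ennreal (norm (fst (\<integral>b. g b \<partial>M))) + ennreal (sqrt t) * ennreal (norm (snd (\<integral>b. g b \<partial>M)))"
    using t by (simp add: jet_norm_def ennreal_mult)
  also have "\<dots> \<le> (\<integral>\<^sup>+b. ennreal (norm (fst (g b))) \<partial>M) + ennreal (sqrt t) * (\<integral>\<^sup>+b. ennreal (norm (snd (g b))) \<partial>M)"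
    by (intro add_mono mult_left_mono norm_bounded_linear_integral_le bounded_linear_fst bounded_linear_snd) auto
  also have "\<dots> = (\<integral>\<^sup>+b. ennreal (norm (fst (g b))) + ennreal (sqrt t) * ennreal (norm (snd (g b))) \<partial>M)"
    using m by (subst nn_integral_add) (auto simp: nn_integral_cmult)
  also have "\<dots> = (\<integral>\<^sup>+b. ennreal (jet_norm t (g b)) \<partial>M)"
    using t by (intro nn_integral_cong) (simp add: jet_norm_def ennreal_mult)
  finally show ?thesis .
qed

lemma jet_norm_heat_jet_late:
  fixes x :: "'a::euclidean_space"
  assumes t: "t > 0"
  shows "jet_norm t (heat_jet (x, 1 + t)) \<le> 2 * 2 powr (real DIM('a) / 2) * heat_kernel x (2 * (1 + t))"
proof -
  let ?c = "2 powr (real DIM('a) / 2) :: real"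
  have r2: "sqrt t * (1 + t) powr (- (1/2)) \<le> 1"
    using t by (simp add: powr_minus_half)
  have "jet_norm t (heat_jet (x, 1 + t)) \<le> ?c * (1 + sqrt t * (1 + t) powr (- (1/2))) * heat_kernel x (2 * (1 + t))"
    using jet_norm_heat_jet_le[of "(x, 1 + t)" t] t by simp
  also have "\<dots> \<le> 2 * ?c * heat_kernel x (2 * (1 + t))"
  proof (rule mult_right_mono[OF _ heat_kernel_nonneg])
    have "?c * (1 + sqrt t * (1 + t) powr (- (1/2))) \<le> ?c * 2" using r2 by (intro mult_left_mono) auto
    then show "?c * (1 + sqrt t * (1 + t) powr (- (1/2))) \<le> 2 * ?c" by simp
  qed
  finally show ?thesis .
qed

lemma controlled_late_kernel:
  assumes t: "t > 0"
  shows "controlled t 1 (\<lambda>x::'a::euclidean_space. ennreal (heat_kernel x (2 * (1 + t))))"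
proof -
  have "t \<le> 1 * (2 * (1 + t))" using t by simp
  also have "\<dots> \<le> 4 * pi * (2 * (1 + t))"
    using pi_ge_two t by (intro mult_right_mono) auto
  finally show ?thesis
    using controlled_heat_kernel[OF t, of "2 * (1 + t)" "0::'a"] by simp
qed

text \<open>A crude bound for every source in the first half of (0, t), wherever it lies in space.
  The elapsed time is at least t / 2, so the factor 1 + sqrt t (t - s)^(-1/2) is at most 3; the
  kernel at time 1 + t adds 2.\<close>

lemma controlled_jet_difference:
  fixes \<xi> :: "'a::euclidean_space"
  assumes t: "1 \<le> t" and s: "0 \<le> s" "s \<le> t / 2"
  shows "controlled t (ennreal (5 * 2 powr (real DIM('a) / 2)))
    (\<lambda>x. ennreal (jet_norm t (heat_jet (x - \<xi>, t - s) - heat_jet (x, 1 + t))))"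
proof -
  let ?c = "2 powr (real DIM('a) / 2) :: real"
  have pi1: "(1::real) \<le> pi" using pi_ge_two by linarith
  have "t \<le> 4 * pi * (2 * (t - s))"
  proof -
    have "t \<le> 1 * (2 * (t - s))" using s by simp
    also have "\<dots> \<le> (4 * pi) * (2 * (t - s))" using pi1 s t by (intro mult_right_mono) auto
    finally show ?thesis .
  qed
  then have c1: "controlled t 1 (\<lambda>x. ennreal (heat_kernel (x - \<xi>) (2 * (t - s))))"
    using t by (intro controlled_heat_kernel) auto
  have c2: "controlled t 1 (\<lambda>x::'a. ennreal (heat_kernel x (2 * (1 + t))))"
    using t by (intro controlled_late_kernel) auto
  have "controlled t (ennreal (3 * ?c) * 1 + ennreal (2 * ?c) * 1)
      (\<lambda>x. ennreal (3 * ?c) * ennreal (heat_kernel (x - \<xi>) (2 * (t - s))) + ennreal (2 * ?c) * ennreal (heat_kernel x (2 * (1 + t))))"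
    by (intro controlled_add controlled_cmult c1 c2)
  then show ?thesis
  proof (rule controlled_mono)
    show "(\<lambda>x. ennreal (jet_norm t (heat_jet (x - \<xi>, t - s) - heat_jet (x, 1 + t)))) \<in> borel_measurable borel"
      by measurable
    show "ennreal (3 * ?c) * 1 + ennreal (2 * ?c) * 1 \<le> ennreal (5 * ?c)"
      by (simp add: ennreal_plus[symmetric] del: ennreal_plus)
    fix x
    have r1: "sqrt t * (t - s) powr (- (1/2)) \<le> 2"
    proof -
      have "sqrt t \<le> sqrt (4 * (t - s))" using s by simp
      also have "\<dots> = 2 * sqrt (t - s)" by (simp only: real_sqrt_mult) simp
      finally show ?thesis using t s by (simp add: powr_minus_half field_simps)
    qed
    have "jet_norm t (heat_jet (x - \<xi>, t - s) - heat_jet (x, 1 + t)) \<le> jet_norm t (heat_jet (x - \<xi>, t - s)) + jet_norm t (heat_jet (x, 1 + t))"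
      using t by (intro jet_norm_diff) auto
    also have "\<dots> \<le> 3 * ?c * heat_kernel (x - \<xi>) (2 * (t - s)) + 2 * ?c * heat_kernel x (2 * (1 + t))"
    proof (rule add_mono)
      have "jet_norm t (heat_jet (x - \<xi>, t - s)) \<le> ?c * (1 + sqrt t * (t - s) powr (- (1/2))) * heat_kernel (x - \<xi>) (2 * (t - s))"
        using jet_norm_heat_jet_le[of "(x - \<xi>, t - s)" t] t s by simp
      also have "\<dots> \<le> ?c * 3 * heat_kernel (x - \<xi>) (2 * (t - s))"
        using r1 by (intro mult_right_mono mult_left_mono heat_kernel_nonneg) auto
      finally show "jet_norm t (heat_jet (x - \<xi>, t - s)) \<le> 3 * ?c * heat_kernel (x - \<xi>) (2 * (t - s))"
        by (simp only: mult_ac)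
      show "jet_norm t (heat_jet (x, 1 + t)) \<le> 2 * ?c * heat_kernel x (2 * (1 + t))"
        using t by (intro jet_norm_heat_jet_late) auto
    qed
    finally have "ennreal (jet_norm t (heat_jet (x - \<xi>, t - s) - heat_jet (x, 1 + t)))
      \<le> ennreal (3 * ?c * heat_kernel (x - \<xi>) (2 * (t - s)) + 2 * ?c * heat_kernel x (2 * (1 + t)))"
      by (rule ennreal_leI)
    then show "ennreal (jet_norm t (heat_jet (x - \<xi>, t - s) - heat_jet (x, 1 + t)))
      \<le> ennreal (3 * ?c) * ennreal (heat_kernel (x - \<xi>) (2 * (t - s))) + ennreal (2 * ?c) * ennreal (heat_kernel x (2 * (1 + t)))"
      by (simp only: ennreal_plus ennreal_mult heat_kernel_nonneg mult_nonneg_nonneg powr_ge_zero zero_le_numeral)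
  qed
qed

lemma controlled_jet_difference_near:
  assumes e: "e > 0"
  obtains d where "0 < d"
    "\<And>(\<xi>::'a::euclidean_space) s t. t > 0 \<Longrightarrow> norm \<xi> < d * sqrt t \<Longrightarrow> \<bar>s\<bar> < d * t \<Longrightarrow> 1 < d * t \<Longrightarrow>
      controlled t (ennreal e) (\<lambda>x. ennreal (jet_norm t (heat_jet (x - \<xi>, t - s) - heat_jet (x, 1 + t))))"
proof -
  obtain d where d: "0 < d" "d \<le> 1/2"
    "\<And>(x::'a) \<xi> s t. t > 0 \<Longrightarrow> norm \<xi> < d * sqrt t \<Longrightarrow> \<bar>s\<bar> < d * t \<Longrightarrow> 1 < d * t \<Longrightarrow>
      jet_norm t (heat_jet (x - \<xi>, t - s) - heat_jet (x, 1 + t)) \<le> e * heat_kernel x (8 * t)"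
    using jet_norm_shift[OF e, where 'a = 'a] by blast
  show ?thesis
  proof (rule that[OF d(1)])
    fix \<xi> :: 'a and s t :: real
    assume as: "t > 0" "norm \<xi> < d * sqrt t" "\<bar>s\<bar> < d * t" "1 < d * t"
    have "t \<le> 4 * pi * (8 * t)"
      using mult_right_mono[of 1 "32 * pi" t] pi_ge_two as(1) by simp
    then have "controlled t 1 (\<lambda>x. ennreal (heat_kernel (x - 0::'a) (8 * t)))"
      using as(1) by (intro controlled_heat_kernel) auto
    from controlled_cmult[OF this, of "ennreal e"]
    show "controlled t (ennreal e) (\<lambda>x. ennreal (jet_norm t (heat_jet (x - \<xi>, t - s) - heat_jet (x, 1 + t))))"
    proof (rule controlled_mono)
      show "(\<lambda>x. ennreal (jet_norm t (heat_jet (x - \<xi>, t - s) - heat_jet (x, 1 + t)))) \<in> borel_measurable borel"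
        by measurable
      show "ennreal (jet_norm t (heat_jet (x - \<xi>, t - s) - heat_jet (x, 1 + t))) \<le> ennreal e * ennreal (heat_kernel (x - 0) (8 * t))" for x
        using d(3)[OF as, of x] e
        by (simp add: ennreal_mult[symmetric] heat_kernel_nonneg ennreal_leI)
    qed simp
  qed
qed

text \<open>Sources that are near the origin in parabolic scaling get the small constant
  \<open>e1\<close>; the remaining ones get the crude constant c. As t grows every fixed source
  becomes near, so the mass of the remaining ones vanishes by dominated convergence. The lemma
  covers the initial datum and the nonlinearity alike.\<close>

lemma controlled_early_sources:
  fixes pos :: "'b \<Rightarrow> 'a::euclidean_space \<times> real" and w :: "'b \<Rightarrow> real"
  assumes M: "sigma_finite_measure M" and pos[measurable]: "pos \<in> borel_measurable M"
    and wi: "integrable M w" and w0: "\<And>b. 0 \<le> w b" and time: "\<And>b. w b \<noteq> 0 \<Longrightarrow> 0 \<le> snd (pos b)"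
    and e: "e > 0"
  shows "eventually (\<lambda>t. controlled t (ennreal e) (\<lambda>x. \<integral>\<^sup>+b. ennreal (if snd (pos b) \<le> t / 2 then w b else 0)
      * ennreal (jet_norm t (heat_jet ((x, t) - pos b) - heat_jet (x, 1 + t))) \<partial>M)) at_top"
proof -
  have [measurable]: "w \<in> borel_measurable M" using wi by simp
  have fm[measurable]: "(\<lambda>b. fst (pos b)) \<in> borel_measurable M" and sm[measurable]: "(\<lambda>b. snd (pos b)) \<in> borel_measurable M"
    by (intro measurable_compose[OF pos borel_measurable_fst_borel] measurable_compose[OF pos borel_measurable_snd_borel])+
  define c where "c = 5 * 2 powr (real DIM('a) / 2)"
  have c0: "0 < c" by (simp add: c_def)
  define m where "m = (\<integral>b. w b \<partial>M)"
  have m0: "0 \<le> m" unfolding m_def using w0 by simp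
  \<comment> \<open>Near sources of total mass m contribute at most e / 2; adding 1 protects against
    m = 0.\<close>
  define e1 where "e1 = e / (2 * (m + 1))"
  have e1: "0 < e1" using e m0 by (simp add: e1_def)
  obtain d where d: "0 < d"
    "\<And>(\<xi>::'a) s t. t > 0 \<Longrightarrow> norm \<xi> < d * sqrt t \<Longrightarrow> \<bar>s\<bar> < d * t \<Longrightarrow> 1 < d * t \<Longrightarrow>
      controlled t (ennreal e1) (\<lambda>x. ennreal (jet_norm t (heat_jet (x - \<xi>, t - s) - heat_jet (x, 1 + t))))"
    using controlled_jet_difference_near[OF e1, where 'a = 'a] by blast
  define near where "near t b \<longleftrightarrow> norm (fst (pos b)) < d * sqrt t \<and> \<bar>snd (pos b)\<bar> < d * t" for t b
  have near_m[measurable]: "Measurable.pred M (near t)" for t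
    unfolding near_def[abs_def] by measurable
  define far where "far t = (\<integral>b. (if near t b then 0 else w b) \<partial>M)" for t
  have far_i: "integrable M (\<lambda>b. if near t b then 0 else w b)" for t
    by (rule Bochner_Integration.integrable_bound[OF wi]) auto
  have "(far \<longlongrightarrow> (\<integral>b. 0 \<partial>M)) at_top"
    unfolding far_def
  proof (rule integral_dominated_convergence_at_top[where w = w])
    show "AE b in M. ((\<lambda>t. if near t b then 0 else w b) \<longlongrightarrow> 0) at_top"
    proof (rule AE_I2)
      fix b
      have "filterlim (\<lambda>t. d * sqrt t) at_top at_top" "filterlim (\<lambda>t. d * t) at_top at_top"
        using d(1) by real_asymp+
      then have "eventually (\<lambda>t. norm (fst (pos b)) < d * sqrt t \<and> \<bar>snd (pos b)\<bar> < d * t) at_top"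
        by (intro eventually_conj) (simp_all add: filterlim_at_top_dense)
      then have "eventually (\<lambda>t. 0 = (if near t b then 0 else w b)) at_top"
        by eventually_elim (simp add: near_def)
      then show "((\<lambda>t. if near t b then 0 else w b) \<longlongrightarrow> 0) at_top"
        by (rule Lim_transform_eventually[OF tendsto_const])
    qed
    show "\<forall>\<^sub>F t in at_top. AE b in M. norm (if near t b then 0 else w b) \<le> w b"
      using w0 by (intro always_eventually allI AE_I2) auto
  qed (use wi in auto)
  then have "(far \<longlongrightarrow> 0) at_top" by simp
  then have "eventually (\<lambda>t. far t < e / (2 * c)) at_top"
    using e c0 by (intro order_tendstoD(2)) auto
  moreover have "filterlim (\<lambda>t. d * t) at_top at_top" using d(1) by real_asymp
  then have "eventually (\<lambda>t. 1 < d * t) at_top" by (simp add: filterlim_at_top_dense)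
  moreover have "eventually (\<lambda>t::real. 1 \<le> t) at_top" by (rule eventually_ge_at_top)
  ultimately show ?thesis
  proof eventually_elim
    case (elim t)
    define v where "v b = (if snd (pos b) \<le> t / 2 then w b else 0)" for b
    define eb where "eb b = (if near t b then e1 else c)" for b
    have [measurable]: "v \<in> borel_measurable M" "eb \<in> borel_measurable M"
      unfolding v_def[abs_def] eb_def[abs_def] by measurable
    have "controlled t (\<integral>\<^sup>+b. ennreal (v b) * ennreal (eb b) \<partial>M)
       (\<lambda>x. \<integral>\<^sup>+b. ennreal (v b) * ennreal (jet_norm t (heat_jet ((x, t) - pos b) - heat_jet (x, 1 + t))) \<partial>M)"
    proof (rule controlled_nn_integral[OF M])
      have p1: "(\<lambda>p. (fst p, t) - pos (snd p)) \<in> borel_measurable (borel \<Otimes>\<^sub>M M)"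
        by (intro borel_measurable_diff borel_measurable_Pair measurable_fst borel_measurable_const measurable_compose[OF measurable_snd pos])
      have p2: "(\<lambda>p. (fst p :: 'a, 1 + t)) \<in> borel_measurable (borel \<Otimes>\<^sub>M M)"
        by (intro borel_measurable_Pair measurable_fst borel_measurable_const)
      have "(\<lambda>p. jet_norm t (heat_jet ((fst p, t) - pos (snd p)) - heat_jet (fst p, 1 + t))) \<in> borel_measurable (borel \<Otimes>\<^sub>M M)"
        by (intro measurable_compose[OF _ jet_norm_measurable] borel_measurable_diff
            measurable_compose[OF p1 borel_measurable_heat_jet] measurable_compose[OF p2 borel_measurable_heat_jet])
      then show "(\<lambda>(x, b). ennreal (jet_norm t (heat_jet ((x, t) - pos b) - heat_jet (x, 1 + t)))) \<in> borel_measurable (borel \<Otimes>\<^sub>M M)"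
        unfolding case_prod_beta' by (rule measurable_compose[OF _ measurable_ennreal])
      fix b assume "ennreal (v b) \<noteq> 0"
      then have vb: "v b \<noteq> 0" by auto
      obtain \<xi> s where b: "pos b = (\<xi>, s)" by (cases "pos b")
      have s: "0 \<le> s" "s \<le> t / 2" using vb time[of b] by (auto simp: v_def b split: if_splits)
      show "controlled t (ennreal (eb b)) (\<lambda>x. ennreal (jet_norm t (heat_jet ((x, t) - pos b) - heat_jet (x, 1 + t))))"
      proof (cases "near t b")
        case True
        then show ?thesis
          using d(2)[of t \<xi> s] elim by (simp add: near_def eb_def b)
      next
        case False
        then show ?thesis
          using controlled_jet_difference[of t s \<xi>] elim s by (simp add: eb_def b c_def)
      qed
    qed measurable
    moreover have "(\<integral>\<^sup>+b. ennreal (v b) * ennreal (eb b) \<partial>M) \<le> ennreal e"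
    proof -
      have "(\<integral>\<^sup>+b. ennreal (v b) * ennreal (eb b) \<partial>M) \<le> (\<integral>\<^sup>+b. ennreal (e1 * w b + c * (if near t b then 0 else w b)) \<partial>M)"
      proof (rule nn_integral_mono)
        fix b
        have "0 \<le> e1 * w b" using w0[of b] e1 by simp
        then have le: "v b * eb b \<le> e1 * w b + c * (if near t b then 0 else w b)"
          using w0[of b] e1 c0 by (auto simp: v_def eb_def)
        have ve: "ennreal (v b) * ennreal (eb b) = ennreal (v b * eb b)"
          using w0[of b] e1 c0 by (intro ennreal_mult[symmetric]) (auto simp: v_def eb_def)
        show "ennreal (v b) * ennreal (eb b) \<le> ennreal (e1 * w b + c * (if near t b then 0 else w b))"
          unfolding ve by (rule ennreal_leI[OF le])
      qed
      also have "\<dots> = ennreal (\<integral>b. e1 * w b + c * (if near t b then 0 else w b) \<partial>M)"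
        using wi far_i[of t] w0 e1 c0 by (intro nn_integral_eq_integral) auto
      also have "(\<integral>b. e1 * w b + c * (if near t b then 0 else w b) \<partial>M) = e1 * m + c * far t"
        unfolding far_def m_def using wi far_i[of t] by (subst Bochner_Integration.integral_add) auto
      also have "ennreal (e1 * m + c * far t) \<le> ennreal e"
      proof (rule ennreal_leI)
        have "e1 * m \<le> e / 2"
          using e m0 by (simp add: e1_def field_simps)
        moreover have "c * far t \<le> e / 2"
          using elim(1) c0 by (simp add: field_simps)
        ultimately show "e1 * m + c * far t \<le> e" by simp
      qed
      finally show ?thesis .
    qed
    ultimately have "controlled t (ennreal e) (\<lambda>x. \<integral>\<^sup>+b. ennreal (v b) * ennreal (jet_norm t (heat_jet ((x, t) - pos b) - heat_jet (x, 1 + t))) \<partial>M)"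
      by (rule controlled_weaken)
    then show ?case by (simp only: v_def)
  qed
qed

text \<open>The supremum and L^1 bounds of the jet are read off componentwise; the gradient
  component gains 1 / sqrt t from the weight in \<open>jet_norm\<close>.\<close>

lemma controlled_jet_consequences:
  fixes R :: "'a::euclidean_space \<Rightarrow> real \<times> 'a"
  assumes c: "controlled t (ennreal e) (\<lambda>x. ennreal (jet_norm t (R x)))"
    and R: "R \<in> borel_measurable borel" and t: "0 < t" and e: "0 \<le> e"
  shows "integrable lborel (\<lambda>x. fst (R x))" "(\<integral>x. \<bar>fst (R x)\<bar> \<partial>lborel) \<le> e"
    and "integrable lborel (\<lambda>x. snd (R x))" "(\<integral>x. norm (snd (R x)) \<partial>lborel) \<le> e / sqrt t"
    and "1 \<le> q \<Longrightarrow> Lp_norm q (\<lambda>x. fst (R x)) \<le> ereal (e * t powr (- (real DIM('a) / 2 * (1 - inv_exp q))))"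
    and "1 \<le> q \<Longrightarrow> Lp_norm q (\<lambda>x. snd (R x)) \<le> ereal (e / sqrt t * t powr (- (real DIM('a) / 2 * (1 - inv_exp q))))"
proof -
  have f[measurable]: "(\<lambda>x. fst (R x)) \<in> borel_measurable borel" and s[measurable]: "(\<lambda>x. snd (R x)) \<in> borel_measurable borel"
    by (intro measurable_compose[OF R borel_measurable_fst_borel] measurable_compose[OF R borel_measurable_snd_borel])+
  have jm: "(\<lambda>x. jet_norm t (R x)) \<in> borel_measurable borel"
    by (rule measurable_compose[OF R jet_norm_measurable])
  have j0: "0 \<le> jet_norm t (R x)" for x using t by (simp add: jet_norm_def)
  have fj: "\<bar>fst (R x)\<bar> \<le> jet_norm t (R x)" for x using t by (simp add: jet_norm_def)
  have sj: "norm (snd (R x)) \<le> jet_norm t (R x) / sqrt t" for x using t by (simp add: jet_norm_def field_simps)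
  have jb: "jet_norm t (R x) \<le> e * t powr (- real DIM('a) / 2)" for x
  proof -
    have "ennreal (jet_norm t (R x)) \<le> ennreal e * ennreal (t powr (- real DIM('a) / 2))"
      using c unfolding controlled_def by blast
    also have "\<dots> = ennreal (e * t powr (- real DIM('a) / 2))"
      using e by (simp add: ennreal_mult)
    finally show ?thesis using e by (subst (asm) ennreal_le_iff) auto
  qed
  have ji: "(\<integral>\<^sup>+x. ennreal (jet_norm t (R x)) \<partial>lborel) \<le> ennreal e"
    using c unfolding controlled_def by blast
  have fi: "(\<integral>\<^sup>+x. ennreal (norm (fst (R x))) \<partial>lborel) \<le> ennreal e"
    by (rule order_trans[OF nn_integral_mono ji]) (use fj in \<open>auto intro: ennreal_leI\<close>)
  have si: "(\<integral>\<^sup>+x. ennreal (norm (snd (R x))) \<partial>lborel) \<le> ennreal (e / sqrt t)"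
  proof -
    have "(\<integral>\<^sup>+x. ennreal (norm (snd (R x))) \<partial>lborel) \<le> (\<integral>\<^sup>+x. ennreal (1 / sqrt t) * ennreal (jet_norm t (R x)) \<partial>lborel)"
      using sj j0 t by (intro nn_integral_mono) (simp add: ennreal_mult[symmetric] ennreal_leI)
    also have "\<dots> = ennreal (1 / sqrt t) * (\<integral>\<^sup>+x. ennreal (jet_norm t (R x)) \<partial>lborel)"
      using jm by (intro nn_integral_cmult) auto
    also have "\<dots> \<le> ennreal (1 / sqrt t) * ennreal e" by (intro mult_left_mono ji) auto
    also have "\<dots> = ennreal (e / sqrt t)" using e t by (simp add: ennreal_mult[symmetric])
    finally show ?thesis .
  qed
  show I1: "integrable lborel (\<lambda>x. fst (R x))"
    using fi by (intro integrableI_bounded) (auto intro: le_less_trans)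
  show I2: "integrable lborel (\<lambda>x. snd (R x))"
    using si by (intro integrableI_bounded) (auto intro: le_less_trans)
  show "(\<integral>x. \<bar>fst (R x)\<bar> \<partial>lborel) \<le> e"
    using fi I1 e by (subst (asm) nn_integral_eq_integral) (auto simp: ennreal_le_iff)
  show "(\<integral>x. norm (snd (R x)) \<partial>lborel) \<le> e / sqrt t"
    using si I2 e t by (subst (asm) nn_integral_eq_integral) (auto simp: ennreal_le_iff)
  show "1 \<le> q \<Longrightarrow> Lp_norm q (\<lambda>x. fst (R x)) \<le> ereal (e * t powr (- (real DIM('a) / 2 * (1 - inv_exp q))))"
    using fj jb fi t e by (intro Lp_norm_le_interpolation f) (auto intro: order_trans)
  show "1 \<le> q \<Longrightarrow> Lp_norm q (\<lambda>x. snd (R x)) \<le> ereal (e / sqrt t * t powr (- (real DIM('a) / 2 * (1 - inv_exp q))))"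
  proof (rule Lp_norm_le_interpolation[OF s t _ _ _ si])
    show "norm (snd (R x)) \<le> e / sqrt t * t powr (- real DIM('a) / 2)" for x
      using sj[of x] divide_right_mono[OF jb[of x], of "sqrt t"] t by simp
  qed (use e t in auto)
qed

section \<open>Unweighted and weighted norms of the dominating solution\<close>

lemma (in initial_datum) controlled_H:
  "t > 0 \<Longrightarrow> controlled t (ennreal mass) (\<lambda>x. ennreal (H (x, t)))"
  unfolding controlled_def
proof (intro conjI allI)
  assume t: "t > 0"
  show "(\<lambda>x. ennreal (H (x, t))) \<in> borel_measurable borel" by measurable
  show "(\<integral>\<^sup>+x. ennreal (H (x, t)) \<partial>lborel) \<le> ennreal mass" by (simp add: nn_integral_H_total[OF t])
  fix x
  have "t \<le> 8 * pi * t" using mult_right_mono[of 1 "8 * pi" t] pi_ge_two t by simp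
  then have "(8 * pi * t) powr (- real DIM('a) / 2) \<le> t powr (- real DIM('a) / 2)"
    using t by (intro powr_mono2') auto
  then have "(8 * pi * t) powr (- real DIM('a) / 2) * mass \<le> t powr (- real DIM('a) / 2) * mass"
    by (intro mult_right_mono mass_nonneg)
  then have "H (x, t) \<le> mass * t powr (- real DIM('a) / 2)"
    using H_le[OF t, of x] by (simp add: mult.commute)
  then show "ennreal (H (x, t)) \<le> ennreal mass * ennreal (t powr (- real DIM('a) / 2))"
    using mass_nonneg by (simp add: ennreal_mult[symmetric] ennreal_leI)
qed

text \<open>From ln (1 + r) \<le> r and l r \<le> 4 l^2 + r^2 / 16. The rate 1/16 is what becomes
  free when the kernel time is doubled from 2t to 4t.\<close>

lemma one_plus_powr_le_exp:
  fixes r :: real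
  assumes "0 \<le> r" "0 \<le> l"
  shows "(1 + r) powr l \<le> exp (4 * l\<^sup>2) * exp (r\<^sup>2 / 16)"
proof -
  have "ln (1 + r) \<le> r" using assms ln_add_one_self_le_self by auto
  then have "l * ln (1 + r) \<le> l * r" using assms by (intro mult_left_mono)
  also have "\<dots> \<le> 4 * l\<^sup>2 + r\<^sup>2 / 16"
  proof -
    have "0 \<le> (2 * l - r / 4)\<^sup>2" by simp
    then show ?thesis by (simp add: power2_eq_square algebra_simps)
  qed
  finally have "exp (l * ln (1 + r)) \<le> exp (4 * l\<^sup>2 + r\<^sup>2 / 16)" by simp
  then show ?thesis using assms by (simp add: powr_def exp_add)
qed

text \<open>Put r = |y| / sqrt t. Then 1 + |y| \<le> (1 + sqrt t) (1 + r): the first factor produces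
  the growth (1 + t)^(l / 2), and the second is absorbed by half of the Gaussian exponent, at the
  price of one more doubling of time.\<close>

lemma weighted_heat_kernel_le:
  fixes y :: "'a::euclidean_space"
  assumes t: "0 < t" and l: "0 \<le> l"
  shows "(1 + norm y) powr l * heat_kernel y (2 * t)
    \<le> (2 powr (l / 2) * exp (4 * l\<^sup>2) * 2 powr (real DIM('a) / 2)) * (1 + t) powr (l / 2) * heat_kernel y (4 * t)"
proof -
  define r where "r = norm y / sqrt t"
  have r: "0 \<le> r" "norm y = r * sqrt t" "(norm y)\<^sup>2 = r\<^sup>2 * t"
    using t by (auto simp: r_def power_divide)
  have "(1 + norm y) powr l \<le> ((1 + sqrt t) * (1 + r)) powr l"
  proof (rule powr_mono2)
    have "(1 + sqrt t) * (1 + r) = 1 + norm y + (r + sqrt t)" by (simp add: r algebra_simps)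
    moreover have "0 \<le> r + sqrt t" using r(1) t by simp
    ultimately show "1 + norm y \<le> (1 + sqrt t) * (1 + r)" by linarith
  qed (use l in auto)
  also have "\<dots> = (1 + sqrt t) powr l * (1 + r) powr l" by (rule powr_mult)
  also have "(1 + sqrt t) powr l \<le> (2 * (1 + t)) powr (l / 2)"
  proof -
    have "2 * sqrt t \<le> 1 + t" using sum_squares_bound[of 1 "sqrt t"] t by simp
    then have "(1 + sqrt t) powr 2 \<le> 2 * (1 + t)"
      using t by (simp add: power2_eq_square algebra_simps)
    then have "((1 + sqrt t) powr 2) powr (l / 2) \<le> (2 * (1 + t)) powr (l / 2)"
      using l by (intro powr_mono2) auto
    then show ?thesis by (simp add: powr_powr)
  qed
  also have "(2 * (1 + t)) powr (l / 2) = 2 powr (l / 2) * (1 + t) powr (l / 2)" by (rule powr_mult)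
  finally have a: "(1 + norm y) powr l \<le> 2 powr (l / 2) * (1 + t) powr (l / 2) * (1 + r) powr l"
    by (simp add: mult_right_mono)
  also have "\<dots> \<le> 2 powr (l / 2) * (1 + t) powr (l / 2) * (exp (4 * l\<^sup>2) * exp (r\<^sup>2 / 16))"
    by (intro mult_left_mono one_plus_powr_le_exp r l) auto
  finally have b: "(1 + norm y) powr l \<le> 2 powr (l / 2) * (1 + t) powr (l / 2) * (exp (4 * l\<^sup>2) * exp (r\<^sup>2 / 16))" .
  have "heat_kernel y (2 * t) = 2 powr (real DIM('a) / 2) * exp (- (r\<^sup>2 / 16)) * heat_kernel y (4 * t)"
    using heat_kernel_double[of "2 * t" y] t by (simp add: r(3))
  then have "(1 + norm y) powr l * heat_kernel y (2 * t)
     \<le> 2 powr (l / 2) * (1 + t) powr (l / 2) * (exp (4 * l\<^sup>2) * exp (r\<^sup>2 / 16)) * (2 powr (real DIM('a) / 2) * exp (- (r\<^sup>2 / 16)) * heat_kernel y (4 * t))"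
    using mult_right_mono[OF b, of "heat_kernel y (2 * t)"] by (simp add: heat_kernel_nonneg)
  also have "\<dots> = (exp (r\<^sup>2 / 16) * exp (- (r\<^sup>2 / 16))) * ((2 powr (l / 2) * exp (4 * l\<^sup>2) * 2 powr (real DIM('a) / 2)) * (1 + t) powr (l / 2) * heat_kernel y (4 * t))"
    by (simp only: mult_ac)
  also have "exp (r\<^sup>2 / 16) * exp (- (r\<^sup>2 / 16)) = 1" by (simp add: exp_add[symmetric])
  finally show ?thesis by simp
qed

text \<open>The weight is submultiplicative, 1 + |x| \<le> (1 + |x - \<xi>|) (1 + |\<xi>|). One
  factor goes to the kernel, the other to \<phi>, and the kernel of time 4t has unit mass in
  x.\<close>

lemma (in initial_datum) wnorm_H_le:
  assumes t: "0 < t" and l: "0 \<le> l"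
  shows "(\<integral>\<^sup>+x. ennreal ((1 + norm x) powr l * H (x, t)) \<partial>lborel)
    \<le> ennreal ((2 powr (l / 2) * exp (4 * l\<^sup>2) * 2 powr (real DIM('a) / 2)) * (1 + t) powr (l / 2)) * wnorm l \<phi>"
proof -
  define D where "D = (2 powr (l / 2) * exp (4 * l\<^sup>2) * 2 powr (real DIM('a) / 2)) * (1 + t) powr (l / 2)"
  have D: "0 \<le> D" by (simp add: D_def)
  have "(\<integral>\<^sup>+x. ennreal ((1 + norm x) powr l * H (x, t)) \<partial>lborel)
     = (\<integral>\<^sup>+x. (\<integral>\<^sup>+\<xi>. ennreal ((1 + norm x) powr l) * ennreal (heat_kernel (x - \<xi>) (2 * t) * \<bar>\<phi> \<xi>\<bar>) \<partial>lborel) \<partial>lborel)"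
  proof (rule nn_integral_cong)
    fix x
    have "ennreal ((1 + norm x) powr l * H (x, t)) = ennreal ((1 + norm x) powr l) * (\<integral>\<^sup>+\<xi>. ennreal (heat_kernel (x - \<xi>) (2 * t) * \<bar>\<phi> \<xi>\<bar>) \<partial>lborel)"
      unfolding nn_integral_H[OF t] by (simp add: ennreal_mult H_nonneg)
    also have "\<dots> = (\<integral>\<^sup>+\<xi>. ennreal ((1 + norm x) powr l) * ennreal (heat_kernel (x - \<xi>) (2 * t) * \<bar>\<phi> \<xi>\<bar>) \<partial>lborel)"
      by (rule nn_integral_cmult[symmetric]) measurable
    finally show "ennreal ((1 + norm x) powr l * H (x, t)) = (\<integral>\<^sup>+\<xi>. ennreal ((1 + norm x) powr l) * ennreal (heat_kernel (x - \<xi>) (2 * t) * \<bar>\<phi> \<xi>\<bar>) \<partial>lborel)" .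
  qed
  also have "\<dots> \<le> (\<integral>\<^sup>+x. (\<integral>\<^sup>+\<xi>. ennreal (heat_kernel (x - \<xi>) (4 * t)) * ennreal (D * ((1 + norm \<xi>) powr l * \<bar>\<phi> \<xi>\<bar>)) \<partial>lborel) \<partial>lborel)"
  proof (intro nn_integral_mono)
    fix x \<xi> :: 'a
    have "(1 + norm x) powr l \<le> ((1 + norm (x - \<xi>)) * (1 + norm \<xi>)) powr l"
    proof (rule powr_mono2)
      have "norm x \<le> norm (x - \<xi>) + norm \<xi>" using norm_triangle_ineq[of "x - \<xi>" \<xi>] by simp
      moreover have "(1 + norm (x - \<xi>)) * (1 + norm \<xi>) = 1 + norm (x - \<xi>) + norm \<xi> + norm (x - \<xi>) * norm \<xi>"
        by (simp add: algebra_simps)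
      moreover have "0 \<le> norm (x - \<xi>) * norm \<xi>" by simp
      ultimately show "1 + norm x \<le> (1 + norm (x - \<xi>)) * (1 + norm \<xi>)" by linarith
    qed (use l in auto)
    also have "\<dots> = (1 + norm (x - \<xi>)) powr l * (1 + norm \<xi>) powr l" by (rule powr_mult)
    finally have "(1 + norm x) powr l * (heat_kernel (x - \<xi>) (2 * t) * \<bar>\<phi> \<xi>\<bar>)
      \<le> ((1 + norm (x - \<xi>)) powr l * (1 + norm \<xi>) powr l) * (heat_kernel (x - \<xi>) (2 * t) * \<bar>\<phi> \<xi>\<bar>)"
      by (intro mult_right_mono) (auto simp: heat_kernel_nonneg)
    also have "\<dots> = ((1 + norm (x - \<xi>)) powr l * heat_kernel (x - \<xi>) (2 * t)) * ((1 + norm \<xi>) powr l * \<bar>\<phi> \<xi>\<bar>)"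
      by (simp add: mult_ac)
    also have "\<dots> \<le> (D * heat_kernel (x - \<xi>) (4 * t)) * ((1 + norm \<xi>) powr l * \<bar>\<phi> \<xi>\<bar>)"
      unfolding D_def by (intro mult_right_mono weighted_heat_kernel_le t l) auto
    also have "\<dots> = heat_kernel (x - \<xi>) (4 * t) * (D * ((1 + norm \<xi>) powr l * \<bar>\<phi> \<xi>\<bar>))"
      by (simp add: mult_ac)
    finally have le: "(1 + norm x) powr l * (heat_kernel (x - \<xi>) (2 * t) * \<bar>\<phi> \<xi>\<bar>) \<le> heat_kernel (x - \<xi>) (4 * t) * (D * ((1 + norm \<xi>) powr l * \<bar>\<phi> \<xi>\<bar>))" .
    have e1: "ennreal ((1 + norm x) powr l) * ennreal (heat_kernel (x - \<xi>) (2 * t) * \<bar>\<phi> \<xi>\<bar>) = ennreal ((1 + norm x) powr l * (heat_kernel (x - \<xi>) (2 * t) * \<bar>\<phi> \<xi>\<bar>))"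
      by (rule ennreal_mult[symmetric]) (auto simp: heat_kernel_nonneg)
    have e2: "ennreal (heat_kernel (x - \<xi>) (4 * t)) * ennreal (D * ((1 + norm \<xi>) powr l * \<bar>\<phi> \<xi>\<bar>)) = ennreal (heat_kernel (x - \<xi>) (4 * t) * (D * ((1 + norm \<xi>) powr l * \<bar>\<phi> \<xi>\<bar>)))"
      by (rule ennreal_mult[symmetric]) (auto simp: heat_kernel_nonneg D)
    show "ennreal ((1 + norm x) powr l) * ennreal (heat_kernel (x - \<xi>) (2 * t) * \<bar>\<phi> \<xi>\<bar>)
       \<le> ennreal (heat_kernel (x - \<xi>) (4 * t)) * ennreal (D * ((1 + norm \<xi>) powr l * \<bar>\<phi> \<xi>\<bar>))"
      unfolding e1 e2 by (rule ennreal_leI[OF le])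
  qed
  also have "\<dots> = (\<integral>\<^sup>+\<xi>. (\<integral>\<^sup>+x. ennreal (heat_kernel (x - \<xi>) (4 * t)) * ennreal (D * ((1 + norm \<xi>) powr l * \<bar>\<phi> \<xi>\<bar>)) \<partial>lborel) \<partial>lborel)"
    by (rule lborel_pair.Fubini') measurable
  also have "\<dots> = (\<integral>\<^sup>+\<xi>. ennreal D * ennreal ((1 + norm \<xi>) powr l * \<bar>\<phi> \<xi>\<bar>) \<partial>lborel)"
    using t D by (intro nn_integral_cong) (simp add: nn_integral_multc nn_integral_heat_kernel ennreal_mult)
  also have "\<dots> = ennreal D * wnorm l \<phi>"
    unfolding wnorm_def real_norm_def by (rule nn_integral_cmult) measurable
  finally show ?thesis unfolding D_def .
qed

section \<open>Source terms and norms of a mild solution\<close>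

locale mild_solution = decaying_nonlinearity +
  fixes W :: "'a \<times> real \<Rightarrow> real \<times> 'a"
  assumes W_measurable: "W \<in> borel_measurable borel" and W_dominated: "dominated W"
    and W_eq: "t > 0 \<Longrightarrow> W (x, t) = init.potential \<phi> (x, t) + duh.potential (src 0 W) (x, t)"
begin

abbreviation F :: "'a \<times> real \<Rightarrow> real" where "F \<equiv> src 0 W"

lemma F_measurable[measurable]: "F \<in> borel_measurable borel"
  by (rule src_measurable[OF W_measurable]) simp

lemma F_split_measurable:
  "(\<lambda>b. if snd b \<le> r then F b else 0) \<in> borel_measurable borel"
  "(\<lambda>b. if r < snd b then F b else 0) \<in> borel_measurable borel"
proof -
  have 1: "{b :: 'a \<times> real. snd b \<le> r} \<in> sets borel"
    by (intro borel_closed closed_Collect_le continuous_intros)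
  have 2: "{b :: 'a \<times> real. r < snd b} \<in> sets borel"
    by (intro borel_open open_Collect_less continuous_intros)
  show "(\<lambda>b. if snd b \<le> r then F b else 0) \<in> borel_measurable borel"
    using 1 by (intro measurable_If F_measurable borel_measurable_const) (simp only: space_borel UNIV_I simp_thms)
  show "(\<lambda>b. if r < snd b then F b else 0) \<in> borel_measurable borel"
    using 2 by (intro measurable_If F_measurable borel_measurable_const) (simp only: space_borel UNIV_I simp_thms)
qed

lemma F_le_\<rho>: "\<bar>F b\<bar> \<le> K * B * \<rho> b"
  by (rule src_le_\<rho>[OF W_dominated]) simp

lemma F_nonpos_time: "snd b \<le> 0 \<Longrightarrow> F b = 0"
  by (simp add: src_def)

lemma F_le: "s > 0 \<Longrightarrow> \<bar>F (y, s)\<bar> \<le> K * B * kw A s * H (y, s)"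
proof -
  assume s: "s > 0"
  have "\<bar>F (y, s)\<bar> \<le> K * kw A s * \<beta> s * H (y, s)"
    by (rule src_bound[OF W_dominated order_refl s])
  also have "\<dots> \<le> K * kw A s * B * H (y, s)"
    using \<beta>_le[OF s] K_pos kw_nonneg[of A s] H_nonneg[of "(y, s)"] by (intro mult_right_mono mult_left_mono) auto
  finally show ?thesis by (simp add: mult_ac)
qed

lemma KB_pos: "0 < K * B"
  using K_pos B_pos by simp

text \<open>At every time s the spatial integral of \<open>H\<close> is \<open>mass\<close>, so the
  total is at most K B \<open>mass\<close> times the finite integral of \<open>kw A\<close>.\<close>

lemma F_integrable: "integrable lborel F"
proof (rule integrableI_bounded)
  have "(\<integral>\<^sup>+b. ennreal (norm (F b)) \<partial>lborel) = (\<integral>\<^sup>+s. (\<integral>\<^sup>+y. ennreal (norm (F (y, s))) \<partial>lborel) \<partial>lborel)"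
    by (rule nn_integral_lborel_prod_snd) measurable
  also have "\<dots> \<le> (\<integral>\<^sup>+s. ennreal (K * B * mass) * (ennreal (kw A s) * indicator {0<..} s) \<partial>lborel)"
  proof (rule nn_integral_mono)
    fix s :: real
    show "(\<integral>\<^sup>+y. ennreal (norm (F (y, s))) \<partial>lborel) \<le> ennreal (K * B * mass) * (ennreal (kw A s) * indicator {0<..} s)"
    proof (cases "s > 0")
      case True
      have "(\<integral>\<^sup>+y. ennreal (norm (F (y, s))) \<partial>lborel) \<le> (\<integral>\<^sup>+y. ennreal (K * B * kw A s) * ennreal (H (y, s)) \<partial>lborel)"
        using F_le[OF True] KB_pos kw_nonneg[of A s] H_nonneg
        by (intro nn_integral_mono) (simp add: ennreal_mult[symmetric] ennreal_leI)
      also have "\<dots> = ennreal (K * B * kw A s) * ennreal mass"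
        unfolding nn_integral_H_total[OF True, symmetric] by (rule nn_integral_cmult) measurable
      also have "\<dots> = ennreal (K * B * mass) * ennreal (kw A s)"
      proof -
        have "ennreal (K * B * kw A s) * ennreal mass = ennreal (K * B * kw A s * mass)"
          using KB_pos kw_nonneg[of A s] mass_nonneg by (intro ennreal_mult[symmetric]) auto
        also have "K * B * kw A s * mass = K * B * mass * kw A s" by simp
        also have "ennreal \<dots> = ennreal (K * B * mass) * ennreal (kw A s)"
          using KB_pos kw_nonneg[of A s] mass_nonneg by (intro ennreal_mult) auto
        finally show ?thesis .
      qed
      finally show ?thesis using True by simp
    next
      case False
      then show ?thesis by (simp add: F_nonpos_time)
    qed
  qed
  also have "\<dots> = ennreal (K * B * mass) * (\<integral>\<^sup>+s\<in>{0<..}. ennreal (kw A s) \<partial>lborel)"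
    by (rule nn_integral_cmult) measurable
  also have "\<dots> \<le> ennreal (K * B * mass) * ennreal (1 / (A - 1))"
    by (intro mult_left_mono nn_integral_kw_le A) auto
  also have "\<dots> < \<infinity>" by (simp add: ennreal_mult_less_top)
  finally show "(\<integral>\<^sup>+b. ennreal (norm (F b)) \<partial>lborel) < \<infinity>" .
qed measurable

lemma jet_norm_W_le: "t > 0 \<Longrightarrow> jet_norm t (W (x, t)) \<le> 2 * B * H (x, t)"
proof -
  assume t: "t > 0"
  have f: "\<bar>fst (W (x, t))\<bar> \<le> \<beta> t * H (x, t)" and s: "norm (snd (W (x, t))) \<le> t powr (- (1/2)) * (\<beta> t * H (x, t))"
    using W_dominated t unfolding dominated_def by blast+
  have "sqrt t * norm (snd (W (x, t))) \<le> sqrt t * (t powr (- (1/2)) * (\<beta> t * H (x, t)))"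
    using s by (intro mult_left_mono) (use t in auto)
  also have "\<dots> = \<beta> t * H (x, t)" using t by (simp add: powr_minus_half)
  finally have "jet_norm t (W (x, t)) \<le> 2 * (\<beta> t * H (x, t))"
    using f by (simp add: jet_norm_def)
  also have "\<beta> t * H (x, t) \<le> B * H (x, t)"
    by (intro mult_right_mono \<beta>_le t H_nonneg)
  finally show ?thesis by simp
qed

lemma W_slice_measurable: "(\<lambda>x. W (x, t)) \<in> borel_measurable borel"
proof -
  have "(\<lambda>x::'a. (x, t)) \<in> borel_measurable borel"
    by (intro borel_measurable_continuous_onI continuous_intros)
  from measurable_compose[OF this W_measurable] show ?thesis .
qed

lemma controlled_W:
  assumes t: "t > 0"
  shows "controlled t (ennreal (2 * B * mass)) (\<lambda>x. ennreal (jet_norm t (W (x, t))))"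
  using controlled_cmult[OF controlled_H[OF t], of "ennreal (2 * B)"]
proof (rule controlled_mono)
  show "(\<lambda>x. ennreal (jet_norm t (W (x, t)))) \<in> borel_measurable borel"
    by (intro measurable_compose[OF measurable_compose[OF W_slice_measurable jet_norm_measurable] measurable_ennreal])
  show "ennreal (jet_norm t (W (x, t))) \<le> ennreal (2 * B) * ennreal (H (x, t))" for x
    using jet_norm_W_le[OF t, of x] B_pos H_nonneg[of "(x, t)"]
    by (simp only: ennreal_mult[symmetric] ennreal_leI mult_nonneg_nonneg less_imp_le zero_le_numeral)
  show "ennreal (2 * B) * ennreal mass \<le> ennreal (2 * B * mass)"
    using B_pos mass_nonneg by (simp add: ennreal_mult[symmetric])
qed

definition M where "M = (\<integral>x. \<phi> x \<partial>lborel) + (\<integral>b. F b \<partial>lborel)"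

text \<open>Sources later than t / 2 include ones too recent for the comparison of kernels, but the
  nonlinearity has decayed by then: the power of 1 + sqrt (t / 2) tends to 0 since A > 1. The
  constant 8 is twice the 4 of \<open>abel_kw_tail\<close>, once per component.\<close>

lemma late_potential_le:
  assumes t: "t > 0"
  shows "jet_norm t (duh.potential (\<lambda>b. if t / 2 < snd b then F b else 0) (x, t))
    \<le> 8 * 2 powr (real DIM('a) / 2) * (K * B) * (1 + sqrt (t / 2)) powr (2 - 2 * A) * H (x, t)"
proof -
  let ?c = "2 powr (real DIM('a) / 2) :: real"
  let ?F = "\<lambda>b. if t / 2 < snd b then F b else 0"
  define P where "P = 4 * (K * B) * t powr (- (1/2)) * (1 + sqrt (t / 2)) powr (2 - 2 * A)"
  have P: "0 \<le> P" using KB_pos by (simp add: P_def)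
  define a where "a s = K * B * kw A s" for s
  have a0: "0 \<le> a s" for s using KB_pos kw_nonneg[of A s] by (simp add: a_def)
  have [measurable]: "a \<in> borel_measurable borel" unfolding a_def by measurable
  have F1: "\<bar>?F (y, s)\<bar> \<le> a s * indicator {t/2<..} s * H (y, s)" if "s > 0" for y s
    using F_le[OF that, of y] by (auto simp: a_def)
  have F2: "?F (y, s) = 0" if "s \<le> 0" for y s using that t by simp
  have tail: "(\<integral>\<^sup>+s\<in>{0<..<t} \<inter> {t/2<..}. ennreal ((t - s) powr (- (1/2)) * a s) \<partial>lborel) \<le> ennreal P"
  proof -
    have "(\<integral>\<^sup>+s\<in>{0<..<t} \<inter> {t/2<..}. ennreal ((t - s) powr (- (1/2)) * a s) \<partial>lborel)
       \<le> (\<integral>\<^sup>+s. ennreal (K * B) * (ennreal ((t - s) powr (- (1/2)) * kw A s) * indicator {t/2..<t} s) \<partial>lborel)"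
      using KB_pos kw_nonneg[of A] by (intro nn_integral_mono)
        (auto simp: a_def indicator_def ennreal_mult[symmetric] mult_ac)
    also have "\<dots> = ennreal (K * B) * (\<integral>\<^sup>+s\<in>{t/2..<t}. ennreal ((t - s) powr (- (1/2)) * kw A s) \<partial>lborel)"
      by (rule nn_integral_cmult) measurable
    also have "\<dots> \<le> ennreal (K * B) * ennreal (4 * t powr (- (1/2)) * (1 + sqrt (t / 2)) powr (2 - 2 * A))"
      by (intro mult_left_mono abel_kw_tail A t) auto
    also have "\<dots> = ennreal P"
      using KB_pos by (subst ennreal_mult[symmetric]) (auto simp: P_def mult_ac)
    finally show ?thesis .
  qed
  have f: "\<bar>fst (duh.potential ?F (x, t))\<bar> \<le> ?c * H (x, t) * (sqrt t * P)"
    and s: "norm (snd (duh.potential ?F (x, t))) \<le> ?c * H (x, t) * P"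
    by (intro duhamel_jet_bound[OF _ a0 _ F1 F2 t P tail]; simp)+
  have "sqrt t * norm (snd (duh.potential ?F (x, t))) \<le> sqrt t * (?c * H (x, t) * P)"
    using s t by (intro mult_left_mono) auto
  then have "jet_norm t (duh.potential ?F (x, t)) \<le> 2 * (?c * H (x, t) * (sqrt t * P))"
    using f by (simp add: jet_norm_def mult_ac)
  also have "sqrt t * P = 4 * (K * B) * (1 + sqrt (t / 2)) powr (2 - 2 * A)"
    using t by (simp add: P_def powr_minus_half)
  finally show ?thesis by (simp add: mult_ac)
qed

text \<open>\<open>M\<close> is the sum of all sources, so its multiple of the jet can be
  distributed over them. For early sources the difference of jets is kept together, because
  cancellation is essential there; for late ones the potential and their share of \<open>M\<close>
  are separated, since each is small by itself.\<close>

lemma residual_decomposition: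
  fixes x :: 'a
  assumes t: "t > 0"
  defines "J \<equiv> heat_jet (x, 1 + t)"
  shows "W (x, t) - M *\<^sub>R J
    = (\<integral>\<xi>. \<phi> \<xi> *\<^sub>R (heat_jet ((x, t) - (\<xi>, 0)) - J) \<partial>lborel)
      + (\<integral>b. (if snd b \<le> t / 2 then F b else 0) *\<^sub>R (heat_jet ((x, t) - b) - J) \<partial>lborel)
      + (duh.potential (\<lambda>b. if t / 2 < snd b then F b else 0) (x, t)
         - (\<integral>b. (if t / 2 < snd b then F b else 0) \<partial>lborel) *\<^sub>R J)"
proof -
  let ?F1 = "\<lambda>b. if snd b \<le> t / 2 then F b else 0" and ?F2 = "\<lambda>b. if t / 2 < snd b then F b else 0"
  have m: "?F1 \<in> borel_measurable borel" "?F2 \<in> borel_measurable borel" by (rule F_split_measurable)+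
  have F12: "F b = ?F1 b + ?F2 b" for b by auto
  have b1: "\<bar>?F1 b\<bar> \<le> K * B * \<rho> b" and b2: "\<bar>?F2 b\<bar> \<le> K * B * \<rho> b" for b
    using F_le_\<rho>[of b] KB_pos \<rho>_ge_0[of b] by auto
  have i1: "integrable lborel ?F1" and i2: "integrable lborel ?F2"
    using m by (auto intro!: Bochner_Integration.integrable_bound[OF F_integrable])
  have j0: "integrable lborel (\<lambda>\<xi>. \<phi> \<xi> *\<^sub>R heat_jet ((x, t) - (\<xi>, 0)))"
    using t by (intro init.jet_integrable[where L = 1]) auto
  have j1: "integrable lborel (\<lambda>b. ?F1 b *\<^sub>R heat_jet ((x, t) - b))"
    using t m by (intro duh.jet_integrable[OF _ _ b1]) auto
  have j2: "integrable lborel (\<lambda>b. ?F2 b *\<^sub>R heat_jet ((x, t) - b))"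
    using t m by (intro duh.jet_integrable[OF _ _ b2]) auto
  have pF: "duh.potential F (x, t) = (\<integral>b. ?F1 b *\<^sub>R heat_jet ((x, t) - b) \<partial>lborel) + duh.potential ?F2 (x, t)"
  proof -
    have "duh.potential F (x, t) = (\<integral>b. ?F1 b *\<^sub>R heat_jet ((x, t) - b) + ?F2 b *\<^sub>R heat_jet ((x, t) - b) \<partial>lborel)"
      unfolding duh.potential_def by (intro Bochner_Integration.integral_cong) auto
    also have "\<dots> = (\<integral>b. ?F1 b *\<^sub>R heat_jet ((x, t) - b) \<partial>lborel) + (\<integral>b. ?F2 b *\<^sub>R heat_jet ((x, t) - b) \<partial>lborel)"
      by (rule Bochner_Integration.integral_add[OF j1 j2])
    finally show ?thesis by (simp only: duh.potential_def)
  qed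
  have mF: "(\<integral>b. F b \<partial>lborel) = (\<integral>b. ?F1 b \<partial>lborel) + (\<integral>b. ?F2 b \<partial>lborel)"
  proof -
    have "(\<integral>b. F b \<partial>lborel) = (\<integral>b. ?F1 b + ?F2 b \<partial>lborel)"
      by (intro Bochner_Integration.integral_cong) auto
    also have "\<dots> = (\<integral>b. ?F1 b \<partial>lborel) + (\<integral>b. ?F2 b \<partial>lborel)"
      by (rule Bochner_Integration.integral_add[OF i1 i2])
    finally show ?thesis .
  qed
  have d0: "(\<integral>\<xi>. \<phi> \<xi> *\<^sub>R (heat_jet ((x, t) - (\<xi>, 0)) - J) \<partial>lborel) = init.potential \<phi> (x, t) - (\<integral>\<xi>. \<phi> \<xi> \<partial>lborel) *\<^sub>R J"
  proof -
    have "(\<integral>\<xi>. \<phi> \<xi> *\<^sub>R (heat_jet ((x, t) - (\<xi>, 0)) - J) \<partial>lborel) = (\<integral>\<xi>. \<phi> \<xi> *\<^sub>R heat_jet ((x, t) - (\<xi>, 0)) \<partial>lborel) - (\<integral>\<xi>. \<phi> \<xi> *\<^sub>R J \<partial>lborel)"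
      unfolding scaleR_diff_right by (rule Bochner_Integration.integral_diff[OF j0]) (simp add: phi_integrable)
    then show ?thesis using phi_integrable by (simp add: init.potential_def)
  qed
  have d1: "(\<integral>b. ?F1 b *\<^sub>R (heat_jet ((x, t) - b) - J) \<partial>lborel) = (\<integral>b. ?F1 b *\<^sub>R heat_jet ((x, t) - b) \<partial>lborel) - (\<integral>b. ?F1 b \<partial>lborel) *\<^sub>R J"
  proof -
    have "(\<integral>b. ?F1 b *\<^sub>R (heat_jet ((x, t) - b) - J) \<partial>lborel) = (\<integral>b. ?F1 b *\<^sub>R heat_jet ((x, t) - b) \<partial>lborel) - (\<integral>b. ?F1 b *\<^sub>R J \<partial>lborel)"
      unfolding scaleR_diff_right by (rule Bochner_Integration.integral_diff[OF j1]) (intro integrable_scaleR_left i1)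
    also have "(\<integral>b. ?F1 b *\<^sub>R J \<partial>lborel) = (\<integral>b. ?F1 b \<partial>lborel) *\<^sub>R J"
      by (rule integral_scaleR_left) (rule i1)
    finally show ?thesis .
  qed
  show ?thesis
    unfolding W_eq[OF t] d0 d1 pF M_def mF by (simp add: algebra_simps)
qed

end

lemma ereal_tendsto_zeroI:
  fixes g :: "'b \<Rightarrow> ereal"
  assumes "\<And>e. e > 0 \<Longrightarrow> eventually (\<lambda>t. 0 \<le> g t \<and> g t \<le> ereal e) F"
  shows "(g \<longlongrightarrow> 0) F"
proof (rule order_tendstoI)
  fix a :: ereal assume "a < 0"
  with assms[of 1] show "eventually (\<lambda>t. a < g t) F"
    by (auto elim!: eventually_mono)
next
  fix a :: ereal assume "0 < a"
  then obtain e where e: "0 < ereal e" "ereal e < a" using ereal_dense2 by blast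
  then have "e > 0" by simp
  from assms[OF this] show "eventually (\<lambda>t. g t < a) F"
    using e(2) by (auto elim!: eventually_mono)
qed

lemma grad_eq:
  assumes "(h has_derivative (\<lambda>v. D \<bullet> v)) (at x)"
  shows "grad h x = D"
  unfolding grad_def
proof (rule the_equality)
  fix D' assume "(h has_derivative (\<lambda>v. D' \<bullet> v)) (at x)"
  from has_derivative_unique[OF this assms] have "D' \<bullet> v = D \<bullet> v" for v by (rule fun_cong)
  then show "D' = D" using vector_eq_rdot by blast
qed (rule assms)

lemma grad_gauss:
  fixes x :: "'a::euclidean_space"
  assumes "t > 0"
  shows "grad (\<lambda>y::'a. gauss y t) x = snd (heat_jet (x, 1 + t))"
proof (rule grad_eq)
  show "((\<lambda>y::'a. gauss y t) has_derivative (\<lambda>v. snd (heat_jet (x, 1 + t)) \<bullet> v)) (at x)"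
    using has_derivative_heat_jet[of "1 + t" x] assms by (simp add: heat_jet_def gauss_def)
qed

context mild_solution
begin

section \<open>Decay of u - M g\<close>

definition residual :: "real \<Rightarrow> 'a \<Rightarrow> real \<times> 'a" where
  "residual t x = W (x, t) - M *\<^sub>R heat_jet (x, 1 + t)"

lemma residual_measurable: "residual t \<in> borel_measurable borel"
proof -
  have "(\<lambda>x::'a. (x, 1 + t)) \<in> borel_measurable borel"
    by (intro borel_measurable_continuous_onI continuous_intros)
  from measurable_compose[OF this borel_measurable_heat_jet]
  show ?thesis
    unfolding residual_def[abs_def]
    by (intro borel_measurable_diff W_slice_measurable borel_measurable_scaleR borel_measurable_const)
qed

lemma late_source_tendsto_zero: "((\<lambda>t. \<integral>b. \<bar>if t / 2 < snd b then F b else 0\<bar> \<partial>lborel) \<longlongrightarrow> 0) at_top"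
proof -
  have "((\<lambda>t. \<integral>b. \<bar>if t / 2 < snd b then F b else 0\<bar> \<partial>lborel) \<longlongrightarrow> (\<integral>(b::'a \<times> real). 0 \<partial>lborel)) at_top"
  proof (rule integral_dominated_convergence_at_top[where w = "\<lambda>b. \<bar>F b\<bar>"])
    show "(\<lambda>b. \<bar>if t / 2 < snd b then F b else 0\<bar>) \<in> borel_measurable lborel" for t
      using borel_measurable_abs[OF F_split_measurable(2)[of "t / 2"]] by simp
    show "AE b in lborel. ((\<lambda>t. \<bar>if t / 2 < snd b then F b else 0\<bar>) \<longlongrightarrow> 0) at_top"
    proof (rule AE_I2)
      fix b :: "'a \<times> real"
      have "eventually (\<lambda>t. 2 * snd b < t) at_top" by (rule eventually_gt_at_top)
      then have "eventually (\<lambda>t. 0 = \<bar>if t / 2 < snd b then F b else 0\<bar>) at_top"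
        by eventually_elim simp
      then show "((\<lambda>t. \<bar>if t / 2 < snd b then F b else 0\<bar>) \<longlongrightarrow> 0) at_top"
        by (rule Lim_transform_eventually[OF tendsto_const])
    qed
    show "integrable lborel (\<lambda>b. \<bar>F b\<bar>)" using F_integrable by simp
    show "\<forall>\<^sub>F t in at_top. AE b in lborel. norm \<bar>if t / 2 < snd b then F b else 0\<bar> \<le> \<bar>F b\<bar>"
      by (intro always_eventually allI AE_I2) auto
  qed simp
  then show ?thesis by simp
qed

text \<open>Each of the four terms gets e / 4: early parts of the datum and of the nonlinearity by
  \<open>controlled_early_sources\<close>, the late potential by its decaying factor, and the late
  share of \<open>M\<close> because \<open>F\<close> is integrable.\<close>

lemma residual_controlled:
  assumes e: "e > 0"
  shows "eventually (\<lambda>t. controlled t (ennreal e) (\<lambda>x. ennreal (jet_norm t (residual t x)))) at_top"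
proof -
  let ?c = "2 powr (real DIM('a) / 2) :: real"
  have e4: "e / 4 > 0" using e by simp
  define lam where "lam t = 8 * ?c * (K * B) * (1 + sqrt (t / 2)) powr (2 - 2 * A)" for t
  define tail where "tail t = (\<integral>b. \<bar>if t / 2 < snd b then F b else 0\<bar> \<partial>lborel)" for t
  have "filterlim (\<lambda>t::real. 1 + sqrt (t / 2)) at_top at_top" by real_asymp
  from tendsto_neg_powr[OF _ this, of "2 - 2 * A"] A
  have "((\<lambda>t. (1 + sqrt (t / 2)) powr (2 - 2 * A)) \<longlongrightarrow> 0) at_top" by simp
  from tendsto_mult_right[OF tendsto_mult_left[OF this, of "8 * ?c * (K * B)"], of mass]
  have "((\<lambda>t. lam t * mass) \<longlongrightarrow> 0) at_top" by (simp add: lam_def)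
  then have ev1: "eventually (\<lambda>t. lam t * mass < e / 4) at_top"
    using e4 by (rule order_tendstoD(2))
  from tendsto_mult_left[OF late_source_tendsto_zero, of "2 * ?c"]
  have "((\<lambda>t. 2 * ?c * tail t) \<longlongrightarrow> 0) at_top" by (simp add: tail_def)
  then have ev2: "eventually (\<lambda>t. 2 * ?c * tail t < e / 4) at_top"
    using e4 by (rule order_tendstoD(2))
  \<comment> \<open>The datum sits at time 0, so for t > 0 the restriction to early sources is
    vacuous; it only matches the form of the general lemma.\<close>
  have ev3: "eventually (\<lambda>t. controlled t (ennreal (e / 4)) (\<lambda>x. \<integral>\<^sup>+\<xi>. ennreal (if snd (\<xi>, 0::real) \<le> t / 2 then \<bar>\<phi> \<xi>\<bar> else 0)
      * ennreal (jet_norm t (heat_jet ((x, t) - (\<xi>, 0)) - heat_jet (x, 1 + t))) \<partial>lborel)) at_top"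
    using phi_integrable e4 by (intro controlled_early_sources init.sigma_finite_measure_axioms) auto
  have ev4: "eventually (\<lambda>t. controlled t (ennreal (e / 4)) (\<lambda>x. \<integral>\<^sup>+b. ennreal (if snd b \<le> t / 2 then \<bar>F b\<bar> else 0)
      * ennreal (jet_norm t (heat_jet ((x, t) - b) - heat_jet (x, 1 + t))) \<partial>lborel)) at_top"
  proof (rule controlled_early_sources[OF duh.sigma_finite_measure_axioms])
    show "0 \<le> snd b" if "\<bar>F b\<bar> \<noteq> 0" for b
      using that F_nonpos_time[of b] by (cases "snd b \<le> 0") auto
  qed (use F_integrable e4 in auto)
  show ?thesis
    using ev1 ev2 ev3 ev4 eventually_gt_at_top[of 0]
  proof eventually_elim
    case (elim t)
    then have t: "t > 0" by simp
    let ?F1 = "\<lambda>b. if snd b \<le> t / 2 then F b else 0" and ?F2 = "\<lambda>b. if t / 2 < snd b then F b else 0"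
    let ?h1 = "\<lambda>x. \<integral>\<^sup>+\<xi>. ennreal (if snd (\<xi>, 0::real) \<le> t / 2 then \<bar>\<phi> \<xi>\<bar> else 0)
      * ennreal (jet_norm t (heat_jet ((x, t) - (\<xi>, 0)) - heat_jet (x, 1 + t))) \<partial>lborel"
    let ?h2 = "\<lambda>x. \<integral>\<^sup>+b. ennreal (if snd b \<le> t / 2 then \<bar>F b\<bar> else 0)
      * ennreal (jet_norm t (heat_jet ((x, t) - b) - heat_jet (x, 1 + t))) \<partial>lborel"
    let ?h3 = "\<lambda>x. ennreal (lam t) * ennreal (H (x, t))"
    let ?h4 = "\<lambda>x. ennreal (2 * ?c * tail t) * ennreal (heat_kernel (x::'a) (2 * (1 + t)))"
    have lam0: "0 \<le> lam t" using KB_pos by (simp add: lam_def)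
    have tail0: "0 \<le> tail t" unfolding tail_def by simp
    have "controlled t (ennreal (lam t) * ennreal mass) ?h3"
      by (intro controlled_cmult controlled_H t)
    then have c3: "controlled t (ennreal (e / 4)) ?h3"
      using elim(1) lam0 mass_nonneg by (elim controlled_weaken) (simp add: ennreal_mult[symmetric] ennreal_leI)
    have "controlled t (ennreal (2 * ?c * tail t) * 1) ?h4"
      by (intro controlled_cmult controlled_late_kernel t)
    then have c4: "controlled t (ennreal (e / 4)) ?h4"
      using elim(2) by (elim controlled_weaken) (simp add: ennreal_leI)
    have sum: "controlled t (ennreal (e / 4) + ennreal (e / 4) + ennreal (e / 4) + ennreal (e / 4)) (\<lambda>x. ?h1 x + ?h2 x + ?h3 x + ?h4 x)"
      by (intro controlled_add elim(3,4) c3 c4)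
    show ?case
    proof (rule controlled_mono[OF sum])
      show "(\<lambda>x. ennreal (jet_norm t (residual t x))) \<in> borel_measurable borel"
        by (rule measurable_compose[OF measurable_compose[OF residual_measurable jet_norm_measurable] measurable_ennreal])
      show "ennreal (e / 4) + ennreal (e / 4) + ennreal (e / 4) + ennreal (e / 4) \<le> ennreal e"
        using e by (simp add: ennreal_plus[symmetric] del: ennreal_plus)
      fix x :: 'a
      let ?J = "heat_jet (x, 1 + t)"
      let ?a = "\<integral>\<xi>. \<phi> \<xi> *\<^sub>R (heat_jet ((x, t) - (\<xi>, 0)) - ?J) \<partial>lborel"
      let ?b = "\<integral>b. ?F1 b *\<^sub>R (heat_jet ((x, t) - b) - ?J) \<partial>lborel"
      let ?m = "\<integral>b. ?F2 b \<partial>lborel"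
      have "jet_norm t (residual t x) \<le> jet_norm t ?a + jet_norm t ?b + (jet_norm t (duh.potential ?F2 (x, t)) + jet_norm t (?m *\<^sub>R ?J))"
        unfolding residual_def residual_decomposition[OF t]
        using t by (intro order_trans[OF jet_norm_triangle] add_mono jet_norm_triangle jet_norm_diff) auto
      also have "\<dots> \<le> jet_norm t ?a + jet_norm t ?b + (lam t * H (x, t) + 2 * ?c * tail t * heat_kernel x (2 * (1 + t)))"
      proof (intro add_mono order_refl)
        show "jet_norm t (duh.potential ?F2 (x, t)) \<le> lam t * H (x, t)"
          unfolding lam_def by (rule late_potential_le[OF t])
        have "jet_norm t (?m *\<^sub>R ?J) = \<bar>?m\<bar> * jet_norm t ?J" by (rule jet_norm_scaleR)
        also have "\<dots> \<le> tail t * (2 * ?c * heat_kernel x (2 * (1 + t)))"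
          unfolding tail_def using jet_norm_heat_jet_late[OF t, of x] jet_norm_nonneg[of t ?J] t
          by (intro mult_mono integral_abs_bound) auto
        finally show "jet_norm t (?m *\<^sub>R ?J) \<le> 2 * ?c * tail t * heat_kernel x (2 * (1 + t))"
          by (simp add: mult_ac)
      qed
      finally have "ennreal (jet_norm t (residual t x)) \<le> ennreal (jet_norm t ?a + jet_norm t ?b + (lam t * H (x, t) + 2 * ?c * tail t * heat_kernel x (2 * (1 + t))))"
        by (rule ennreal_leI)
      also have "\<dots> = ennreal (jet_norm t ?a) + ennreal (jet_norm t ?b) + (?h3 x + ?h4 x)"
        using t lam0 tail0
        by (simp add: ennreal_plus ennreal_mult jet_norm_nonneg H_nonneg heat_kernel_nonneg)
      also have "ennreal (jet_norm t ?a) \<le> ?h1 x"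
      proof -
        have "ennreal (jet_norm t ?a) \<le> (\<integral>\<^sup>+\<xi>. ennreal (jet_norm t (\<phi> \<xi> *\<^sub>R (heat_jet ((x, t) - (\<xi>, 0)) - ?J))) \<partial>lborel)"
          using t by (intro jet_norm_integral_le) auto
        also have "\<dots> = ?h1 x"
          using t by (intro nn_integral_cong) (simp add: jet_norm_scaleR ennreal_mult jet_norm_nonneg)
        finally show ?thesis .
      qed
      also have "ennreal (jet_norm t ?b) \<le> ?h2 x"
      proof -
        have "(\<lambda>b. heat_jet ((x, t) - b) - ?J) \<in> borel_measurable lborel" by measurable
        then have "ennreal (jet_norm t ?b) \<le> (\<integral>\<^sup>+b. ennreal (jet_norm t (?F1 b *\<^sub>R (heat_jet ((x, t) - b) - ?J))) \<partial>lborel)"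
          using t F_split_measurable(1)[of "t / 2"] by (intro jet_norm_integral_le borel_measurable_scaleR) auto
        also have "\<dots> = ?h2 x"
          using t by (intro nn_integral_cong) (simp add: jet_norm_scaleR ennreal_mult jet_norm_nonneg)
        finally show ?thesis .
      qed
      finally show "ennreal (jet_norm t (residual t x)) \<le> ?h1 x + ?h2 x + ?h3 x + ?h4 x"
        by (simp add: add.assoc)
    qed
  qed
qed

lemma Lp_norm_residual_limits:
  assumes q: "1 \<le> q"
  shows "((\<lambda>t. ereal (t powr (real DIM('a) / 2 * (1 - inv_exp q))) * Lp_norm q (\<lambda>x. fst (residual t x))) \<longlongrightarrow> 0) at_top"
    and "((\<lambda>t. ereal (t powr (real DIM('a) / 2 * (1 - inv_exp q) + 1/2)) * Lp_norm q (\<lambda>x. snd (residual t x))) \<longlongrightarrow> 0) at_top"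
proof -
  define a where "a = real DIM('a) / 2 * (1 - inv_exp q)"
  have m: "(\<lambda>x. fst (residual t x)) \<in> borel_measurable borel" "(\<lambda>x. snd (residual t x)) \<in> borel_measurable borel" for t
    by (intro measurable_compose[OF residual_measurable borel_measurable_fst_borel] measurable_compose[OF residual_measurable borel_measurable_snd_borel])+
  show "((\<lambda>t. ereal (t powr (real DIM('a) / 2 * (1 - inv_exp q))) * Lp_norm q (\<lambda>x. fst (residual t x))) \<longlongrightarrow> 0) at_top"
    unfolding a_def[symmetric]
  proof (rule ereal_tendsto_zeroI)
    fix e :: real assume e: "e > 0"
    show "\<forall>\<^sub>F t in at_top. 0 \<le> ereal (t powr a) * Lp_norm q (\<lambda>x. fst (residual t x)) \<and> ereal (t powr a) * Lp_norm q (\<lambda>x. fst (residual t x)) \<le> ereal e"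
      using residual_controlled[OF e] eventually_gt_at_top[of 0]
    proof eventually_elim
      case (elim t)
      have "Lp_norm q (\<lambda>x. fst (residual t x)) \<le> ereal (e * t powr (- a))"
        unfolding a_def using controlled_jet_consequences(5)[OF elim(1) residual_measurable elim(2)] e q by simp
      then have "ereal (t powr a) * Lp_norm q (\<lambda>x. fst (residual t x)) \<le> ereal (t powr a) * ereal (e * t powr (- a))"
        by (intro ereal_mult_left_mono) auto
      also have "\<dots> = ereal e" using elim(2) by (simp add: powr_minus)
      finally show ?case using Lp_norm_nonneg[OF m(1)] by simp
    qed
  qed
  show "((\<lambda>t. ereal (t powr (real DIM('a) / 2 * (1 - inv_exp q) + 1/2)) * Lp_norm q (\<lambda>x. snd (residual t x))) \<longlongrightarrow> 0) at_top"
    unfolding a_def[symmetric]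
  proof (rule ereal_tendsto_zeroI)
    fix e :: real assume e: "e > 0"
    show "\<forall>\<^sub>F t in at_top. 0 \<le> ereal (t powr (a + 1/2)) * Lp_norm q (\<lambda>x. snd (residual t x)) \<and> ereal (t powr (a + 1/2)) * Lp_norm q (\<lambda>x. snd (residual t x)) \<le> ereal e"
      using residual_controlled[OF e] eventually_gt_at_top[of 0]
    proof eventually_elim
      case (elim t)
      have "Lp_norm q (\<lambda>x. snd (residual t x)) \<le> ereal (e / sqrt t * t powr (- a))"
        unfolding a_def using controlled_jet_consequences(6)[OF elim(1) residual_measurable elim(2)] e q by simp
      then have "ereal (t powr (a + 1/2)) * Lp_norm q (\<lambda>x. snd (residual t x)) \<le> ereal (t powr (a + 1/2)) * ereal (e / sqrt t * t powr (- a))"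
        by (intro ereal_mult_left_mono) auto
      also have "\<dots> = ereal e" using elim(2) by (simp add: powr_minus powr_add powr_half_sqrt)
      finally show ?case using Lp_norm_nonneg[OF m(2)] by simp
    qed
  qed
qed

lemma residual_eq:
  "t > 0 \<Longrightarrow> fst (residual t x) = fst (W (x, t)) - M * gauss x t"
  "t > 0 \<Longrightarrow> snd (residual t x) = snd (W (x, t)) - M *\<^sub>R grad (\<lambda>y. gauss y t) x"
  by (simp_all add: residual_def grad_gauss) (simp add: heat_jet_def gauss_def)

text \<open>\<open>gauss\<close> has unit mass, so the integral of u minus M is the integral of the
  value part of the residual, and the L^1 bound of \<open>controlled\<close> applies.\<close>

lemma total_mass_limit: "((\<lambda>t. \<integral>x. fst (W (x, t)) \<partial>lborel) \<longlongrightarrow> M) at_top"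
proof (rule tendstoI)
  fix e :: real assume e: "e > 0"
  then have e2: "e / 2 > 0" by simp
  show "\<forall>\<^sub>F t in at_top. dist (\<integral>x. fst (W (x, t)) \<partial>lborel) M < e"
    using residual_controlled[OF e2] eventually_gt_at_top[of 0]
  proof eventually_elim
    case (elim t)
    note R = controlled_jet_consequences[OF elim(1) residual_measurable elim(2)]
    have g: "has_bochner_integral lborel (\<lambda>x::'a. gauss x t) 1"
      using nn_integral_heat_kernel[of "1 + t" "0::'a"] elim(2)
      by (intro has_bochner_integral_nn_integral) (auto simp: gauss_def heat_kernel_nonneg)
    have "integrable lborel (\<lambda>x. fst (W (x, t)))"
      using controlled_jet_consequences(1)[OF controlled_W[OF elim(2)] W_slice_measurable elim(2)] B_pos mass_nonneg by simp
    then have "(\<integral>x. fst (residual t x) \<partial>lborel) = (\<integral>x. fst (W (x, t)) \<partial>lborel) - M"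
      using g unfolding residual_eq[OF elim(2)]
      by (subst Bochner_Integration.integral_diff) (auto simp: has_bochner_integral_iff)
    moreover have "\<bar>\<integral>x. fst (residual t x) \<partial>lborel\<bar> \<le> e / 2"
      using R(2) e2 by (intro order_trans[OF integral_abs_bound]) auto
    ultimately show ?case using e by (simp add: dist_real_def)
  qed
qed

section \<open>Bounds uniform in time, regularity and the integral equation\<close>

lemma Lp_norm_bounded:
  assumes q: "1 \<le> q"
  shows "(SUP t\<in>{0<..}. ereal (t powr (real DIM('a) / 2 * (1 - inv_exp q)))
    * (Lp_norm q (\<lambda>x. fst (W (x, t))) + ereal (t powr (1/2)) * Lp_norm q (\<lambda>x. snd (W (x, t))))) < \<infinity>"
proof -
  define a where "a = real DIM('a) / 2 * (1 - inv_exp q)"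
  define E where "E = 2 * B * mass"
  have E: "0 \<le> E" using B_pos mass_nonneg by (simp add: E_def)
  have "(SUP t\<in>{0<..}. ereal (t powr a) * (Lp_norm q (\<lambda>x. fst (W (x, t))) + ereal (t powr (1/2)) * Lp_norm q (\<lambda>x. snd (W (x, t))))) \<le> ereal (2 * E)"
  proof (rule SUP_least)
    fix t :: real assume "t \<in> {0<..}"
    then have t: "t > 0" by simp
    have c: "controlled t (ennreal E) (\<lambda>x. ennreal (jet_norm t (W (x, t))))"
      unfolding E_def by (rule controlled_W[OF t])
    have "ereal (t powr a) * (Lp_norm q (\<lambda>x. fst (W (x, t))) + ereal (t powr (1/2)) * Lp_norm q (\<lambda>x. snd (W (x, t))))
      \<le> ereal (t powr a) * (ereal (E * t powr (- a)) + ereal (t powr (1/2)) * ereal (E / sqrt t * t powr (- a)))"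
      unfolding a_def
      using controlled_jet_consequences(5,6)[OF c W_slice_measurable t E q]
      by (intro ereal_mult_left_mono add_mono) auto
    also have "\<dots> = ereal (2 * E)"
      using t by (simp add: powr_minus powr_half_sqrt field_simps)
    finally show "ereal (t powr a) * (Lp_norm q (\<lambda>x. fst (W (x, t))) + ereal (t powr (1/2)) * Lp_norm q (\<lambda>x. snd (W (x, t)))) \<le> ereal (2 * E)" .
  qed
  also have "\<dots> < \<infinity>" by simp
  finally show ?thesis unfolding a_def .
qed

text \<open>Value and sqrt t times gradient are each below 2 B \<open>H\<close>, which adds up to 4
  B; the constant \<open>D\<close> and the growth (1 + t)^(l / 2) come from
  \<open>wnorm_H_le\<close>.\<close>

lemma wnorm_bounded:
  assumes l: "0 \<le> l" and fin: "wnorm l \<phi> < \<infinity>"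
  shows "(SUP t\<in>{0<..}. ennreal ((1 + t) powr (- l / 2))
    * (wnorm l (\<lambda>x. fst (W (x, t))) + ennreal (t powr (1/2)) * wnorm l (\<lambda>x. snd (W (x, t))))) < \<infinity>"
proof -
  define D where "D = 2 powr (l / 2) * exp (4 * l\<^sup>2) * 2 powr (real DIM('a) / 2)"
  have D: "0 \<le> D" by (simp add: D_def)
  have "(SUP t\<in>{0<..}. ennreal ((1 + t) powr (- l / 2))
    * (wnorm l (\<lambda>x. fst (W (x, t))) + ennreal (t powr (1/2)) * wnorm l (\<lambda>x. snd (W (x, t))))) \<le> ennreal (4 * B * D) * wnorm l \<phi>"
  proof (rule SUP_least)
    fix t :: real assume "t \<in> {0<..}"
    then have t: "t > 0" by simp
    define Q where "Q = (\<integral>\<^sup>+x. ennreal ((1 + norm x) powr l * H (x, t)) \<partial>lborel)"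
    have Q: "(\<integral>\<^sup>+x. ennreal ((1 + norm x) powr l * (2 * B * H (x, t))) \<partial>lborel) = ennreal (2 * B) * Q"
    proof -
      have "(\<integral>\<^sup>+x. ennreal ((1 + norm x) powr l * (2 * B * H (x, t))) \<partial>lborel) = (\<integral>\<^sup>+x. ennreal (2 * B) * ennreal ((1 + norm x) powr l * H (x, t)) \<partial>lborel)"
      proof (rule nn_integral_cong)
        fix x
        have "(1 + norm x) powr l * (2 * B * H (x, t)) = 2 * B * ((1 + norm x) powr l * H (x, t))" by simp
        also have "ennreal \<dots> = ennreal (2 * B) * ennreal ((1 + norm x) powr l * H (x, t))"
          using B_pos by (intro ennreal_mult) (auto simp: H_nonneg)
        finally show "ennreal ((1 + norm x) powr l * (2 * B * H (x, t))) = ennreal (2 * B) * ennreal ((1 + norm x) powr l * H (x, t))" .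
      qed
      also have "\<dots> = ennreal (2 * B) * Q"
        unfolding Q_def by (rule nn_integral_cmult) measurable
      finally show ?thesis .
    qed
    have jf: "\<bar>fst (W (x, t))\<bar> \<le> 2 * B * H (x, t)" and js: "sqrt t * norm (snd (W (x, t))) \<le> 2 * B * H (x, t)" for x
      using jet_norm_W_le[OF t, of x] t by (auto simp: jet_norm_def intro: order_trans[rotated])
    have 1: "wnorm l (\<lambda>x. fst (W (x, t))) \<le> ennreal (2 * B) * Q"
      unfolding Q[symmetric] wnorm_def using jf by (intro nn_integral_mono ennreal_leI mult_left_mono) auto
    have sm: "(\<lambda>x. snd (W (x, t))) \<in> borel_measurable borel"
      by (rule measurable_compose[OF W_slice_measurable borel_measurable_snd_borel])
    have "ennreal (t powr (1/2)) * wnorm l (\<lambda>x. snd (W (x, t))) = (\<integral>\<^sup>+x. ennreal (t powr (1/2)) * ennreal ((1 + norm x) powr l * norm (snd (W (x, t)))) \<partial>lborel)"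
    proof -
      have "(\<integral>\<^sup>+x. c * ennreal ((1 + norm x) powr l * v x) \<partial>lborel) = c * (\<integral>\<^sup>+x. ennreal ((1 + norm x) powr l * v x) \<partial>lborel)"
        if [measurable]: "v \<in> borel_measurable borel" for v :: "'a \<Rightarrow> real" and c
        by (rule nn_integral_cmult) measurable
      from this[OF measurable_compose[OF sm borel_measurable_norm]] show ?thesis
        unfolding wnorm_def by simp
    qed
    also have "\<dots> \<le> (\<integral>\<^sup>+x. ennreal ((1 + norm x) powr l * (2 * B * H (x, t))) \<partial>lborel)"
    proof (rule nn_integral_mono)
      fix x
      have "ennreal (t powr (1/2)) * ennreal ((1 + norm x) powr l * norm (snd (W (x, t)))) = ennreal (t powr (1/2) * ((1 + norm x) powr l * norm (snd (W (x, t)))))"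
        by (rule ennreal_mult[symmetric]) auto
      also have "t powr (1/2) * ((1 + norm x) powr l * norm (snd (W (x, t)))) = (1 + norm x) powr l * (sqrt t * norm (snd (W (x, t))))"
        using t by (simp add: powr_half_sqrt)
      finally show "ennreal (t powr (1/2)) * ennreal ((1 + norm x) powr l * norm (snd (W (x, t)))) \<le> ennreal ((1 + norm x) powr l * (2 * B * H (x, t)))"
        using js[of x] by (simp add: ennreal_leI mult_left_mono)
    qed
    finally have 2: "ennreal (t powr (1/2)) * wnorm l (\<lambda>x. snd (W (x, t))) \<le> ennreal (2 * B) * Q"
      unfolding Q .
    have QD: "Q \<le> ennreal (D * (1 + t) powr (l / 2)) * wnorm l \<phi>"
      unfolding Q_def D_def by (rule wnorm_H_le[OF t l])
    have "ennreal ((1 + t) powr (- l / 2)) * (wnorm l (\<lambda>x. fst (W (x, t))) + ennreal (t powr (1/2)) * wnorm l (\<lambda>x. snd (W (x, t))))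
      \<le> ennreal ((1 + t) powr (- l / 2)) * (ennreal (2 * B) * Q + ennreal (2 * B) * Q)"
      by (intro mult_left_mono add_mono 1 2) auto
    also have "\<dots> = ennreal ((1 + t) powr (- l / 2)) * (ennreal (4 * B) * Q)"
      using B_pos by (simp add: distrib_right[symmetric] ennreal_plus[symmetric] del: ennreal_plus)
    also have "\<dots> \<le> ennreal ((1 + t) powr (- l / 2)) * (ennreal (4 * B) * (ennreal (D * (1 + t) powr (l / 2)) * wnorm l \<phi>))"
      by (intro mult_left_mono QD) auto
    also have "\<dots> = (ennreal ((1 + t) powr (- l / 2)) * ennreal (4 * B) * ennreal (D * (1 + t) powr (l / 2))) * wnorm l \<phi>"
      by (simp add: mult.assoc)
    also have "ennreal ((1 + t) powr (- l / 2)) * ennreal (4 * B) * ennreal (D * (1 + t) powr (l / 2)) = ennreal (4 * B * D)"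
    proof -
      have "(1 + t) powr (- l / 2) * (4 * B) * (D * (1 + t) powr (l / 2)) = 4 * B * D"
        using t by (simp add: powr_minus field_simps)
      moreover have "ennreal ((1 + t) powr (- l / 2)) * ennreal (4 * B) * ennreal (D * (1 + t) powr (l / 2)) = ennreal ((1 + t) powr (- l / 2) * (4 * B) * (D * (1 + t) powr (l / 2)))"
        using B_pos D by (simp only: ennreal_mult mult_nonneg_nonneg powr_ge_zero less_imp_le zero_le_numeral)
      ultimately show ?thesis by (simp only:)
    qed
    finally show "ennreal ((1 + t) powr (- l / 2)) * (wnorm l (\<lambda>x. fst (W (x, t))) + ennreal (t powr (1/2)) * wnorm l (\<lambda>x. snd (W (x, t)))) \<le> ennreal (4 * B * D) * wnorm l \<phi>" .
  qed
  also have "\<dots> < \<infinity>" using fin by (simp add: ennreal_mult_less_top)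
  finally show ?thesis .
qed

lemma continuous_on_W: "continuous_on {z. snd z > 0} W"
proof -
  have "continuous_on {z. snd z > 0} (\<lambda>z. init.potential \<phi> z + duh.potential F z)"
    by (intro continuous_on_add init.continuous_on_potential[where L = 1] duh.continuous_on_potential[where L = "K * B"])
      (auto simp: F_le_\<rho>)
  moreover have "init.potential \<phi> z + duh.potential F z = W z" if "z \<in> {z. snd z > 0}" for z
    using W_eq[of "snd z" "fst z"] that by simp
  ultimately show ?thesis by (rule continuous_on_eq)
qed

lemma has_derivative_W:
  assumes t: "t > 0"
  shows "((\<lambda>y. fst (W (y, t))) has_derivative (\<lambda>v. snd (W (x, t)) \<bullet> v)) (at x)"
proof -
  have "((\<lambda>y. fst (init.potential \<phi> (y, t)) + fst (duh.potential F (y, t))) has_derivative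
    (\<lambda>v. snd (init.potential \<phi> (x, t)) \<bullet> v + snd (duh.potential F (x, t)) \<bullet> v)) (at x)"
    by (intro has_derivative_add init.has_derivative_potential[OF t, where L = 1] duh.has_derivative_potential[OF t, where L = "K * B"])
      (auto simp: F_le_\<rho>)
  then show ?thesis
    by (simp add: W_eq[OF t] inner_add_left)
qed

lemma indicator_F:
  "indicator (UNIV \<times> {0<..}) b *\<^sub>R f (fst b) (snd b) (fst (W b)) (snd (W b)) = F b"
  by (cases b) (auto simp: indicator_def src_def)

lemma duhamel_formula:
  fixes x :: 'a
  assumes t: "t > 0"
  defines "g \<equiv> \<lambda>(\<xi>, s). heat_kernel (x - \<xi>) (t - s) * f \<xi> s (fst (W (\<xi>, s))) (snd (W (\<xi>, s)))"
  shows "set_integrable (lborel \<Otimes>\<^sub>M lborel) (UNIV \<times> {0<..<t}) g"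
    and "fst (W (x, t)) = (\<integral>\<xi>. heat_kernel (x - \<xi>) t * \<phi> \<xi> \<partial>lborel) + (LINT w:UNIV \<times> {0<..<t}|lborel \<Otimes>\<^sub>M lborel. g w)"
proof -
  \<comment> \<open>\<open>F\<close> vanishes for s \<le> 0 and the jet for s \<ge> t, so the
    integral over all space-time is the integral over 0 < s < t.\<close>
  have e: "indicator (UNIV \<times> {0<..<t}) b *\<^sub>R g b = fst (F b *\<^sub>R heat_jet ((x, t) - b))" for b
    by (cases b) (auto simp: indicator_def g_def src_def heat_jet_def)
  have i: "integrable lborel (\<lambda>b. F b *\<^sub>R heat_jet ((x, t) - b))"
    using t F_le_\<rho> by (intro duh.jet_integrable) auto
  from integrable_bounded_linear[OF bounded_linear_fst i]
  show "set_integrable (lborel \<Otimes>\<^sub>M lborel) (UNIV \<times> {0<..<t}) g"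
    unfolding set_integrable_def e lborel_prod .
  have i0: "integrable lborel (\<lambda>\<xi>. \<phi> \<xi> *\<^sub>R heat_jet ((x, t) - (\<xi>, 0)))"
    using t by (intro init.jet_integrable[where L = 1]) auto
  have "fst (init.potential \<phi> (x, t)) = (\<integral>\<xi>. fst (\<phi> \<xi> *\<^sub>R heat_jet ((x, t) - (\<xi>, 0))) \<partial>lborel)"
    unfolding init.potential_def by (rule integral_bounded_linear[OF bounded_linear_fst i0, symmetric])
  also have "\<dots> = (\<integral>\<xi>. heat_kernel (x - \<xi>) t * \<phi> \<xi> \<partial>lborel)"
    using t by (intro Bochner_Integration.integral_cong) (auto simp: heat_jet_def)
  finally have 1: "fst (init.potential \<phi> (x, t)) = (\<integral>\<xi>. heat_kernel (x - \<xi>) t * \<phi> \<xi> \<partial>lborel)" .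
  have "fst (duh.potential F (x, t)) = (\<integral>b. fst (F b *\<^sub>R heat_jet ((x, t) - b)) \<partial>lborel)"
    unfolding duh.potential_def by (rule integral_bounded_linear[OF bounded_linear_fst i, symmetric])
  also have "\<dots> = (LINT w:UNIV \<times> {0<..<t}|lborel \<Otimes>\<^sub>M lborel. g w)"
    unfolding set_lebesgue_integral_def e lborel_prod ..
  finally have 2: "fst (duh.potential F (x, t)) = (LINT w:UNIV \<times> {0<..<t}|lborel \<Otimes>\<^sub>M lborel. g w)" .
  show "fst (W (x, t)) = (\<integral>\<xi>. heat_kernel (x - \<xi>) t * \<phi> \<xi> \<partial>lborel) + (LINT w:UNIV \<times> {0<..<t}|lborel \<Otimes>\<^sub>M lborel. g w)"
    unfolding W_eq[OF t] fst_add 1 2 ..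
qed

lemma is_solution_W: "is_solution f \<phi> (\<lambda>x t. fst (W (x, t))) (\<lambda>x t. snd (W (x, t)))"
  unfolding is_solution_def
proof (intro conjI allI impI)
  show "(\<lambda>(x, t). fst (W (x, t))) \<in> borel_measurable (lborel \<Otimes>\<^sub>M lborel)"
    using measurable_compose[OF W_measurable borel_measurable_fst_borel] by (simp add: case_prod_beta' lborel_prod)
  show "(\<lambda>(x, t). snd (W (x, t))) \<in> borel_measurable (lborel \<Otimes>\<^sub>M lborel)"
    using measurable_compose[OF W_measurable borel_measurable_snd_borel] by (simp add: case_prod_beta' lborel_prod)
  have E: "0 \<le> 2 * B * mass" using B_pos mass_nonneg by simp
  note cons = controlled_jet_consequences[OF controlled_W W_slice_measurable _ E]
  show "integrable lborel (\<lambda>x. fst (W (x, t)))" if "t > 0" for t by (rule cons(1)[OF that that])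
  show "integrable lborel (\<lambda>x. snd (W (x, t)))" if "t > 0" for t by (rule cons(3)[OF that that])
  show "((\<lambda>y. fst (W (y, t))) has_derivative (\<lambda>v. snd (W (x, t)) \<bullet> v)) (at x)" if "t > 0" for t x
    by (rule has_derivative_W[OF that])
  fix a b :: real assume a: "0 < a" "a \<le> b"
  show "\<exists>B. \<forall>t\<in>{a..b}. (\<integral>x. \<bar>fst (W (x, t))\<bar> \<partial>lborel) + (\<integral>x. norm (snd (W (x, t))) \<partial>lborel) \<le> B"
  \<comment> \<open>The gradient bound behaves like t^(-1/2), hence is worst at the left end of
    [a, b].\<close>
  proof (intro exI[of _ "2 * B * mass + 2 * B * mass / sqrt a"] ballI add_mono)
    fix t assume t: "t \<in> {a..b}"
    then have t0: "t > 0" using a by simp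
    show "(\<integral>x. \<bar>fst (W (x, t))\<bar> \<partial>lborel) \<le> 2 * B * mass" by (rule cons(2)[OF t0 t0])
    have "(\<integral>x. norm (snd (W (x, t))) \<partial>lborel) \<le> 2 * B * mass / sqrt t" by (rule cons(4)[OF t0 t0])
    also have "\<dots> \<le> 2 * B * mass / sqrt a" using t a E by (intro divide_left_mono) auto
    finally show "(\<integral>x. norm (snd (W (x, t))) \<partial>lborel) \<le> 2 * B * mass / sqrt a" .
  qed
next
  show "AE z in lborel \<Otimes>\<^sub>M lborel. 0 < snd z \<longrightarrow>
      (let x = fst z; t = snd z;
           F = (\<lambda>(\<xi>, s). heat_kernel (x - \<xi>) (t - s) * f \<xi> s (fst (W (\<xi>, s))) (snd (W (\<xi>, s))))
       in set_integrable (lborel \<Otimes>\<^sub>M lborel) (UNIV \<times> {0<..<t}) F \<and>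
          fst (W (x, t)) = (\<integral>\<xi>. heat_kernel (x - \<xi>) t * \<phi> \<xi> \<partial>lborel) + (LINT w:UNIV \<times> {0<..<t}|lborel \<Otimes>\<^sub>M lborel. F w))"
    \<comment> \<open>The integral equation holds at every point with t > 0, not merely almost
      everywhere.\<close>
    unfolding Let_def by (intro AE_I2 impI conjI duhamel_formula)
qed

end

section \<open>Choice of the supersolution and assembly of (i), (ii) and (iii)\<close>

theorem theorem3p1:
  fixes f :: "'a::euclidean_space \<Rightarrow> real \<Rightarrow> real \<Rightarrow> 'a \<Rightarrow> real"
    and \<phi> :: "'a \<Rightarrow> real" and K C A :: real
  assumes K: "K \<ge> 0"
    and phi: "\<phi> \<in> L1_K K"
    and f_cont: "continuous_on (UNIV \<times> {0<..} \<times> UNIV \<times> UNIV) (\<lambda>(x, t, p, q). f x t p q)"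
    and C: "C > 0" and A: "A > 1"
    and f_bound: "\<And>x t p q. t > 0 \<Longrightarrow>
        \<bar>f x t p q\<bar> \<le> C * (1 + t) powr (- A) * (\<bar>p\<bar> + (1 + t) powr (1/2) * norm q)"
  shows "\<exists>u Du. is_solution f \<phi> u Du
    \<and> continuous_on (UNIV \<times> {0<..}) (\<lambda>(x, t). u x t)
    \<and> continuous_on (UNIV \<times> {0<..}) (\<lambda>(x, t). Du x t)
    \<and> (\<forall>q::ereal. 1 \<le> q \<longrightarrow>
         (SUP t\<in>{0<..}. ereal (t powr (real DIM('a) / 2 * (1 - inv_exp q)))
             * (Lp_norm q (\<lambda>x. u x t) + ereal (t powr (1/2)) * Lp_norm q (\<lambda>x. Du x t))) < \<infinity>)
    \<and> (\<forall>l. 0 \<le> l \<and> l \<le> K \<longrightarrow>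
         (SUP t\<in>{0<..}. ennreal ((1 + t) powr (- l / 2))
             * (wnorm l (\<lambda>x. u x t) + ennreal (t powr (1/2)) * wnorm l (\<lambda>x. Du x t))) < \<infinity>)
    \<and> (\<exists>M::real.
         ((\<lambda>t. \<integral>x. u x t \<partial>lborel) \<longlongrightarrow> M) at_top
       \<and> set_integrable (lborel \<Otimes>\<^sub>M lborel) (UNIV \<times> {0<..}) (\<lambda>(x, t). f x t (u x t) (Du x t))
       \<and> M = (\<integral>x. \<phi> x \<partial>lborel)
             + (LINT z:UNIV \<times> {0<..}|lborel \<Otimes>\<^sub>M lborel. f (fst z) (snd z) (u (fst z) (snd z)) (Du (fst z) (snd z)))
       \<and> (\<forall>q::ereal. 1 \<le> q \<longrightarrow>
            ((\<lambda>t. ereal (t powr (real DIM('a) / 2 * (1 - inv_exp q)))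
                   * Lp_norm q (\<lambda>x. u x t - M * gauss x t)) \<longlongrightarrow> 0) at_top
          \<and> ((\<lambda>t. ereal (t powr (real DIM('a) / 2 * (1 - inv_exp q) + 1/2))
                   * Lp_norm q (\<lambda>x. Du x t - M *\<^sub>R grad (\<lambda>y. gauss y t) x)) \<longlongrightarrow> 0) at_top))"
proof -
  define L where "L = 2 * 2 powr (real DIM('a) / 2) * (C * 2 powr (A + 1))"
  have L: "0 < L" using C by (simp add: L_def)
  have c0: "0 < 2 powr (real DIM('a) / 2)" by simp
  \<comment> \<open>The supersolution is taken with c = 2^(N/2), the loss in the passage from the
    kernel to the one of doubled time.\<close>
  obtain \<beta> B where \<beta>: "\<beta> \<in> borel_measurable borel" "\<And>s. 0 < \<beta> s" "\<And>s. 0 < s \<Longrightarrow> \<beta> s \<le> B"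
    "\<And>r s. 0 < r \<Longrightarrow> r \<le> s \<Longrightarrow> \<beta> r \<le> \<beta> s"
    "\<And>t. t > 0 \<Longrightarrow> \<exists>p\<ge>0. (\<integral>\<^sup>+s\<in>{0<..<t}. ennreal ((t - s) powr (- (1/2)) * (L * kw A s * \<beta> s)) \<partial>lborel) \<le> ennreal p
        \<and> 2 powr (real DIM('a) / 2) * (1 + sqrt t * p) \<le> \<beta> t"
    using exists_supersolution[OF A c0 L] by blast
  interpret decaying_nonlinearity \<phi> f C A \<beta> B L
  proof
    show "integrable lborel \<phi>" using phi by (simp add: L1_K_def)
  qed (use f_cont C A f_bound \<beta> in \<open>simp_all add: L_def\<close>)
  obtain W where W: "W \<in> borel_measurable borel" "dominated W"
    "\<And>x t. t > 0 \<Longrightarrow> W (x, t) = init.potential \<phi> (x, t) + duh.potential (src 0 W) (x, t)"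
    using exists_mild_solution by blast
  interpret mild_solution \<phi> f C A \<beta> B L W
    by unfold_locales (use W in auto)
  have S: "{z::'a \<times> real. snd z > 0} = UNIV \<times> {0<..}" by auto
  have cont: "continuous_on (UNIV \<times> {0<..}) (\<lambda>(x, t). fst (W (x, t)))" "continuous_on (UNIV \<times> {0<..}) (\<lambda>(x, t). snd (W (x, t)))"
    using continuous_on_fst[OF continuous_on_W] continuous_on_snd[OF continuous_on_W]
    by (simp_all add: S case_prod_beta')
  have wfin: "wnorm l \<phi> < \<infinity>" if "l \<le> K" for l
  proof -
    have "wnorm l \<phi> \<le> wnorm K \<phi>"
      \<comment> \<open>The weight increases with its exponent because its base 1 + |x| is at least
        1, so finiteness for K gives finiteness for every smaller l.\<close>
      unfolding wnorm_def using that
      by (intro nn_integral_mono ennreal_leI mult_right_mono powr_mono) auto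
    then show ?thesis using phi by (auto simp: L1_K_def intro: le_less_trans)
  qed
  have F_set: "set_integrable (lborel \<Otimes>\<^sub>M lborel) (UNIV \<times> {0<..}) (\<lambda>(x, t). f x t (fst (W (x, t))) (snd (W (x, t))))"
    using F_integrable unfolding set_integrable_def lborel_prod
    by (simp only: case_prod_beta' prod.collapse indicator_F)
  have M_eq: "M = (\<integral>x. \<phi> x \<partial>lborel) + (LINT z:UNIV \<times> {0<..}|lborel \<Otimes>\<^sub>M lborel. f (fst z) (snd z) (fst (W (fst z, snd z))) (snd (W (fst z, snd z))))"
    unfolding M_def set_lebesgue_integral_def lborel_prod by (simp only: prod.collapse indicator_F)
  have lim: "((\<lambda>t. ereal (t powr (real DIM('a) / 2 * (1 - inv_exp q))) * Lp_norm q (\<lambda>x. fst (W (x, t)) - M * gauss x t)) \<longlongrightarrow> 0) at_top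
     \<and> ((\<lambda>t. ereal (t powr (real DIM('a) / 2 * (1 - inv_exp q) + 1/2)) * Lp_norm q (\<lambda>x. snd (W (x, t)) - M *\<^sub>R grad (\<lambda>y. gauss y t) x)) \<longlongrightarrow> 0) at_top"
    if "1 \<le> q" for q
  \<comment> \<open>The residual is expressed by \<open>gauss\<close> and \<open>grad\<close> for
    positive t only, which is enough for a limit at infinity.\<close>
  proof (rule conjI[OF Lim_transform_eventually[OF Lp_norm_residual_limits(1)[OF that]]
        Lim_transform_eventually[OF Lp_norm_residual_limits(2)[OF that]]])
    show "\<forall>\<^sub>F t in at_top. ereal (t powr (real DIM('a) / 2 * (1 - inv_exp q))) * Lp_norm q (\<lambda>x. fst (residual t x))
       = ereal (t powr (real DIM('a) / 2 * (1 - inv_exp q))) * Lp_norm q (\<lambda>x. fst (W (x, t)) - M * gauss x t)"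
      using eventually_gt_at_top[of 0] by eventually_elim (simp only: residual_eq)
    show "\<forall>\<^sub>F t in at_top. ereal (t powr (real DIM('a) / 2 * (1 - inv_exp q) + 1/2)) * Lp_norm q (\<lambda>x. snd (residual t x))
       = ereal (t powr (real DIM('a) / 2 * (1 - inv_exp q) + 1/2)) * Lp_norm q (\<lambda>x. snd (W (x, t)) - M *\<^sub>R grad (\<lambda>y. gauss y t) x)"
      using eventually_gt_at_top[of 0] by eventually_elim (simp only: residual_eq)
  qed
  show ?thesis
    by (rule exI[of _ "\<lambda>x t. fst (W (x, t))"], rule exI[of _ "\<lambda>x t. snd (W (x, t))"],
        intro conjI allI impI exI[of _ M])
      (rule is_solution_W cont total_mass_limit F_set M_eq
        | erule Lp_norm_bounded lim[THEN conjunct1] lim[THEN conjunct2]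
        | (elim conjE, erule wnorm_bounded, erule wfin))+
qed
end
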